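(* For any integer $l\ge 1$, we have, as $N\to\infty$ through the positive integers, \[ C_{0,1,l}(N) = b^N N^{-l-1} H_l(N) + O\big(b^N N^{-l-117/112}\big), \] where $b = 1/|1-e^{z_0}|\approx 1.07$ and $H_l$ is a bounded function (of a real variable $N$) with period $p = 2\pi/|\arg(1-e^{z_0})|\approx 31.96$, given by \[ H_l(N) = \frac{(-1)^{l-1}}{\pi}\sqrt{-\frac{z_0(1-e^{z_0})}{\rho^2 e^{z_0}}}\left(\Im\left(\frac{\rho(-z_0)^{l-1/2}}{\sqrt{1-e^{z_0}}}\right)\cos\big(N\arg(1-e^{z_0})\big) - \Re\left(\frac{\rho(-z_0)^{l-1/2}}{\sqrt{1-e^{z_0}}}\right)\sin\big(N\arg(1-e^{z_0})\big)\right). \] The implied constant may depend on $l$.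
   Context: For a positive integer $N$, the numbers $C_{h,k,l}(N)$ are the coefficients of the partial fraction decomposition \[ \prod_{j=1}^N\frac{1}{1-x^j} = \sum_{k=1}^N\ \sum_{\substack{0\le h<k\\ \gcd(h,k)=1}}\ \sum_{l=1}^{\lfloor N/k\rfloor}\frac{C_{h,k,l}(N)}{(x-e^{2\pi i h/k})^l}. \] Thus $C_{0,1,l}(N)$ is the coefficient of $(x-1)^{-l}$ in the Laurent expansion of $\prod_{j=1}^N(1-x^j)^{-1}$ at $x=1$. The dilogarithm is $\mathrm{Li}_2(w)=\sum_{k\ge1}w^k/k^2$ for $|w|<1$. The number $z_0\approx -1.61+7.42i$ is the solution of \[ \log(1-e^z)+\frac1z\left(\mathrm{Li}_2(e^z)-\frac{\pi^2}{6}\right)=0 \] that is the unique root within distance $1$ of $-1.61+7.42i$. Moreover $\rho=e^{ia}$, where \[ a=\frac{\pi}{2}-\frac12\arg\left(\frac{e^{z_0}}{z_0(1-e^{z_0})}\right)\approx 1.79. \] All logarithms, arguments, square roots and complex powers are principal branches. The number $-z_0(1-e^{z_0})/(\rho^2e^{z_0})$ is real and positive. *)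

theory Defs
  imports "HOL-Analysis.Analysis" "HOL-Library.Landau_Symbols"
begin

text \<open>
  The identity of rational functions is stated pointwise at all complex numbers that are not poles.
  Coefficients outside the index range of the triple sum are normalised to zero, so that a
  coefficient family is determined uniquely.
\<close>

definition is_partial_fraction_coeffs :: "nat \<Rightarrow> (nat \<Rightarrow> nat \<Rightarrow> nat \<Rightarrow> complex) \<Rightarrow> bool" where
  "is_partial_fraction_coeffs N c \<longleftrightarrow>
     (\<forall>h k l. \<not> (k \<in> {1..N} \<and> h < k \<and> coprime h k \<and> l \<in> {1..N div k}) \<longrightarrow> c h k l = 0) \<and>
     (\<forall>x::complex. (\<forall>j\<in>{1..N}. x ^ j \<noteq> 1) \<longrightarrow>
        (\<Prod>j=1..N. 1 / (1 - x ^ j)) =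
        (\<Sum>k=1..N. \<Sum>h | h < k \<and> coprime h k. \<Sum>l=1..N div k.
           c h k l / (x - exp (2 * of_real pi * \<i> * of_nat h / of_nat k)) ^ l))"

definition C :: "nat \<Rightarrow> nat \<Rightarrow> nat \<Rightarrow> nat \<Rightarrow> complex" where
  "C h k l N = (THE c. is_partial_fraction_coeffs N c) h k l"

text \<open>The series represents the dilogarithm for \<open>norm w < 1\<close>, the only case that is used.\<close>

definition Li2 :: "complex \<Rightarrow> complex" where
  "Li2 w = (\<Sum>k. w ^ Suc k / of_nat (Suc k) ^ 2)"

definition z0 :: complex where
  "z0 = (THE z. dist z (Complex (- 1.61) 7.42) \<le> 1 \<and>
                Ln (1 - exp z) + 1 / z * (Li2 (exp z) - of_real (pi ^ 2 / 6)) = 0)"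

definition rho :: complex where
  "rho = exp (\<i> * of_real (pi / 2 - 1 / 2 * Arg (exp z0 / (z0 * (1 - exp z0)))))"

definition b :: real where
  "b = 1 / norm (1 - exp z0)"

definition p :: real where
  "p = 2 * pi / \<bar>Arg (1 - exp z0)\<bar>"

text \<open>
  The radicand of the first square root is in fact a positive real number, so the values are real;
  the type is complex only because the principal complex root is written literally.
\<close>

definition H :: "nat \<Rightarrow> real \<Rightarrow> complex" where
  "H l x =
     (let w = rho * (- z0) powr (of_nat l - 1 / 2) / csqrt (1 - exp z0);
          \<theta> = Arg (1 - exp z0)
      in (- 1) ^ (l - 1) / of_real pi * csqrt (- (z0 * (1 - exp z0)) / (rho ^ 2 * exp z0)) *
         of_real (Im w * cos (x * \<theta>) - Re w * sin (x * \<theta>)))"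

end

theory Submission
  imports Defs "HOL-Complex_Analysis.Complex_Analysis" "HOL-Probability.Distributions"
    "HOL-Real_Asymp.Real_Asymp" "HOL-Computational_Algebra.Fundamental_Theorem_Algebra"
begin

text \<open>
  By the residue theorem, $2\pi i\,C_{0,1,l}(N)$ is the integral of $(x-1)^{l-1}\prod_j (1-x^j)^{-1}$
  around $x = 1$. The substitution $x = e^{z/N}$ and the trapezoidal rule for
  $\sum_j \log((e^{jz/N}-1)/(jz/N))$ turn the integrand into
  $\frac{N^N}{e^N N!}N^{-l}$ times an amplitude times the $N$-th power of a fixed function, whose
  logarithm in the left half plane is $(\mathrm{Li}_2(e^z)-\pi^2/6)/z$. Two critical points of the latter are
  $z_0$ and its conjugate. The contour runs through both of them along the rays they span; elsewhere the integrand
  is exponentially smaller, and Laplace's method at $z_0$ together with Stirling's formula gives the main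
  term with an error smaller by the factor $N^{-1/2}$.
\<close>

section \<open>Partial fractions\<close>

text \<open>The statement takes all roots and logarithms as principal values and gives
  \<open>z0\<close> only by a definite description. Besides the analysis, the proof must therefore
  supply a numerical enclosure of \<open>z0\<close> with its uniqueness, and must match the branches
  that Laplace's method produces with those written in \<open>H\<close>. The contour is shaped by
  the slits: \<open>z0\<close> lies above height 2 pi, while the imaginary axis may be crossed only
  below 2 pi i. It is crossed at height 3 pi / 2, where e^z = -i and the growth rate is minus
  Catalan's constant divided by 3 pi / 2, about -0.19. The rate at \<open>z0\<close> is only about
  0.066, and the estimate at the corner between the horizontal line and the ray stays below it by
  less than 0.002; this is why several decimals of \<open>z0\<close> are carried along. The exponent
  117/112 asks for a saving of N^(-5/112) over the main term, and the factor N^(-1/2) is more than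
  that.\<close>

definition pole_sum :: "complex set \<Rightarrow> (complex \<Rightarrow> nat) \<Rightarrow> (complex \<Rightarrow> complex) \<Rightarrow> bool" where
  "pole_sum Z m f \<longleftrightarrow> (\<exists>c. \<forall>x. x \<notin> Z \<longrightarrow> f x = (\<Sum>\<zeta>\<in>Z. \<Sum>l=1..m \<zeta>. c \<zeta> l / (x - \<zeta>) ^ l))"

lemma pole_sum_add:
  assumes "pole_sum Z m f" "pole_sum Z m g"
  shows "pole_sum Z m (\<lambda>x. f x + g x)"
proof -
  obtain c where c: "\<And>x. x \<notin> Z \<Longrightarrow> f x = (\<Sum>\<zeta>\<in>Z. \<Sum>l=1..m \<zeta>. c \<zeta> l / (x - \<zeta>) ^ l)"
    using assms(1) by (auto simp: pole_sum_def)
  obtain d where d: "\<And>x. x \<notin> Z \<Longrightarrow> g x = (\<Sum>\<zeta>\<in>Z. \<Sum>l=1..m \<zeta>. d \<zeta> l / (x - \<zeta>) ^ l)"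
    using assms(2) by (auto simp: pole_sum_def)
  show ?thesis unfolding pole_sum_def
    by (rule exI[of _ "\<lambda>\<zeta> l. c \<zeta> l + d \<zeta> l"]) (simp add: c d sum.distrib add_divide_distrib)
qed

lemma pole_sum_scale:
  assumes "pole_sum Z m f"
  shows "pole_sum Z m (\<lambda>x. a * f x)"
proof -
  obtain c where c: "\<And>x. x \<notin> Z \<Longrightarrow> f x = (\<Sum>\<zeta>\<in>Z. \<Sum>l=1..m \<zeta>. c \<zeta> l / (x - \<zeta>) ^ l)"
    using assms(1) by (auto simp: pole_sum_def)
  show ?thesis unfolding pole_sum_def
    by (rule exI[of _ "\<lambda>\<zeta> l. a * c \<zeta> l"]) (simp add: c sum_distrib_left)
qed

lemma pole_sum_cong:
  assumes "pole_sum Z m f" "\<And>x. x \<notin> Z \<Longrightarrow> f x = g x"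
  shows "pole_sum Z m g"
  using assms unfolding pole_sum_def by auto

lemma pole_sum_zero: "pole_sum Z m (\<lambda>x. 0)"
  unfolding pole_sum_def by (rule exI[of _ "\<lambda>_ _. 0"]) simp

lemma pole_sum_sum:
  assumes "\<And>i. i \<in> I \<Longrightarrow> pole_sum Z m (f i)"
  shows "pole_sum Z m (\<lambda>x. \<Sum>i\<in>I. f i x)"
  using assms
proof (induction I rule: infinite_finite_induct)
  case (insert i I)
  then show ?case by (simp add: pole_sum_add)
qed (auto simp: pole_sum_zero)

lemma pole_sum_basic:
  assumes "finite Z" "\<eta> \<in> Z" "1 \<le> k" "k \<le> m \<eta>"
  shows "pole_sum Z m (\<lambda>x. 1 / (x - \<eta>) ^ k)"
  unfolding pole_sum_def
proof (rule exI[of _ "\<lambda>\<zeta> l. if \<zeta> = \<eta> \<and> l = k then 1 else 0"], intro allI impI)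
  fix x assume "x \<notin> Z"
  have "(\<Sum>\<zeta>\<in>Z. \<Sum>l=1..m \<zeta>. (if \<zeta> = \<eta> \<and> l = k then 1 else 0) / (x - \<zeta>) ^ l)
      = (\<Sum>\<zeta>\<in>Z. if \<zeta> = \<eta> then 1 / (x - \<eta>) ^ k else 0)"
  proof (rule sum.cong[OF refl])
    fix \<zeta> assume "\<zeta> \<in> Z"
    have "(\<Sum>l=1..m \<zeta>. (if \<zeta> = \<eta> \<and> l = k then 1 else 0) / (x - \<zeta>) ^ l)
       = (\<Sum>l=1..m \<zeta>. if l = k then (if \<zeta> = \<eta> then 1 / (x - \<eta>) ^ k else 0) else 0)"
      by (rule sum.cong) auto
    also have "\<dots> = (if \<zeta> = \<eta> then 1 / (x - \<eta>) ^ k else 0)"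
      using assms by auto
    finally show "(\<Sum>l=1..m \<zeta>. (if \<zeta> = \<eta> \<and> l = k then 1 else 0) / (x - \<zeta>) ^ l) = (if \<zeta> = \<eta> then 1 / (x - \<eta>) ^ k else 0)" .
  qed
  also have "\<dots> = 1 / (x - \<eta>) ^ k" using assms by simp
  finally show "1 / (x - \<eta>) ^ k = (\<Sum>\<zeta>\<in>Z. \<Sum>l=1..m \<zeta>. (if \<zeta> = \<eta> \<and> l = k then 1 else 0) / (x - \<zeta>) ^ l)" by simp
qed

text \<open>If the two points coincide, the order simply rises by one. Otherwise the product of the
  two fractions is split, which lowers the exponent at \<open>\<zeta>\<close>, and induction on that
  exponent finishes.\<close>

lemma pole_sum_basic_divide:
  assumes Z: "finite Z" "\<zeta> \<in> Z" "\<eta> \<in> Z" and k: "1 \<le> k" "k \<le> m \<zeta>"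
  shows "pole_sum Z (m(\<eta> := Suc (m \<eta>))) (\<lambda>x. 1 / (x - \<zeta>) ^ k / (x - \<eta>))"
proof (cases "\<zeta> = \<eta>")
  case True
  have "pole_sum Z (m(\<eta> := Suc (m \<eta>))) (\<lambda>x. 1 / (x - \<eta>) ^ Suc k)"
    using assms True by (intro pole_sum_basic) auto
  then show ?thesis by (rule pole_sum_cong) (simp add: True)
next
  case False
  show ?thesis using k
  proof (induction k)
    case (Suc k)
    let ?m = "m(\<eta> := Suc (m \<eta>))"
    have A: "pole_sum Z ?m (\<lambda>x. 1 / (x - \<zeta>) ^ Suc k)"
      using Suc.prems False Z by (intro pole_sum_basic) auto
    have B: "pole_sum Z ?m (\<lambda>x. 1 / (x - \<zeta>) ^ k / (x - \<eta>))"
    proof (cases "k = 0")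
      case True
      \<comment> \<open>The raised bound \<open>Suc (m \<eta>)\<close> leaves room for this term of
        order one even when \<open>m \<eta>\<close> is 0.\<close>
      have "pole_sum Z ?m (\<lambda>x. 1 / (x - \<eta>) ^ 1)"
        using Z by (intro pole_sum_basic) auto
      then show ?thesis using True by simp
    next
      case False
      then show ?thesis using Suc.IH Suc.prems by (simp del: fun_upd_apply)
    qed
    \<comment> \<open>With u = x - \<open>\<zeta>\<close> and v = x - \<open>\<eta>\<close> this is
      the identity 1/(u^(k+1) v) = (1/u^(k+1) - 1/(u^k v)) / (v - u).\<close>
    have "pole_sum Z ?m (\<lambda>x. (1 / (\<zeta> - \<eta>)) * (1 / (x - \<zeta>) ^ Suc k + (-1) * (1 / (x - \<zeta>) ^ k / (x - \<eta>))))"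
      by (intro pole_sum_scale pole_sum_add A B)
    then show ?case
    proof (rule pole_sum_cong)
      fix x assume "x \<notin> Z"
      then have nz: "x - \<zeta> \<noteq> 0" "x - \<eta> \<noteq> 0" "\<zeta> - \<eta> \<noteq> 0" using Z False by auto
      define u v where "u = x - \<zeta>" and "v = x - \<eta>"
      have uv: "u \<noteq> 0" "v \<noteq> 0" "v - u \<noteq> 0" "\<zeta> - \<eta> = v - u" using nz by (auto simp: u_def v_def)
      show "(1 / (\<zeta> - \<eta>)) * (1 / (x - \<zeta>) ^ Suc k + (-1) * (1 / (x - \<zeta>) ^ k / (x - \<eta>))) = 1 / (x - \<zeta>) ^ Suc k / (x - \<eta>)"
        unfolding u_def[symmetric] v_def[symmetric] uv(4) using uv(1-3) by (simp add: divide_simps)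
    qed
  qed simp
qed

lemma pole_sum_divide:
  assumes "finite Z" "\<eta> \<in> Z" "pole_sum Z m f"
  shows "pole_sum Z (m(\<eta> := Suc (m \<eta>))) (\<lambda>x. f x / (x - \<eta>))"
proof -
  obtain c where c: "\<And>x. x \<notin> Z \<Longrightarrow> f x = (\<Sum>\<zeta>\<in>Z. \<Sum>l=1..m \<zeta>. c \<zeta> l / (x - \<zeta>) ^ l)"
    using assms(3) by (auto simp: pole_sum_def)
  have "pole_sum Z (m(\<eta> := Suc (m \<eta>))) (\<lambda>x. \<Sum>\<zeta>\<in>Z. \<Sum>l=1..m \<zeta>. c \<zeta> l * (1 / (x - \<zeta>) ^ l / (x - \<eta>)))"
    using assms by (intro pole_sum_sum pole_sum_scale pole_sum_basic_divide) auto
  then show ?thesis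
    by (rule pole_sum_cong) (simp add: c sum_divide_distrib)
qed

lemma pole_sum_divide_prod:
  assumes "finite Z" "R \<subseteq> Z" "pole_sum Z m f"
  shows "pole_sum Z (\<lambda>\<zeta>. m \<zeta> + (if \<zeta> \<in> R then 1 else 0)) (\<lambda>x. f x / (\<Prod>\<eta>\<in>R. x - \<eta>))"
proof -
  have "finite R" using assms finite_subset by blast
  then show ?thesis using assms(2)
  proof (induction R)
    case empty
    then show ?case using assms by simp
  next
    case (insert \<eta> R)
    have "pole_sum Z ((\<lambda>\<zeta>. m \<zeta> + (if \<zeta> \<in> R then 1 else 0))(\<eta> := Suc (m \<eta> + (if \<eta> \<in> R then 1 else 0)))) (\<lambda>x. f x / (\<Prod>\<eta>\<in>R. x - \<eta>) / (x - \<eta>))"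
      using insert by (intro pole_sum_divide assms) auto
    also have "(\<lambda>\<zeta>. m \<zeta> + (if \<zeta> \<in> R then 1 else 0))(\<eta> := Suc (m \<eta> + (if \<eta> \<in> R then 1 else 0)))
       = (\<lambda>\<zeta>. m \<zeta> + (if \<zeta> \<in> insert \<eta> R then 1 else 0))"
      using insert by (auto simp: fun_eq_iff)
    finally show ?case
      using insert by (simp add: divide_simps mult.commute)
  qed
qed

text \<open>The derivative n x^(n-1) vanishes only at 0, which is not a root, so all roots are
  simple and the monic polynomial is the product over its set of roots. Hence dividing by 1 - x^n
  raises the pole order by one at each n-th root of unity.\<close>

lemma power_minus_one_eq_prod:
  assumes "n \<ge> 1"
  shows "x ^ n - 1 = (\<Prod>\<zeta> | \<zeta> ^ n = 1. x - \<zeta> :: complex)"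
proof -
  define q :: "complex poly" where "q = monom 1 n - 1"
  have poly: "poly q z = z ^ n - 1" for z by (simp add: q_def poly_monom)
  have deg: "degree q = n"
    unfolding q_def using assms
    by (metis (no_types) degree_add_eq_left degree_1 degree_minus degree_monom_eq diff_conv_add_uminus less_le_trans one_neq_zero zero_less_one)
  have lc: "lead_coeff q = 1" unfolding deg using assms by (simp add: q_def)
  have "rsquarefree q"
    unfolding rsquarefree_roots
  proof (intro allI notI)
    fix a assume a: "poly q a = 0 \<and> poly (pderiv q) a = 0"
    have "pderiv q = smult (of_nat n) (monom 1 (n - 1))"
      by (simp add: q_def pderiv_diff pderiv_monom smult_monom)
    with a assms have "a ^ (n - 1) = 0" by (simp add: poly_monom)
    then have "a = 0" by simp
    with a assms show False by (simp add: poly power_0_left)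
  qed
  then have "q = (\<Prod>z | poly q z = 0. [:-z, 1:])"
    using complex_poly_decompose_rsquarefree[of q] lc by simp
  then have "poly q x = (\<Prod>z | poly q z = 0. x - z)"
    by (metis (no_types, lifting) poly_prod prod.cong poly_pCons mult.right_neutral poly_0 mult_zero_right add.right_neutral add.commute diff_conv_add_uminus)
  then show ?thesis by (simp add: poly)
qed

text \<open>Multiply the identity by (x - \<open>\<eta>\<close>)^L, where L is the largest order
  with a nonzero coefficient at \<open>\<eta>\<close>, and let x tend to \<open>\<eta>\<close>: only
  the coefficient of order L survives, so it would be 0.\<close>

lemma pole_sum_unique:
  assumes Z: "finite Z"
    and zero: "\<And>x. x \<notin> Z \<Longrightarrow> (\<Sum>\<zeta>\<in>Z. \<Sum>l=1..m \<zeta>. d \<zeta> l / (x - \<zeta>) ^ l) = (0::complex)"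
    and \<eta>: "\<eta> \<in> Z" and l: "1 \<le> l" "l \<le> m \<eta>"
  shows "d \<eta> l = 0"
proof (rule ccontr)
  assume nz: "d \<eta> l \<noteq> 0"
  define L where "L = Max {k \<in> {1..m \<eta>}. d \<eta> k \<noteq> 0}"
  have fin: "finite {k \<in> {1..m \<eta>}. d \<eta> k \<noteq> 0}" by simp
  have "L \<in> {k \<in> {1..m \<eta>}. d \<eta> k \<noteq> 0}"
    unfolding L_def using nz l by (intro Max_in) auto
  then have L: "1 \<le> L" "L \<le> m \<eta>" "d \<eta> L \<noteq> 0" by auto
  have above: "d \<eta> k = 0" if "L < k" "k \<le> m \<eta>" for k
    using Max_ge[OF fin, of k] that L unfolding L_def[symmetric] by fastforce
  \<comment> \<open>The part at \<open>\<eta>\<close> is written as a polynomial in x -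
    \<open>\<eta>\<close>, which makes \<open>F\<close> continuous at \<open>\<eta>\<close>
    itself.\<close>
  define F where "F = (\<lambda>x. (\<Sum>\<zeta>\<in>Z-{\<eta>}. \<Sum>k=1..m \<zeta>. d \<zeta> k / (x - \<zeta>) ^ k) * (x - \<eta>) ^ L
      + (\<Sum>k=1..L. d \<eta> k * (x - \<eta>) ^ (L - k)))"
  have "F x = 0" if "x \<notin> Z" for x
  proof -
    have x: "x - \<eta> \<noteq> 0" using that \<eta> by auto
    have "(\<Sum>k=1..m \<eta>. d \<eta> k / (x - \<eta>) ^ k) = (\<Sum>k=1..L. d \<eta> k / (x - \<eta>) ^ k)"
      using L above by (intro sum.mono_neutral_right) auto
    then have "(\<Sum>k=1..m \<eta>. d \<eta> k / (x - \<eta>) ^ k) * (x - \<eta>) ^ L = (\<Sum>k=1..L. d \<eta> k * (x - \<eta>) ^ (L - k))"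
      using x by (simp add: sum_distrib_right power_diff)
    moreover have "(\<Sum>\<zeta>\<in>Z. \<Sum>k=1..m \<zeta>. d \<zeta> k / (x - \<zeta>) ^ k) = (\<Sum>k=1..m \<eta>. d \<eta> k / (x - \<eta>) ^ k) + (\<Sum>\<zeta>\<in>Z-{\<eta>}. \<Sum>k=1..m \<zeta>. d \<zeta> k / (x - \<zeta>) ^ k)"
      using Z \<eta> by (rule sum.remove)
    ultimately show ?thesis using zero[OF that] unfolding F_def
      by (metis (no_types, lifting) add.commute distrib_right mult_zero_left)
  qed
  moreover have "open (- (Z - {\<eta>}))" using Z by (intro open_Compl finite_imp_closed) auto
  then have "eventually (\<lambda>x. x \<in> - (Z - {\<eta>})) (at \<eta>)"
    by (intro eventually_at_in_open') auto
  then have "eventually (\<lambda>x. x \<notin> Z) (at \<eta>)"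
    using eventually_neq_at_within[of \<eta> \<eta>] by eventually_elim auto
  ultimately have "eventually (\<lambda>x. F x = 0) (at \<eta>)" by (auto elim: eventually_mono)
  then have lim0: "(F \<longlongrightarrow> 0) (at \<eta>)" by (simp add: tendsto_eventually)
  have "(F \<longlongrightarrow> (\<Sum>\<zeta>\<in>Z-{\<eta>}. \<Sum>k=1..m \<zeta>. d \<zeta> k / (\<eta> - \<zeta>) ^ k) * (\<eta> - \<eta>) ^ L
      + (\<Sum>k=1..L. d \<eta> k * (\<eta> - \<eta>) ^ (L - k))) (at \<eta>)"
    unfolding F_def by (intro tendsto_intros) auto
  also have "(\<Sum>k=1..L. d \<eta> k * (\<eta> - \<eta>) ^ (L - k)) = (\<Sum>k\<in>{L}. d \<eta> k)"
    using L by (intro sum.mono_neutral_cong_right) auto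
  finally have "(F \<longlongrightarrow> d \<eta> L) (at \<eta>)" using L by (simp add: power_0_left)
  with lim0 have "d \<eta> L = 0" using tendsto_unique by (metis trivial_limit_at)
  with L show False by simp
qed

section \<open>Roots of unity of order at most \<open>N\<close> as the poles of the product\<close>

definition farey :: "nat \<Rightarrow> (nat \<times> nat) set" where
  "farey N = (SIGMA k:{1..N}. {h. h < k \<and> coprime h k})"

definition farey_root :: "nat \<times> nat \<Rightarrow> complex" where
  "farey_root = (\<lambda>(k, h). exp (2 * of_real pi * \<i> * of_nat h / of_nat k))"

text \<open>For coprime h and k the number exp(2 pi i h / k) is a primitive k-th root of unity, so
  divisibility decides which factors 1 - x^j vanish there. The root 1 itself is represented by the
  pair (1, 0).\<close>

lemma farey_root_power_eq_1_iff:
  assumes "(k, h) \<in> farey N"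
  shows "farey_root (k, h) ^ j = 1 \<longleftrightarrow> k dvd j"
proof -
  have k: "k \<ge> 1" "coprime h k" using assms by (auto simp: farey_def)
  have "farey_root (k, h) ^ j = exp (2 * of_real pi * \<i> * of_nat (h * j) / of_nat k)"
    unfolding farey_root_def prod.case exp_of_nat_mult[symmetric] by (simp add: algebra_simps)
  also have "\<dots> = 1 \<longleftrightarrow> k dvd h * j" using complex_root_unity_eq_1[of k "h * j"] k by simp
  also have "\<dots> \<longleftrightarrow> k dvd j" using k by (simp add: coprime_commute coprime_dvd_mult_right_iff)
  finally show ?thesis .
qed

text \<open>The order of the root recovers k, and then h is determined modulo k, hence determined
  because h < k.\<close>

lemma inj_on_farey_root: "inj_on farey_root (farey N)"
proof (rule inj_onI)
  fix a b assume ab: "a \<in> farey N" "b \<in> farey N" "farey_root a = farey_root b"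
  obtain k h k' h' where [simp]: "a = (k, h)" "b = (k', h')" by (cases a, cases b)
  have dv: "k dvd j \<longleftrightarrow> k' dvd j" for j
    using farey_root_power_eq_1_iff[of k h N j] farey_root_power_eq_1_iff[of k' h' N j] ab by simp
  have "k dvd k'" "k' dvd k" using dv[of k'] dv[of k] by simp_all
  then have [simp]: "k' = k" by (simp add: dvd_antisym)
  have *: "k \<ge> 1" "h < k" "h' < k" using ab by (auto simp: farey_def)
  have "h mod k = h' mod k"
    using complex_root_unity_eq[of k h h'] ab * by (auto simp: farey_root_def)
  with * show "a = b" by simp
qed

lemma finite_farey: "finite (farey N)"
  unfolding farey_def by (intro finite_SigmaI) auto

lemma root_of_unity_in_image:
  assumes "z ^ j = 1" "1 \<le> j" "j \<le> N"
  shows "z \<in> farey_root ` farey N"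
proof -
  obtain a where a: "z = exp (2 * of_real pi * \<i> * of_nat a / of_nat j)" "a < j"
    using complex_roots_unity[of j] assms by auto
  define g where "g = gcd a j"
  have g: "g > 0" "g dvd a" "g dvd j" using assms by (auto simp: g_def)
  have "coprime (a div g) (j div g)" unfolding g_def using assms by (intro div_gcd_coprime) auto
  moreover have "a div g < j div g"
    using a(2) g by (metis dvd_div_mult_self mult_less_cancel2)
  moreover have "1 \<le> j div g" "j div g \<le> N" using g assms
    by (auto simp: Suc_le_eq div_greater_zero_iff dvd_imp_le intro: order.trans[OF div_le_dividend])
  ultimately have "(j div g, a div g) \<in> farey N" by (auto simp: farey_def)
  moreover have "z = farey_root (j div g, a div g)"
  proof -
    have "(of_nat a :: complex) = of_nat (a div g) * of_nat g" "(of_nat j :: complex) = of_nat (j div g) * of_nat g"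
      using g by (metis dvd_div_mult_self of_nat_mult)+
    then have "(of_nat (a div g) / of_nat (j div g) :: complex) = of_nat a / of_nat j"
      using g by simp
    then show ?thesis unfolding a farey_root_def by (metis case_prod_conv times_divide_eq_right)
  qed
  ultimately show ?thesis by blast
qed

lemma farey_root_image_avoid:
  "x \<notin> farey_root ` farey N \<longleftrightarrow> (\<forall>j\<in>{1..N}. x ^ j \<noteq> 1)"
proof
  assume "x \<notin> farey_root ` farey N"
  show "\<forall>j\<in>{1..N}. x ^ j \<noteq> 1"
  proof (intro ballI notI)
    fix j assume "j \<in> {1..N}" "x ^ j = 1"
    then have "x \<in> farey_root ` farey N" by (intro root_of_unity_in_image[of x j N]) auto
    with \<open>x \<notin> farey_root ` farey N\<close> show False by contradiction
  qed
next
  assume *: "\<forall>j\<in>{1..N}. x ^ j \<noteq> 1"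
  show "x \<notin> farey_root ` farey N"
  proof
    assume "x \<in> farey_root ` farey N"
    then obtain k h where kh: "x = farey_root (k, h)" "(k, h) \<in> farey N" by (metis imageE surj_pair)
    have "x ^ k = 1" unfolding kh(1) farey_root_power_eq_1_iff[OF kh(2)] by (rule dvd_refl)
    moreover have "k \<in> {1..N}" using kh(2) by (simp add: farey_def)
    ultimately show False using bspec[OF *, of k] by metis
  qed
qed

text \<open>The admissible pole order at \<open>\<zeta>\<close> counts the factors that vanish
  there. In the inductive step the new factor is minus the product of x - \<open>\<eta>\<close> over
  all roots of unity \<open>\<eta>\<close> of its order, so it adds one exactly at these
  points.\<close>

lemma pole_sum_prod:
  assumes "n \<ge> 1" "n \<le> N"
  shows "pole_sum (farey_root ` farey N) (\<lambda>\<zeta>. card {j\<in>{1..n}. \<zeta> ^ j = 1}) (\<lambda>x. \<Prod>j=1..n. 1 / (1 - x ^ j))"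
  using assms
proof (induction n rule: nat_induct_at_least)
  case base
  have "1 \<in> farey_root ` farey N" using base by (intro root_of_unity_in_image[of _ 1]) auto
  then have "pole_sum (farey_root ` farey N) (\<lambda>\<zeta>. card {j\<in>{1..1}. \<zeta> ^ j = 1}) (\<lambda>x. (-1) * (1 / (x - 1) ^ 1))"
    by (intro pole_sum_scale pole_sum_basic) (auto simp: finite_farey)
  then show ?case by (rule pole_sum_cong) (simp add: divide_simps)
next
  case (Suc n)
  let ?R = "{\<zeta>::complex. \<zeta> ^ Suc n = 1}"
  have "?R \<subseteq> farey_root ` farey N" using Suc.prems root_of_unity_in_image[of _ "Suc n" N] by auto
  then have "pole_sum (farey_root ` farey N) (\<lambda>\<zeta>. card {j\<in>{1..n}. \<zeta> ^ j = 1} + (if \<zeta> \<in> ?R then 1 else 0))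
     (\<lambda>x. (-1) * ((\<Prod>j=1..n. 1 / (1 - x ^ j)) / (\<Prod>\<eta>\<in>?R. x - \<eta>)))"
    using Suc by (intro pole_sum_scale pole_sum_divide_prod) (auto simp: finite_farey)
  also have "(\<lambda>\<zeta>. card {j\<in>{1..n}. \<zeta> ^ j = 1} + (if \<zeta> \<in> ?R then 1 else 0)) = (\<lambda>\<zeta>::complex. card {j\<in>{1..Suc n}. \<zeta> ^ j = 1})"
  proof
    fix \<zeta> :: complex
    have "{j\<in>{1..Suc n}. \<zeta> ^ j = 1} = {j\<in>{1..n}. \<zeta> ^ j = 1} \<union> (if \<zeta> \<in> ?R then {Suc n} else {})"
      by (auto simp: le_Suc_eq)
    then show "card {j\<in>{1..n}. \<zeta> ^ j = 1} + (if \<zeta> \<in> ?R then 1 else 0) = card {j\<in>{1..Suc n}. \<zeta> ^ j = 1}"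
      by auto
  qed
  finally show ?case
  proof (rule pole_sum_cong)
    fix x :: complex
    have "(\<Prod>\<eta>\<in>?R. x - \<eta>) = x ^ Suc n - 1" using power_minus_one_eq_prod[of "Suc n" x] by simp
    moreover have "(-1) * (P / (y - 1)) = P * (1 / (1 - y))" for P y :: complex
      by (metis divide_minus_left minus_diff_eq minus_divide_right mult_minus1 times_divide_eq_right mult.right_neutral)
    ultimately show "(-1) * ((\<Prod>j=1..n. 1 / (1 - x ^ j)) / (\<Prod>\<eta>\<in>?R. x - \<eta>)) = (\<Prod>j=1..Suc n. 1 / (1 - x ^ j))"
      by (simp del: power_Suc)
  qed
qed

text \<open>The factors vanishing at a primitive k-th root are those whose exponent is a multiple of
  k; this produces the upper limit \<open>N div k\<close> of the innermost sum.\<close>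

lemma card_multiples:
  assumes "(k, h) \<in> farey N"
  shows "card {j\<in>{1..N}. farey_root (k, h) ^ j = 1} = N div k"
proof -
  have k: "k \<ge> 1" using assms by (auto simp: farey_def)
  have "{j\<in>{1..N}. farey_root (k, h) ^ j = 1} = (\<lambda>i. k * i) ` {1..N div k}"
  proof (intro equalityI subsetI)
    fix j assume "j \<in> {j\<in>{1..N}. farey_root (k, h) ^ j = 1}"
    then have "k dvd j" "1 \<le> j" "j \<le> N" using farey_root_power_eq_1_iff[OF assms] by auto
    then obtain i where i: "j = k * i" unfolding dvd_def by metis
    have "i \<ge> 1" using i \<open>1 \<le> j\<close> by (cases i) auto
    moreover have "i \<le> N div k" using i \<open>j \<le> N\<close> k by (simp add: less_eq_div_iff_mult_less_eq mult.commute)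
    ultimately show "j \<in> (\<lambda>i. k * i) ` {1..N div k}" using i by auto
  next
    fix j assume "j \<in> (\<lambda>i. k * i) ` {1..N div k}"
    then obtain i where i: "j = k * i" "1 \<le> i" "i \<le> N div k" by (metis atLeastAtMost_iff imageE)
    have "k * i \<le> N" using i k by (simp add: less_eq_div_iff_mult_less_eq mult.commute)
    moreover have "1 \<le> k * i" using i k by simp
    ultimately show "j \<in> {j\<in>{1..N}. farey_root (k, h) ^ j = 1}"
      unfolding i(1) farey_root_power_eq_1_iff[OF assms] by simp
  qed
  moreover have "inj_on (\<lambda>i. k * i) {1..N div k}" using k by (auto simp: inj_on_def)
  ultimately show ?thesis by (simp add: card_image)
qed

text \<open>Reindexing along the injective map \<open>farey_root\<close> turns a sum over index
  triples into a sum over poles, the form in which existence and uniqueness have been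
  proved.\<close>

lemma triple_sum_eq:
  "(\<Sum>k=1..N. \<Sum>h | h < k \<and> coprime h k. \<Sum>l=1..N div k.
           c h k l / (x - exp (2 * of_real pi * \<i> * of_nat h / of_nat k)) ^ l)
   = (\<Sum>\<zeta>\<in>farey_root ` farey N. \<Sum>l=1..card {j\<in>{1..N}. \<zeta> ^ j = 1}.
        (case the_inv_into (farey N) farey_root \<zeta> of (k, h) \<Rightarrow> c h k l) / (x - \<zeta>) ^ l)"
proof -
  have "(\<Sum>k=1..N. \<Sum>h | h < k \<and> coprime h k. \<Sum>l=1..N div k.
           c h k l / (x - exp (2 * of_real pi * \<i> * of_nat h / of_nat k)) ^ l)
    = (\<Sum>(k,h)\<in>farey N. \<Sum>l=1..N div k. c h k l / (x - farey_root (k, h)) ^ l)"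
    unfolding farey_def farey_root_def prod.case by (rule sum.Sigma) auto
  also have "\<dots> = (\<Sum>\<zeta>\<in>farey_root ` farey N. \<Sum>l=1..card {j\<in>{1..N}. \<zeta> ^ j = 1}.
        (case the_inv_into (farey N) farey_root \<zeta> of (k, h) \<Rightarrow> c h k l) / (x - \<zeta>) ^ l)"
    unfolding sum.reindex[OF inj_on_farey_root] o_def
  proof (rule sum.cong[OF refl])
    fix a assume a: "a \<in> farey N"
    obtain k h where kh: "a = (k, h)" by (cases a)
    have "the_inv_into (farey N) farey_root (farey_root (k, h)) = (k, h)"
      using the_inv_into_f_f[OF inj_on_farey_root a] unfolding kh .
    then show "(case a of (k, h) \<Rightarrow> \<Sum>l=1..N div k. c h k l / (x - farey_root (k, h)) ^ l)
      = (\<Sum>l=1..card {j\<in>{1..N}. farey_root a ^ j = 1}.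
          (case the_inv_into (farey N) farey_root (farey_root a) of (k, h) \<Rightarrow> c h k l) / (x - farey_root a) ^ l)"
      unfolding kh card_multiples[OF a[unfolded kh]] by (simp only: prod.case)
  qed
  finally show ?thesis .
qed

text \<open>This makes the definite description in \<open>C\<close> meaningful. Uniqueness applies
  \<open>pole_sum_unique\<close> to the difference of two families; outside the index range both
  vanish by the normalisation.\<close>

lemma ex1_partial_fraction_coeffs:
  assumes "N \<ge> 1"
  shows "\<exists>!c. is_partial_fraction_coeffs N c"
proof (rule ex_ex1I)
  let ?I = "\<lambda>h k l. k \<in> {1..N} \<and> h < k \<and> coprime h k \<and> l \<in> {1..N div k}"
  obtain c where c: "\<And>x. x \<notin> farey_root ` farey N \<Longrightarrow> (\<Prod>j=1..N. 1 / (1 - x ^ j)) =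
      (\<Sum>\<zeta>\<in>farey_root ` farey N. \<Sum>l=1..card {j\<in>{1..N}. \<zeta> ^ j = 1}. c \<zeta> l / (x - \<zeta>) ^ l)"
    using pole_sum_prod[OF assms order.refl] unfolding pole_sum_def by blast
  define c' where "c' = (\<lambda>h k l. if ?I h k l then c (farey_root (k, h)) l else 0)"
  have "is_partial_fraction_coeffs N c'"
    unfolding is_partial_fraction_coeffs_def
  proof (intro conjI allI impI)
    fix x :: complex assume "\<forall>j\<in>{1..N}. x ^ j \<noteq> 1"
    then have x: "x \<notin> farey_root ` farey N" by (simp add: farey_root_image_avoid)
    show "(\<Prod>j=1..N. 1 / (1 - x ^ j)) = (\<Sum>k=1..N. \<Sum>h | h < k \<and> coprime h k. \<Sum>l=1..N div k.
           c' h k l / (x - exp (2 * of_real pi * \<i> * of_nat h / of_nat k)) ^ l)"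
      unfolding triple_sum_eq c[OF x]
    proof (intro sum.cong refl)
      fix \<zeta> l assume \<zeta>: "\<zeta> \<in> farey_root ` farey N" and l: "l \<in> {1..card {j\<in>{1..N}. \<zeta> ^ j = 1}}"
      obtain k h where kh: "(k, h) \<in> farey N" "\<zeta> = farey_root (k, h)" using \<zeta> by auto
      then have "?I h k l" using l card_multiples[OF kh(1)] by (auto simp: farey_def)
      then show "c \<zeta> l / (x - \<zeta>) ^ l = (case the_inv_into (farey N) farey_root \<zeta> of (k, h) \<Rightarrow> c' h k l) / (x - \<zeta>) ^ l"
        using kh by (simp add: the_inv_into_f_f[OF inj_on_farey_root] c'_def)
    qed
  qed (auto simp: c'_def)
  then show "\<exists>c. is_partial_fraction_coeffs N c" by blast
next
  fix c d assume cd: "is_partial_fraction_coeffs N c" "is_partial_fraction_coeffs N d"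
  show "c = d"
  proof (intro ext)
    fix h k l
    show "c h k l = d h k l"
    proof (cases "k \<in> {1..N} \<and> h < k \<and> coprime h k \<and> l \<in> {1..N div k}")
      case False
      then show ?thesis using cd unfolding is_partial_fraction_coeffs_def by simp
    next
      case True
      then have kh: "(k, h) \<in> farey N" by (auto simp: farey_def)
      let ?d = "\<lambda>\<zeta> l. case the_inv_into (farey N) farey_root \<zeta> of (k, h) \<Rightarrow> c h k l - d h k l"
      have "?d (farey_root (k, h)) l = 0"
      proof (rule pole_sum_unique[where Z = "farey_root ` farey N" and m = "\<lambda>\<zeta>. card {j\<in>{1..N}. \<zeta> ^ j = 1}"
            and d = ?d and \<eta> = "farey_root (k, h)"])
        fix x assume "x \<notin> farey_root ` farey N"
        then have "\<forall>j\<in>{1..N}. x ^ j \<noteq> 1" by (simp add: farey_root_image_avoid)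
        then have "(\<Prod>j=1..N. 1 / (1 - x ^ j)) = (\<Sum>k=1..N. \<Sum>h | h < k \<and> coprime h k. \<Sum>l=1..N div k.
            c h k l / (x - exp (2 * of_real pi * \<i> * of_nat h / of_nat k)) ^ l)"
          and "(\<Prod>j=1..N. 1 / (1 - x ^ j)) = (\<Sum>k=1..N. \<Sum>h | h < k \<and> coprime h k. \<Sum>l=1..N div k.
            d h k l / (x - exp (2 * of_real pi * \<i> * of_nat h / of_nat k)) ^ l)"
          using cd unfolding is_partial_fraction_coeffs_def by simp_all
        then have "(\<Sum>k=1..N. \<Sum>h | h < k \<and> coprime h k. \<Sum>l=1..N div k.
           (c h k l - d h k l) / (x - exp (2 * of_real pi * \<i> * of_nat h / of_nat k)) ^ l) = 0"
          by (simp add: diff_divide_distrib sum_subtractf)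
        then show "(\<Sum>\<zeta>\<in>farey_root ` farey N. \<Sum>l=1..card {j\<in>{1..N}. \<zeta> ^ j = 1}. ?d \<zeta> l / (x - \<zeta>) ^ l) = 0"
          using triple_sum_eq[of "\<lambda>h k l. c h k l - d h k l" x N] by simp
      qed (use kh True card_multiples[OF kh] in \<open>auto simp: finite_farey\<close>)
      then show ?thesis using kh by (simp add: the_inv_into_f_f[OF inj_on_farey_root])
    qed
  qed
qed

lemma C_expansion:
  assumes "N \<ge> 1" "\<forall>j\<in>{1..N}. x ^ j \<noteq> 1"
  shows "(\<Prod>j=1..N. 1 / (1 - x ^ j)) = (\<Sum>(k,h)\<in>farey N. \<Sum>l=1..N div k. C h k l N / (x - farey_root (k, h)) ^ l)"
proof -
  have "is_partial_fraction_coeffs N (THE c. is_partial_fraction_coeffs N c)"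
    using ex1_partial_fraction_coeffs[OF assms(1)] by (rule theI')
  then have "(\<Prod>j=1..N. 1 / (1 - x ^ j)) = (\<Sum>k=1..N. \<Sum>h | h < k \<and> coprime h k. \<Sum>l=1..N div k.
           C h k l N / (x - exp (2 * of_real pi * \<i> * of_nat h / of_nat k)) ^ l)"
    using assms(2) unfolding is_partial_fraction_coeffs_def C_def by blast
  also have "\<dots> = (\<Sum>(k,h)\<in>farey N. \<Sum>l=1..N div k. C h k l N / (x - farey_root (k, h)) ^ l)"
    unfolding farey_def farey_root_def prod.case by (rule sum.Sigma) auto
  finally show ?thesis .
qed

section \<open>A holomorphic logarithm of the product\<close>

text \<open>The nonzero zeros $2\pi i k$ of $e^w - 1$ lie on the two removed rays; what remains is star-shaped
  about 0, so $(e^w-1)/w$ has a holomorphic logarithm there.\<close>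

definition slit_domain :: "complex set" where
  "slit_domain = {z. Re z \<noteq> 0 \<or> \<bar>Im z\<bar> < 2 * pi}"

lemma open_slit_domain: "open slit_domain"
proof -
  have "slit_domain = {z. Re z \<noteq> 0} \<union> {z. Im z < 2 * pi} \<inter> {z. Im z > - (2 * pi)}"
    by (auto simp: slit_domain_def)
  moreover have "open {z. Re z \<noteq> 0}"
    by (intro open_Collect_neq continuous_intros)
  then have "open ({z. Re z \<noteq> 0} \<union> {z. Im z < 2 * pi} \<inter> {z. Im z > - (2 * pi)})"
    by (intro open_Un open_Int open_halfspace_Im_lt open_halfspace_Im_gt)
  ultimately show ?thesis by (simp only:)
qed

lemma zero_in_slit_domain [simp]: "0 \<in> slit_domain"
  by (simp add: slit_domain_def)

lemma slit_domain_scale: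
  assumes "z \<in> slit_domain" "0 \<le> t" "t \<le> 1"
  shows "of_real t * z \<in> slit_domain"
proof (cases "t = 0")
  case False
  have "t * \<bar>Im z\<bar> \<le> \<bar>Im z\<bar>" using assms by (intro mult_left_le_one_le) auto
  then show ?thesis using assms False by (auto simp: slit_domain_def abs_mult)
qed simp

lemma closed_segment_slit_domain:
  assumes "z \<in> slit_domain" shows "closed_segment 0 z \<subseteq> slit_domain"
  using assms slit_domain_scale by (auto simp: closed_segment_def scaleR_conv_of_real)

lemma starlike_slit_domain: "starlike slit_domain"
  unfolding starlike_def using closed_segment_slit_domain zero_in_slit_domain by blast

definition expm1_quot :: "complex \<Rightarrow> complex" where
  "expm1_quot w = (if w = 0 then 1 else (exp w - 1) / w)"

lemma expm1_quot_mult: "w * expm1_quot w = exp w - 1"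
  by (simp add: expm1_quot_def)

lemma holomorphic_expm1_quot: "expm1_quot holomorphic_on A"
proof -
  have "(\<lambda>w::complex. if w = 0 then deriv exp 0 else (exp w - exp 0) / (w - 0)) holomorphic_on UNIV"
    by (rule pole_lemma) (auto intro!: holomorphic_intros)
  also have "(\<lambda>w::complex. if w = 0 then deriv exp 0 else (exp w - exp 0) / (w - 0)) = expm1_quot"
  proof -
    have "deriv exp (0::complex) = 1" by (rule DERIV_imp_deriv) (auto intro!: derivative_eq_intros)
    then show ?thesis by (auto simp: fun_eq_iff expm1_quot_def)
  qed
  finally show ?thesis by (rule holomorphic_on_subset) simp
qed

lemma exp_eq_1_slit_domain:
  assumes "w \<in> slit_domain" "exp w = 1" shows "w = 0"
proof -
  obtain n :: int where n: "Re w = 0" "Im w = of_int (2 * n) * pi"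
    using assms(2) by (auto simp: exp_eq_1)
  with assms(1) have "2 * pi * \<bar>real_of_int n\<bar> < 2 * pi * 1" by (simp add: slit_domain_def abs_mult)
  then have "\<bar>real_of_int n\<bar> < 1" by (subst (asm) mult_less_cancel_left_pos) auto
  then have "n = 0" by linarith
  with n show ?thesis by (simp add: complex_eq_iff)
qed

lemma expm1_quot_nonzero:
  assumes "w \<in> slit_domain" shows "expm1_quot w \<noteq> 0"
  using assms exp_eq_1_slit_domain by (auto simp: expm1_quot_def)

text \<open>The value 0 at 0 selects the branch. Composing the principal logarithm with
  \<open>expm1_quot\<close> would not do: the quotient crosses the negative real axis inside the
  domain, for instance far to the right at height near pi.\<close>

definition log_quot :: "complex \<Rightarrow> complex" where
  "log_quot = (SOME L. L holomorphic_on slit_domain \<and> L 0 = 0 \<and> (\<forall>w\<in>slit_domain. exp (L w) = expm1_quot w))"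

lemma log_quot:
  shows holomorphic_log_quot: "log_quot holomorphic_on slit_domain"
    and log_quot_0 [simp]: "log_quot 0 = 0"
    and exp_log_quot: "\<And>w. w \<in> slit_domain \<Longrightarrow> exp (log_quot w) = expm1_quot w"
proof -
  obtain g where g: "g holomorphic_on slit_domain" "\<And>w. w \<in> slit_domain \<Longrightarrow> expm1_quot w = exp (g w)"
    using contractible_imp_holomorphic_log[OF holomorphic_expm1_quot starlike_imp_contractible[OF starlike_slit_domain] expm1_quot_nonzero]
    by metis
  have g0: "exp (g 0) = 1" using g(2)[of 0] by (simp add: expm1_quot_def)
  have "\<exists>L. L holomorphic_on slit_domain \<and> L 0 = 0 \<and> (\<forall>w\<in>slit_domain. exp (L w) = expm1_quot w)"
    by (rule exI[of _ "\<lambda>w. g w - g 0"]) (auto intro!: holomorphic_intros g(1) simp: exp_diff g0 g(2))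
  from someI_ex[OF this] show "log_quot holomorphic_on slit_domain" "log_quot 0 = 0"
     "\<And>w. w \<in> slit_domain \<Longrightarrow> exp (log_quot w) = expm1_quot w"
    unfolding log_quot_def by blast+
qed

text \<open>Integrating along the segment from 0 to z, N times \<open>log_quot_prim z / z\<close> is
  the continuous counterpart of the sum of \<open>log_quot\<close> over the points j z / N, and thus
  the leading part of the exponent.\<close>

definition log_quot_prim :: "complex \<Rightarrow> complex" where
  "log_quot_prim = (SOME A. A 0 = 0 \<and> (\<forall>w\<in>slit_domain. (A has_field_derivative log_quot w) (at w)))"

lemma log_quot_prim:
  shows log_quot_prim_0 [simp]: "log_quot_prim 0 = 0"
    and log_quot_prim_deriv: "\<And>w. w \<in> slit_domain \<Longrightarrow> (log_quot_prim has_field_derivative log_quot w) (at w)"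
proof -
  obtain A where A: "\<And>w. w \<in> slit_domain \<Longrightarrow> (A has_field_derivative log_quot w) (at w)"
    using holomorphic_starlike_primitive[OF holomorphic_on_imp_continuous_on[OF holomorphic_log_quot] starlike_slit_domain open_slit_domain, of "{}"]
      holomorphic_log_quot open_slit_domain holomorphic_on_imp_differentiable_at by blast
  have "\<exists>A. A 0 = 0 \<and> (\<forall>w\<in>slit_domain. (A has_field_derivative log_quot w) (at w))"
    by (rule exI[of _ "\<lambda>w. A w - A 0"]) (auto intro!: derivative_eq_intros A)
  from someI_ex[OF this] show "log_quot_prim 0 = 0" "\<And>w. w \<in> slit_domain \<Longrightarrow> (log_quot_prim has_field_derivative log_quot w) (at w)"
    unfolding log_quot_prim_def by blast+
qed

lemma log_quot_deriv:
  assumes "w \<in> slit_domain"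
  shows "(log_quot has_field_derivative deriv log_quot w) (at w)"
  using holomorphic_derivI[OF holomorphic_log_quot open_slit_domain assms] .

lemma one_minus_exp_eq:
  assumes "w \<in> slit_domain"
  shows "1 - exp w = - w * exp (log_quot w)"
  using exp_log_quot[OF assms] expm1_quot_mult[of w] by (simp add: algebra_simps)

text \<open>Each factor 1 - e^w at w = j z / N equals -w times the exponential of
  \<open>log_quot w\<close>. The linear factors collect to the explicit prefactor and the rest to
  one exponential of a Riemann sum.\<close>

lemma product_eq:
  assumes z: "z \<in> slit_domain" and N: "N \<ge> 1"
  shows "(\<Prod>j=1..N. 1 / (1 - exp (of_nat j * z / of_nat N)))
    = of_nat N ^ N / fact N * (1 / (- z) ^ N) * exp (- (\<Sum>j=1..N. log_quot (of_nat j * z / of_nat N)))"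
proof -
  have "(\<Prod>j=1..N. 1 / (1 - exp (of_nat j * z / of_nat N)))
      = (\<Prod>j=1..N. of_nat N * (1 / of_nat j) * (1 / (- z)) * exp (- log_quot (of_nat j * z / of_nat N)))"
  proof (rule prod.cong[OF refl])
    fix j assume j: "j \<in> {1..N}"
    have "of_real (real j / real N) * z \<in> slit_domain"
      using j by (intro slit_domain_scale z) auto
    then have "of_nat j * z / of_nat N \<in> slit_domain" by simp
    note E = one_minus_exp_eq[OF this]
    show "1 / (1 - exp (of_nat j * z / of_nat N)) =
        of_nat N * (1 / of_nat j) * (1 / (- z)) * exp (- log_quot (of_nat j * z / of_nat N))"
      unfolding E using j N by (simp add: exp_minus divide_simps)
  qed
  also have "\<dots> = (\<Prod>j=1..N. of_nat N) * (\<Prod>j=1..N. 1 / of_nat j) * (\<Prod>j=1..N. 1 / (- z)) *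
      (\<Prod>j=1..N. exp (- log_quot (of_nat j * z / of_nat N)))"
    by (simp only: prod.distrib)
  also have "(\<Prod>j=1..N. 1 / of_nat j :: complex) = 1 / fact N"
    by (simp add: prod_dividef fact_prod)
  also have "(\<Prod>j=1..N. exp (- log_quot (of_nat j * z / of_nat N))) = exp (- (\<Sum>j=1..N. log_quot (of_nat j * z / of_nat N)))"
    by (simp add: exp_sum[symmetric] sum_negf)
  also have "(\<Prod>j=1..N. 1 / (- z)) = 1 / (- z) ^ N"
    unfolding prod_constant power_one_over by simp
  also have "(\<Prod>j=1..N. of_nat N :: complex) = of_nat N ^ N"
    by simp
  finally show ?thesis by (simp only: times_divide_eq_right mult_1_right)
qed

text \<open>Regard the error as a function of the right endpoint p. Its derivative is half of a
  first-order Taylor remainder of f, expanded at p and evaluated at a, hence quadratic in the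
  length; integrating once more gives the cube.\<close>

lemma trapezoid_bound:
  fixes f g :: "complex \<Rightarrow> complex"
  assumes g: "\<And>x. x \<in> closed_segment a c \<Longrightarrow> (g has_field_derivative f x) (at x)"
    and f: "\<And>x. x \<in> closed_segment a c \<Longrightarrow> (f has_field_derivative f' x) (at x)"
    and f': "\<And>x. x \<in> closed_segment a c \<Longrightarrow> (f' has_field_derivative f'' x) (at x)"
    and M: "\<And>x. x \<in> closed_segment a c \<Longrightarrow> norm (f'' x) \<le> M"
  shows "norm ((c - a) * (f a + f c) / 2 - (g c - g a)) \<le> M * norm (c - a) ^ 3"
proof -
  let ?S = "closed_segment a c"
  define e where "e = (\<lambda>p. (p - a) * (f a + f p) / 2 - (g p - g a))"
  define e' where "e' = (\<lambda>p. (f a - (f p + f' p * (a - p))) / 2)"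
  have M0: "M \<ge> 0" using order.trans[OF norm_ge_zero M[of a]] by simp
  have "norm (e c - e a) \<le> (M * norm (c - a) ^ 2) * norm (c - a)"
  proof (rule field_differentiable_bound[of ?S])
    fix p assume p: "p \<in> ?S"
    have "(e has_field_derivative e' p) (at p)"
      unfolding e_def e'_def by (rule derivative_eq_intros f[OF p] g[OF p] refl | simp)+ (simp add: field_simps)
    then show "(e has_field_derivative e' p) (at p within ?S)" by (rule has_field_derivative_at_within)
    let ?f = "\<lambda>i. if i = 0 then f else if i = Suc 0 then f' else f''"
    have "cmod (?f 0 a - (\<Sum>i\<le>1. ?f i p * (a - p) ^ i / fact i)) \<le> M * cmod (a - p) ^ Suc 1 / fact 1"
    proof (rule complex_Taylor[of ?S])
      fix i x assume "x \<in> ?S" "i \<le> (1::nat)"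
      then show "(?f i has_field_derivative ?f (Suc i) x) (at x within ?S)"
        using f f' by (auto simp: le_Suc_eq intro: has_field_derivative_at_within)
    qed (use M p in auto)
    then have "norm (f a - (f p + f' p * (a - p))) \<le> M * norm (a - p) ^ 2"
      by (simp add: numeral_2_eq_2)
    also have "\<dots> \<le> M * norm (c - a) ^ 2"
      using M0 segment_bound1[OF p] by (intro mult_left_mono power_mono) (auto simp: norm_minus_commute)
    finally show "norm (e' p) \<le> M * norm (c - a) ^ 2"
      using norm_ge_zero[of "f a - (f p + f' p * (a - p))"] unfolding e'_def norm_divide norm_numeral by linarith
  qed auto
  then show ?thesis by (simp add: e_def power3_eq_cube power2_eq_square mult_ac)
qed

text \<open>The primitive is the integral and \<open>log_quot z / 2\<close> the endpoint correction of the trapezoidal rule.\<close>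

lemma log_quot_sum_bound:
  assumes K: "compact K" "K \<subseteq> slit_domain"
  obtains B where "B \<ge> 0" and "\<And>z N. z \<in> K \<Longrightarrow> N \<ge> 1 \<Longrightarrow>
     norm (z * ((\<Sum>j=1..N. log_quot (of_nat j * z / of_nat N)) - log_quot z / 2) - of_nat N * log_quot_prim z) \<le> B / real N"
proof -
  \<comment> \<open>The cone over \<open>K\<close> with apex 0 contains every panel for every
    \<open>N\<close>, so one bound on the second derivative serves for all of them.\<close>
  define K' where "K' = (\<lambda>(t::real,z). of_real t * z) ` ({0..1} \<times> K)"
  have cK': "compact K'"
    unfolding K'_def case_prod_unfold by (intro compact_continuous_image continuous_intros compact_Times K compact_Icc)
  have sK': "K' \<subseteq> slit_domain" unfolding K'_def using slit_domain_scale K by auto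
  have hol: "deriv log_quot holomorphic_on slit_domain" "deriv (deriv log_quot) holomorphic_on slit_domain"
    by (intro holomorphic_deriv open_slit_domain holomorphic_log_quot)+
  have "compact (deriv (deriv log_quot) ` K')"
    using hol(2) sK' by (intro compact_continuous_image cK') (auto intro: holomorphic_on_imp_continuous_on holomorphic_on_subset)
  then obtain M where M: "\<And>x. x \<in> K' \<Longrightarrow> norm (deriv (deriv log_quot) x) \<le> M"
    using compact_imp_bounded[of "deriv (deriv log_quot) ` K'"] by (auto simp: bounded_iff)
  obtain R where R: "\<And>z. z \<in> K \<Longrightarrow> norm z \<le> R"
    using compact_imp_bounded[OF K(1)] by (auto simp: bounded_iff)
  define B where "B = \<bar>M\<bar> * \<bar>R\<bar> ^ 3"
  show ?thesis
  proof (rule that[of B])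
    show "B \<ge> 0" by (simp add: B_def)
    fix z and N :: nat assume z: "z \<in> K" and N: "N \<ge> 1"
    define h where "h = z / of_nat N"
    define x where "x = (\<lambda>j::nat. of_nat j * z / of_nat N)"
    have x0: "x 0 = 0" and xN: "x N = z" and xS: "x (Suc j) - x j = h" for j
      using N by (auto simp: x_def h_def field_simps)
    have seg: "closed_segment (x j) (x (Suc j)) \<subseteq> K'" if "j < N" for j
    proof
      fix y assume "y \<in> closed_segment (x j) (x (Suc j))"
      then obtain u where u: "0 \<le> u" "u \<le> 1" "y = (1 - u) *\<^sub>R x j + u *\<^sub>R x (Suc j)"
        by (auto simp: closed_segment_def)
      have "y = of_real ((real j + u) / real N) * z"
        unfolding u(3) x_def using N by (simp add: scaleR_conv_of_real field_simps)
      moreover have "(real j + u) / real N \<in> {0..1}" using u that by (simp add: divide_simps)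
      ultimately show "y \<in> K'" unfolding K'_def using z by force
    qed
    have each: "norm (h * (log_quot (x j) + log_quot (x (Suc j))) / 2 - (log_quot_prim (x (Suc j)) - log_quot_prim (x j)))
       \<le> M * norm h ^ 3" if "j < N" for j
    proof -
      have D: "w \<in> slit_domain" if "w \<in> closed_segment (x j) (x (Suc j))" for w using seg[OF \<open>j < N\<close>] sK' that by blast
      have "norm ((x (Suc j) - x j) * (log_quot (x j) + log_quot (x (Suc j))) / 2 - (log_quot_prim (x (Suc j)) - log_quot_prim (x j)))
       \<le> M * norm (x (Suc j) - x j) ^ 3"
      proof (rule trapezoid_bound)
        fix w assume w: "w \<in> closed_segment (x j) (x (Suc j))"
        note D = D[OF w]
        show "(log_quot_prim has_field_derivative log_quot w) (at w)" by (rule log_quot_prim_deriv[OF D])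
        show "(log_quot has_field_derivative deriv log_quot w) (at w)" by (rule log_quot_deriv[OF D])
        show "(deriv log_quot has_field_derivative deriv (deriv log_quot) w) (at w)"
          by (rule holomorphic_derivI[OF hol(1) open_slit_domain D])
        show "norm (deriv (deriv log_quot) w) \<le> M" using M seg[OF that] w by blast
      qed
      then show ?thesis by (simp add: xS)
    qed
    \<comment> \<open>Since \<open>log_quot 0 = 0\<close>, the left endpoint contributes nothing,
      and only half of the value at the right endpoint has to be subtracted.\<close>
    have tele: "(\<Sum>j<n. h * (log_quot (x j) + log_quot (x (Suc j))) / 2 - (log_quot_prim (x (Suc j)) - log_quot_prim (x j)))
        = h * ((\<Sum>j=1..n. log_quot (x j)) - log_quot (x n) / 2) - log_quot_prim (x n)" for n
    proof (induction n)
      case (Suc n)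
      have "(h * 2) * y = h * y + h * y" for y by (simp add: algebra_simps)
      then show ?case by (simp add: Suc.IH) (simp add: field_simps)
    qed (simp add: x0)
    \<comment> \<open>There are N panels with an error of order N^(-3) each; multiplying by N
      afterwards, to turn h into z, leaves 1/N.\<close>
    have "norm (h * ((\<Sum>j=1..N. log_quot (x j)) - log_quot z / 2) - log_quot_prim z) \<le> (\<Sum>j<N. M * norm h ^ 3)"
      using tele[of N] sum_norm_le[of "{..<N}" "\<lambda>j. h * (log_quot (x j) + log_quot (x (Suc j))) / 2 - (log_quot_prim (x (Suc j)) - log_quot_prim (x j))" "\<lambda>_. M * norm h ^ 3"] each
      by (simp add: xN)
    also have "\<dots> = M * norm z ^ 3 / real N ^ 2"
      using N by (simp add: h_def norm_divide power_divide power3_eq_cube power2_eq_square)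
    also have "\<dots> \<le> B / real N ^ 2"
      unfolding B_def using R[OF z] by (intro divide_right_mono mult_mono power_mono) auto
    finally have "norm (h * ((\<Sum>j=1..N. log_quot (x j)) - log_quot z / 2) - log_quot_prim z) * real N \<le> B / real N ^ 2 * real N"
      by (intro mult_right_mono) auto
    also have "B / real N ^ 2 * real N = B / real N" using N by (simp add: power2_eq_square)
    also have "norm (h * ((\<Sum>j=1..N. log_quot (x j)) - log_quot z / 2) - log_quot_prim z) * real N
       = norm ((h * ((\<Sum>j=1..N. log_quot (x j)) - log_quot z / 2) - log_quot_prim z) * of_nat N)"
      by (simp add: norm_mult)
    also have "(h * ((\<Sum>j=1..N. log_quot (x j)) - log_quot z / 2) - log_quot_prim z) * of_nat N
       = z * ((\<Sum>j=1..N. log_quot (of_nat j * z / of_nat N)) - log_quot z / 2) - of_nat N * log_quot_prim z"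
    proof -
      have hN: "h * of_nat N = z" using N by (simp add: h_def)
      have "(h * T - P) * of_nat N = (h * of_nat N) * T - of_nat N * P" for T P
        by (simp add: algebra_simps)
      then show ?thesis unfolding hN x_def .
    qed
    finally show "norm (z * ((\<Sum>j=1..N. log_quot (of_nat j * z / of_nat N)) - log_quot z / 2) - of_nat N * log_quot_prim z) \<le> B / real N" .
  qed
qed

section \<open>The coefficient as a contour integral\<close>

text \<open>This is $(x-1)^{l-1}\prod_j(1-x^j)^{-1}\,dx$ at $x = e^{z/N}$.\<close>

definition integrand :: "nat \<Rightarrow> nat \<Rightarrow> complex \<Rightarrow> complex" where
  "integrand l N z = exp (z / of_nat N) * (exp (z / of_nat N) - 1) ^ (l - 1) / of_nat N *
     (\<Prod>j=1..N. 1 / (1 - exp (of_nat j * z / of_nat N)))"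

text \<open>Scaling by j/N keeps z inside the star-shaped domain, where e^w = 1 forces w = 0. Hence
  z = 0 is the only possible singularity of the integrand in \<open>slit_domain\<close>.\<close>

lemma exp_power_neq_1:
  assumes z: "z \<in> slit_domain" "z \<noteq> 0" and j: "j \<in> {1..N}"
  shows "exp (z / of_nat N) ^ j \<noteq> 1"
proof
  assume "exp (z / of_nat N) ^ j = 1"
  then have "exp (of_nat j * z / of_nat N) = 1"
    by (simp add: exp_of_nat_mult[symmetric])
  moreover have "of_real (real j / real N) * z \<in> slit_domain"
    using j by (intro slit_domain_scale z) auto
  then have "of_nat j * z / of_nat N \<in> slit_domain" by simp
  ultimately have "of_nat j * z / of_nat N = 0" by (rule exp_eq_1_slit_domain[rotated])
  with z j show False by auto
qed

lemma integrand_expansion: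
  assumes "z \<in> slit_domain" "z \<noteq> 0" "N \<ge> 1"
  shows "integrand l N z = (\<Sum>a\<in>farey N. \<Sum>m=1..N div fst a. C (snd a) (fst a) m N *
     (exp (z / of_nat N) * (exp (z / of_nat N) - 1) ^ (l - 1) / of_nat N / (exp (z / of_nat N) - farey_root a) ^ m))"
proof -
  have "(\<Prod>j=1..N. 1 / (1 - exp (of_nat j * z / of_nat N))) = (\<Prod>j=1..N. 1 / (1 - exp (z / of_nat N) ^ j))"
    by (simp add: exp_of_nat_mult[symmetric])
  also have "\<dots> = (\<Sum>(k,h)\<in>farey N. \<Sum>m=1..N div k. C h k m N / (exp (z / of_nat N) - farey_root (k, h)) ^ m)"
    using exp_power_neq_1[OF assms(1,2)] by (intro C_expansion assms) auto
  finally show ?thesis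
    unfolding integrand_def case_prod_unfold by (simp add: sum_distrib_left mult_ac)
qed

lemma slit_domain_divide:
  assumes "z \<in> slit_domain" "N \<ge> 1" shows "z / of_nat N \<in> slit_domain"
  using slit_domain_scale[OF assms(1), of "1 / real N"] assms(2) by simp

text \<open>In the domain, e^(z/N) can be a root of unity of order at most N only at z = 0, where it
  equals 1. The terms attached to all other roots are therefore holomorphic and Cauchy's theorem
  applies.\<close>

lemma contour_integral_other_roots:
  assumes g: "valid_path g" "pathfinish g = pathstart g" "path_image g \<subseteq> slit_domain"
    and a: "a \<in> farey N" "a \<noteq> (1, 0)"
  shows "((\<lambda>z. exp (z / of_nat N) * (exp (z / of_nat N) - 1) ^ q / of_nat N / (exp (z / of_nat N) - farey_root a) ^ m)
     has_contour_integral 0) g"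
proof (rule Cauchy_theorem_starlike_simple[OF open_slit_domain starlike_slit_domain _ g(1,3,2)])
  obtain k h where kh: "a = (k, h)" by (cases a)
  have k: "k \<ge> 1" "k \<le> N" "N \<ge> 1" using a kh by (auto simp: farey_def)
  have "exp (z / of_nat N) \<noteq> farey_root a" if z: "z \<in> slit_domain" for z
  proof
    assume eq: "exp (z / of_nat N) = farey_root a"
    then have "exp (z / of_nat N) ^ k = 1" using farey_root_power_eq_1_iff[of k h N k] a kh by simp
    then have "z = 0" using exp_power_neq_1[OF z, of k N] k by auto
    with eq have "farey_root a ^ 1 = 1" by simp
    then have "k = 1" using farey_root_power_eq_1_iff[of k h N 1] a kh by simp
    with a kh show False by (auto simp: farey_def)
  qed
  then show "(\<lambda>z. exp (z / of_nat N) * (exp (z / of_nat N) - 1) ^ q / of_nat N / (exp (z / of_nat N) - farey_root a) ^ m) holomorphic_on slit_domain"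
    using k by (intro holomorphic_intros) auto
qed

text \<open>With exponent q - m + 1, a power of e^(z/N) - 1 is a primitive up to a constant factor.
  The exponent may be negative, hence the integer power, and it is nonzero because m differs from q
  + 1.\<close>

lemma contour_integral_other_orders:
  assumes g: "valid_path g" "pathfinish g = pathstart g" "path_image g \<subseteq> slit_domain - {0}"
    and N: "N \<ge> 1" and ml: "m \<noteq> Suc q"
  shows "((\<lambda>z. exp (z / of_nat N) * (exp (z / of_nat N) - 1) ^ q / of_nat N / (exp (z / of_nat N) - 1) ^ m)
     has_contour_integral 0) g"
proof -
  define e :: int where "e = int q - int m + 1"
  have e: "e \<noteq> 0" using ml by (simp add: e_def)
  let ?F = "\<lambda>z. (exp (z / of_nat N) - 1) powi e / of_int e"
  let ?f = "\<lambda>z. exp (z / of_nat N) * (exp (z / of_nat N) - 1) ^ q / of_nat N / (exp (z / of_nat N) - 1) ^ m"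
  show ?thesis
  proof (rule Cauchy_theorem_primitive[OF _ g(1,3,2)])
    fix z assume z: "z \<in> slit_domain - {0}"
    have nz: "exp (z / of_nat N) - 1 \<noteq> 0" using exp_power_neq_1[of z 1 N] z N by auto
    have "(?F has_field_derivative (of_int e * (exp (z / of_nat N) - 1) powi (e - 1) * (exp (z / of_nat N) * (1 / of_nat N))) / of_int e) (at z)"
    proof -
      have "((\<lambda>z. exp (z / of_nat N) - 1) has_field_derivative exp (z / of_nat N) * (1 / of_nat N)) (at z)"
        using N by (auto intro!: derivative_eq_intros)
      from DERIV_cdivide[OF DERIV_power_int[OF this disjI2[OF nz]]] show ?thesis .
    qed
    also have "(of_int e * (exp (z / of_nat N) - 1) powi (e - 1) * (exp (z / of_nat N) * (1 / of_nat N))) / of_int e = ?f z"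
    proof -
      have "(exp (z / of_nat N) - 1) powi (e - 1) = (exp (z / of_nat N) - 1) ^ q / (exp (z / of_nat N) - 1) ^ m"
        using nz by (simp add: e_def power_int_diff)
      then show ?thesis using e by (simp add: mult.commute)
    qed
    finally show "(?F has_field_derivative ?f z) (at z within slit_domain - {0})"
      by (rule has_field_derivative_at_within)
  qed
qed

text \<open>Logarithmic differentiation of e^w - 1 = w exp(\<open>log_quot w\<close>) shows that the
  integrand exceeds 1/z by the derivative of \<open>log_quot (z / N)\<close>, which integrates to 0
  over a closed path. The winding number enters only through the integral of 1/z.\<close>

lemma contour_integral_main_order:
  assumes g: "valid_path g" "pathfinish g = pathstart g" "path_image g \<subseteq> slit_domain - {0}"
    and N: "N \<ge> 1" and w: "((\<lambda>z. 1 / z) has_contour_integral I) g"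
  shows "((\<lambda>z. exp (z / of_nat N) * (exp (z / of_nat N) - 1) ^ q / of_nat N / (exp (z / of_nat N) - 1) ^ Suc q)
     has_contour_integral I) g"
proof -
  let ?f = "\<lambda>z. exp (z / of_nat N) * (exp (z / of_nat N) - 1) ^ q / of_nat N / (exp (z / of_nat N) - 1) ^ Suc q"
  have "((\<lambda>z. ?f z - 1 / z) has_contour_integral 0) g"
  proof (rule Cauchy_theorem_primitive[OF _ g(1,3,2)])
    fix z assume z: "z \<in> slit_domain - {0}"
    define w where "w = z / of_nat N"
    have w: "w \<in> slit_domain" unfolding w_def using z N by (intro slit_domain_divide) auto
    have w0: "w \<noteq> 0" using z N by (simp add: w_def)
    have nz: "exp w - 1 \<noteq> 0" using exp_eq_1_slit_domain[OF w] w0 by auto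
    have "((\<lambda>v. v * exp (log_quot v)) has_field_derivative exp (log_quot w) + w * (exp (log_quot w) * deriv log_quot w)) (at w)"
      by (rule derivative_eq_intros log_quot_deriv[OF w] refl | simp)+
    moreover have "((\<lambda>v. v * exp (log_quot v)) has_field_derivative exp w) (at w)"
    proof (rule has_field_derivative_transform_within_open[OF _ open_slit_domain w])
      show "((\<lambda>v. exp v - 1) has_field_derivative exp w) (at w)"
        by (rule derivative_eq_intros refl | simp)+
      show "exp v - 1 = v * exp (log_quot v)" if "v \<in> slit_domain" for v
        using one_minus_exp_eq[OF that] by (simp add: algebra_simps)
    qed
    ultimately have X: "exp w = exp (log_quot w) * (1 + w * deriv log_quot w)"
      using DERIV_unique by (fastforce simp: algebra_simps)
    have E: "exp w - 1 = w * exp (log_quot w)" using one_minus_exp_eq[OF w] by (simp add: algebra_simps)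
    have q: "exp w / (exp w - 1) = 1 / w + deriv log_quot w"
      unfolding E by (subst X) (use w0 in \<open>simp add: divide_simps algebra_simps\<close>)
    have "((\<lambda>z. log_quot (z / of_nat N)) has_field_derivative deriv log_quot w * (1 / of_nat N)) (at z)"
    proof (rule DERIV_chain2[where f = log_quot and g = "\<lambda>z. z / of_nat N"])
      show "(log_quot has_field_derivative deriv log_quot w) (at (z / of_nat N))"
        using log_quot_deriv[OF w] by (simp add: w_def)
      show "((\<lambda>z. z / of_nat N) has_field_derivative 1 / of_nat N) (at z)"
        using N by (auto intro!: derivative_eq_intros)
    qed
    also have "deriv log_quot w * (1 / of_nat N) = (exp w / (exp w - 1)) / of_nat N - 1 / z"
      unfolding q using N z by (simp add: w_def field_simps)
    also have "(exp w / (exp w - 1)) / of_nat N - 1 / z = ?f z - 1 / z"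
      unfolding w_def[symmetric] using nz by simp
    finally show "((\<lambda>z. log_quot (z / of_nat N)) has_field_derivative ?f z - 1 / z) (at z within slit_domain - {0})"
      by (rule has_field_derivative_at_within)
  qed
  from has_contour_integral_add[OF this w] show ?thesis by simp
qed

text \<open>Inserting the partial fraction decomposition, only the term with root 1 and order l
  contributes; \<open>N \<ge> l\<close> places that order in the range of the sum.\<close>

theorem contour_integral_integrand:
  assumes g: "valid_path g" "pathfinish g = pathstart g" "path_image g \<subseteq> slit_domain - {0}"
    and w: "((\<lambda>z. 1 / z) has_contour_integral 2 * of_real pi * \<i>) g"
    and N: "N \<ge> 1" "N \<ge> l" and l: "l \<ge> 1"
  shows "(integrand l N has_contour_integral 2 * of_real pi * \<i> * C 0 1 l N) g"
proof -
  let ?t = "\<lambda>a m z. exp (z / of_nat N) * (exp (z / of_nat N) - 1) ^ (l - 1) / of_nat N / (exp (z / of_nat N) - farey_root a) ^ m"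
  have r1: "farey_root (1, 0) = 1" by (simp add: farey_root_def)
  have t: "(?t a m has_contour_integral (if a = (1, 0) \<and> m = l then 2 * of_real pi * \<i> else 0)) g" if "a \<in> farey N" for a m
  proof (cases "a = (1, 0)")
    case True
    then show ?thesis
      using contour_integral_other_orders[OF g N(1), of m "l - 1"] contour_integral_main_order[OF g N(1) w, of "l - 1"] l
      by (cases "m = l") (auto simp: r1[simplified])
  next
    case False
    then show ?thesis using contour_integral_other_roots[OF g(1,2) _ that False] g(3) by auto
  qed
  have "((\<lambda>z. \<Sum>a\<in>farey N. \<Sum>m=1..N div fst a. C (snd a) (fst a) m N * ?t a m z) has_contour_integral
      (\<Sum>a\<in>farey N. \<Sum>m=1..N div fst a. C (snd a) (fst a) m N * (if a = (1, 0) \<and> m = l then 2 * of_real pi * \<i> else 0))) g"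
    by (intro has_contour_integral_sum has_contour_integral_lmul t finite_farey) auto
  also have "(\<Sum>a\<in>farey N. \<Sum>m=1..N div fst a. C (snd a) (fst a) m N * (if a = (1, 0) \<and> m = l then 2 * of_real pi * \<i> else 0))
    = (\<Sum>a\<in>farey N. if a = (1, 0) then 2 * of_real pi * \<i> * C 0 1 l N else 0)"
  proof (intro sum.cong refl)
    fix a assume "a \<in> farey N"
    have "(\<Sum>m=1..N. C 0 1 m N * (if m = l then 2 * of_real pi * \<i> else 0)) = (\<Sum>m=1..N. if m = l then C 0 1 m N * (2 * of_real pi * \<i>) else 0)"
      by (intro sum.cong) auto
    also have "\<dots> = C 0 1 l N * (2 * of_real pi * \<i>)" using N l by simp
    finally show "(\<Sum>m=1..N div fst a. C (snd a) (fst a) m N * (if a = (1, 0) \<and> m = l then 2 * of_real pi * \<i> else 0)) =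
      (if a = (1, 0) then 2 * of_real pi * \<i> * C 0 1 l N else 0)"
      by auto
  qed
  also have "\<dots> = 2 * of_real pi * \<i> * C 0 1 l N"
    using N by (subst sum.delta[OF finite_farey]) (auto simp: farey_def)
  finally show ?thesis
  proof (rule has_contour_integral_eq)
    fix z assume "z \<in> path_image g"
    then show "(\<Sum>a\<in>farey N. \<Sum>m=1..N div fst a. C (snd a) (fst a) m N * ?t a m z) = integrand l N z"
      using g N by (subst integrand_expansion) auto
  qed
qed

section \<open>Stirling's formula and Laplace's method\<close>

text \<open>From c/n^2 <= 2c/n - 2c/(n+1) it follows that a(n) - 2c/n increases and a(n) + 2c/n
  decreases eventually. Both tend to the same limit, which they enclose with distance 2c/n.\<close>

lemma limit_rate_of_summable_increments:
  fixes a :: "nat \<Rightarrow> real"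
  assumes inc: "(\<lambda>n. a (Suc n) - a n) \<in> O(\<lambda>n. 1 / real n ^ 2)"
  obtains A where "(\<lambda>n. a n - A) \<in> O(\<lambda>n. 1 / real n)"
proof -
  obtain c where c: "c > 0" "eventually (\<lambda>n. norm (a (Suc n) - a n) \<le> c * norm (1 / real n ^ 2)) at_top"
    using inc by (elim landau_o.bigE) auto
  then obtain n0 where n0: "\<And>n. n \<ge> n0 \<Longrightarrow> \<bar>a (Suc n) - a n\<bar> \<le> c / real n ^ 2"
    by (auto simp: eventually_sequentially)
  define m where "m = max n0 1"
  have step: "\<bar>a (Suc n) - a n\<bar> \<le> 2 * c / real n - 2 * c / real (Suc n)" if "n \<ge> m" for n
  proof -
    have n: "real n \<ge> 1" using that by (simp add: m_def)
    have "c / real n ^ 2 \<le> 2 * c / real n - 2 * c / real (Suc n)"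
    proof -
      have "2 * c / real n - 2 * c / real (Suc n) = 2 * c / (real n * (real n + 1))"
        using n by (simp add: field_simps)
      moreover have "c / real n ^ 2 \<le> 2 * c / (real n * (real n + 1))"
      proof -
        have "c * (real n * (real n + 1)) \<le> c * (2 * real n ^ 2)"
          using n c mult_left_mono[of "real n + 1" "2 * real n" "real n"]
          by (intro mult_left_mono) (auto simp: power2_eq_square)
        then show ?thesis using n by (simp add: divide_simps mult_ac)
      qed
      ultimately show ?thesis by linarith
    qed
    with n0[of n] that show ?thesis by (simp add: m_def)
  qed
  define u where "u = (\<lambda>k. a (k + m) - 2 * c / real (k + m))"
  define v where "v = (\<lambda>k. a (k + m) + 2 * c / real (k + m))"
  have "u k \<le> u (Suc k)" "v (Suc k) \<le> v k" for k
    using step[of "k + m"] unfolding u_def v_def abs_le_iff add_Suc by linarith+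
  then have mono: "incseq u" "decseq v" by (auto intro: incseq_SucI decseq_SucI)
  have uv: "u k \<le> v k" for k using c by (simp add: u_def v_def)
  have ub: "u k \<le> v 0" for k using uv[of k] decseqD[OF mono(2), of 0 k] by simp
  obtain A where A: "u \<longlonglongrightarrow> A" "\<And>k. u k \<le> A"
    using incseq_convergent[OF mono(1), of "v 0"] ub by auto
  have "(\<lambda>k. 4 * c / (real k + real m)) \<longlonglongrightarrow> 0" by real_asymp
  then have "(\<lambda>k. v k - u k) \<longlonglongrightarrow> 0" by (simp add: u_def v_def)
  from tendsto_add[OF A(1) this] have "v \<longlonglongrightarrow> A" by simp
  then have vA: "A \<le> v k" for k using decseq_ge[OF mono(2)] by blast
  have "\<bar>a n - A\<bar> \<le> 2 * c / real n" if "n \<ge> m" for n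
    using A(2)[of "n - m"] vA[of "n - m"] that by (simp add: u_def v_def abs_le_iff)
  then have "(\<lambda>n. a n - A) \<in> O(\<lambda>n. 1 / real n)"
    by (intro bigoI[of _ "2 * c"]) (auto simp: eventually_sequentially intro!: exI[of _ m])
  then show ?thesis by (rule that)
qed

text \<open>The logarithm of the Stirling quotient has increments of order n^(-2), so it converges
  with rate 1/n; the value of its limit is read off from Wallis' product.\<close>

lemma stirling_bigo:
  "(\<lambda>n. real n ^ n * sqrt (real n) / (exp (real n) * fact n) - 1 / sqrt (2 * pi)) \<in> O(\<lambda>n. 1 / real n)"
proof -
  define a where "a = (\<lambda>n. ln (fact n) - (real n + 1/2) * ln (real n) + real n)"
  have "(\<lambda>n. a (Suc n) - a n) \<in> O(\<lambda>n. 1 / real n ^ 2)"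
  proof -
    have big: "(\<lambda>n. 1 - (real n + 1/2) * ln (1 + 1 / real n)) \<in> O(\<lambda>n. 1 / real n ^ 2)"
      by real_asymp
    have ev: "eventually (\<lambda>n. 1 - (real n + 1/2) * ln (1 + 1 / real n) = a (Suc n) - a n) at_top"
      using eventually_gt_at_top[of 0]
    proof eventually_elim
      case (elim n)
      have h1: "ln (1 + 1 / real n) = ln (real (Suc n)) - ln (real n)"
        using elim ln_div[of "real (Suc n)" "real n"] by (simp add: add_divide_distrib add.commute)
      have h2: "ln (fact (Suc n)) = ln (real (Suc n)) + ln (fact n :: real)"
        unfolding fact_Suc by (subst ln_mult) auto
      show ?case unfolding a_def h1 h2 by (simp add: algebra_simps)
    qed
    show ?thesis using landau_o.big.in_cong[OF ev] big by blast
  qed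
  then obtain A where A: "(\<lambda>n. a n - A) \<in> O(\<lambda>n. 1 / real n)"
    by (rule limit_rate_of_summable_increments)
  have lim: "(\<lambda>n. a n - A) \<longlonglongrightarrow> 0"
  proof -
    have "(\<lambda>n. 1 / real n) \<in> o(\<lambda>n. 1 :: real)" by real_asymp
    with A have "(\<lambda>n. a n - A) \<in> o(\<lambda>n. 1 :: real)" by (rule landau_o.big_small_trans)
    from smalloD_tendsto[OF this] show ?thesis by simp
  qed
  have exp_a: "exp (a n) = fact n * exp (real n) / (real n ^ n * sqrt (real n))" if "n \<ge> 1" for n
  proof -
    have "exp ((real n + 1/2) * ln (real n)) = real n powr (real n + 1/2)"
      using that by (simp add: powr_def)
    also have "\<dots> = real n ^ n * sqrt (real n)"
      using that by (simp add: powr_add powr_realpow powr_half_sqrt)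
    finally show ?thesis unfolding a_def by (simp add: exp_diff exp_add)
  qed
  have prod_eq: "(\<Prod>k=1..n. (4*real k^2) / (4*real k^2 - 1)) = 2 ^ (4 * n) * fact n ^ 4 / (fact (2 * n) ^ 2 * (2 * real n + 1))" for n
  proof (induction n)
    case (Suc n)
    have pos: "4 * real (Suc n) ^ 2 - 1 = (2 * real n + 1) * (2 * real n + 3)"
      by (simp add: power2_eq_square algebra_simps)
    have f2: "fact (2 * Suc n) = (2 * real n + 2) * (2 * real n + 1) * fact (2 * n)"
      by (simp add: algebra_simps)
    have alg: "(P * F ^ 4 / (G ^ 2 * x)) * (4 * y ^ 2 / (x * z)) = (16 * P) * (y * F) ^ 4 / (((2 * y) * x * G) ^ 2 * z)"
      if "x > 0" "y > 0" "z > 0" "G > 0" for P F G x y z :: real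
      using that by (simp add: divide_simps) (simp add: power2_eq_square power4_eq_xxxx algebra_simps)
    have "(\<Prod>k=1..Suc n. (4*real k^2) / (4*real k^2 - 1)) = 2 ^ (4 * n) * fact n ^ 4 / (fact (2 * n) ^ 2 * (2 * real n + 1))
       * ((4 * real (Suc n) ^ 2) / ((2 * real n + 1) * (2 * real n + 3)))"
      using Suc pos by simp
    also have "\<dots> = 2 ^ (4 * Suc n) * fact (Suc n) ^ 4 / (fact (2 * Suc n) ^ 2 * (2 * real (Suc n) + 1))"
    proof -
      have e1: "2 ^ (4 * Suc n) = 16 * (2 ^ (4 * n) :: real)" by (simp add: power_add)
      have e2: "fact (Suc n) = real (Suc n) * fact n" by simp
      have e3: "fact (2 * Suc n) = (2 * real (Suc n)) * (2 * real n + 1) * fact (2 * n)"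
        unfolding f2 by simp
      have e4: "2 * real (Suc n) + 1 = 2 * real n + 3" by simp
      show ?thesis unfolding e1 e2 e3 e4 by (rule alg) auto
    qed
    finally show ?case .
  qed simp
  \<comment> \<open>In the combination 4 a(n) - 2 a(2n) the exponentials and the powers n^n cancel,
    and what remains is the Wallis product up to a rational factor tending to 1/4.\<close>
  have wal: "(\<Prod>k=1..n. (4*real k^2) / (4*real k^2 - 1)) = exp (4 * a n - 2 * a (2 * n)) * (real n / (2 * (2 * real n + 1)))"
    if n: "n \<ge> 1" for n
  proof -
    define r where "r = real n"
    have r: "r > 0" using n by (simp add: r_def)
    have "exp (4 * a n - 2 * a (2 * n)) = exp (a n) ^ 4 / exp (a (2 * n)) ^ 2"
      by (simp add: exp_diff exp_of_nat_mult[symmetric])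
    also have "\<dots> = (fact n * exp r / (r ^ n * sqrt r)) ^ 4 / (fact (2 * n) * exp (2 * r) / ((2 * r) ^ (2 * n) * sqrt (2 * r))) ^ 2"
      using n by (simp add: exp_a r_def)
    also have "\<dots> = (fact n ^ 4 * exp r ^ 4 / (r ^ (4 * n) * r ^ 2)) / (fact (2 * n) ^ 2 * exp r ^ 4 / (2 ^ (4 * n) * r ^ (4 * n) * (2 * r)))"
    proof -
      have "sqrt r ^ 4 = r ^ 2" using r by (metis less_eq_real_def mult_2_right numeral_Bit0 power2_eq_square power_add real_sqrt_pow2)
      moreover have "exp (2 * r) = exp r ^ 2" by (simp add: exp_double)
      ultimately show ?thesis using r
        by (simp add: power_divide power_mult_distrib power_mult[symmetric] mult.commute[of n])
    qed
    also have "\<dots> * (r / (2 * (2 * r + 1))) = 2 ^ (4 * n) * fact n ^ 4 / (fact (2 * n) ^ 2 * (2 * r + 1))"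
      using r by (simp add: divide_simps) (simp add: power2_eq_square)
    finally show ?thesis unfolding prod_eq r_def by simp
  qed
  have "(\<lambda>n. exp (4 * a n - 2 * a (2 * n)) * (real n / (2 * (2 * real n + 1)))) \<longlonglongrightarrow> pi / 2"
  proof (rule Lim_transform_eventually[OF wallis])
    show "eventually (\<lambda>n. (\<Prod>k=1..n. (4*real k^2) / (4*real k^2 - 1)) = exp (4 * a n - 2 * a (2 * n)) * (real n / (2 * (2 * real n + 1)))) sequentially"
      by (rule eventually_mono[OF eventually_ge_at_top[of 1]]) (rule wal)
  qed
  moreover have "(\<lambda>n. exp (4 * a n - 2 * a (2 * n)) * (real n / (2 * (2 * real n + 1)))) \<longlonglongrightarrow> exp (4 * A - 2 * A) * (1/4)"
  proof (intro tendsto_mult tendsto_exp tendsto_diff tendsto_const)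
    show "a \<longlonglongrightarrow> A" using lim by (simp add: LIM_zero_iff)
    then show "(\<lambda>n. a (2 * n)) \<longlonglongrightarrow> A"
      by (rule filterlim_compose) real_asymp
    show "(\<lambda>n. real n / (2 * (2 * real n + 1))) \<longlonglongrightarrow> 1/4" by real_asymp
  qed
  ultimately have "pi / 2 = exp (4 * A - 2 * A) * (1/4)" by (rule LIMSEQ_unique)
  \<comment> \<open>Comparing both limits gives pi/2 = e^(2A)/4.\<close>
  then have "exp (2 * A) = 2 * pi" by simp
  then have "exp A ^ 2 = 2 * pi" by (simp add: exp_double)
  then have eA: "exp A = sqrt (2 * pi)" by (metis exp_ge_zero real_sqrt_unique)
  have "eventually (\<lambda>n. \<bar>a n - A\<bar> < 1) at_top"
    using tendstoD[OF lim, of 1] by simp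
  then have "eventually (\<lambda>n. norm (exp (- (a n - A)) - 1) \<le> 2 * norm (a n - A)) at_top"
  proof eventually_elim
    case (elim n)
    have "\<bar>exp x - 1\<bar> \<le> 2 * \<bar>x\<bar>" if "\<bar>x\<bar> \<le> 1" for x :: real
    proof (cases "x \<ge> 0")
      case True
      then have "exp x \<le> 1 + x + x ^ 2" "x ^ 2 \<le> x" "1 \<le> exp x"
        using exp_bound[of x] that mult_left_mono[of x 1 x] by (auto simp: power2_eq_square)
      then show ?thesis using True by linarith
    next
      case False
      then have "exp x \<le> 1" by simp
      then show ?thesis using False exp_ge_add_one_self[of x] by linarith
    qed
    from this[of "- (a n - A)"] show ?case using elim by (simp add: abs_minus_commute)
  qed
  then have "(\<lambda>n. exp (- (a n - A)) - 1) \<in> O(\<lambda>n. a n - A)" by (rule bigoI)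
  also have "(\<lambda>n. a n - A) \<in> O(\<lambda>n. 1 / real n)" by (rule A)
  finally have "(\<lambda>n. 1 / sqrt (2 * pi) * (exp (- (a n - A)) - 1)) \<in> O(\<lambda>n. 1 / real n)"
    by (subst landau_o.big.cmult_in_iff) auto
  moreover have ev: "eventually (\<lambda>n. 1 / sqrt (2 * pi) * (exp (- (a n - A)) - 1) =
      real n ^ n * sqrt (real n) / (exp (real n) * fact n) - 1 / sqrt (2 * pi)) at_top"
    using eventually_ge_at_top[of 1]
  proof eventually_elim
    case (elim n)
    have "exp (- (a n - A)) = sqrt (2 * pi) / (fact n * exp (real n) / (real n ^ n * sqrt (real n)))"
      using eA exp_a[OF elim] by (simp add: exp_diff)
    then show ?case by (simp add: right_diff_distrib mult.commute)
  qed
  ultimately show ?thesis using landau_o.big.in_cong[OF ev] by blast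
qed

text \<open>\<open>P\<close> is the error function up to normalisation. For the last property w is
  joined to its real part by a vertical segment, on which |e^(-u^2)| is largest at w; on the real
  axis the tail is compared with e^(-x).\<close>

lemma erf_like_ex:
  obtains P :: "complex \<Rightarrow> complex" where
    "\<And>w. (P has_field_derivative exp (- w\<^sup>2)) (at w)" "\<And>w. P (- w) = - P w"
    "\<And>w. Re w \<ge> 1 \<Longrightarrow> norm (P w - of_real (sqrt pi / 2)) \<le> exp (- Re w) + \<bar>Im w\<bar> * exp (- Re (w ^ 2))"
proof -
  obtain P1 :: "complex \<Rightarrow> complex" where P1: "\<And>w. (P1 has_field_derivative exp (- w\<^sup>2)) (at w)"
  proof (rule holomorphic_convex_primitive'[of UNIV "\<lambda>w::complex. exp (- w\<^sup>2)"])
    show "(\<lambda>w::complex. exp (- w\<^sup>2)) holomorphic_on UNIV" by (intro holomorphic_intros)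
  qed auto
  define P where "P = (\<lambda>w. P1 w - P1 0)"
  have P: "(P has_field_derivative exp (- w\<^sup>2)) (at w)" for w
    unfolding P_def by (auto intro!: derivative_eq_intros P1)
  have P0: "P 0 = 0" by (simp add: P_def)
  have odd: "P (- w) = - P w" for w
  proof -
    have "((\<lambda>w. P w + P (- w)) has_field_derivative 0) (at x)" for x
      by (rule derivative_eq_intros P DERIV_chain2[OF P] refl | simp)+
    then have "\<exists>c. \<forall>x. P x + P (- x) = c"
      using has_field_derivative_zero_constant[of UNIV "\<lambda>w. P w + P (- w)"] by auto
    then have "P w + P (- w) = P 0 + P (- 0)" by metis
    then show ?thesis by (simp add: P0 add_eq_0_iff)
  qed
  define q where "q = (\<lambda>x::real. integral {0..x} (\<lambda>t. exp (- t\<^sup>2)))"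
  have q: "(q has_real_derivative exp (- x\<^sup>2)) (at x within {0..b})" if "0 \<le> x" "x \<le> b" for x b
    unfolding q_def using that
    by (intro integral_has_real_derivative continuous_intros) auto
  have Pq: "P (of_real x) = of_real (q x)" if "x \<ge> 0" for x
  proof -
    have "((\<lambda>t. exp (- (of_real t)\<^sup>2)) has_integral P (of_real x) - P (of_real 0)) {0..x}"
    proof (rule fundamental_theorem_of_calculus[OF that])
      fix t assume "t \<in> {0..x}"
      show "((\<lambda>t. P (of_real t)) has_vector_derivative exp (- (of_real t)\<^sup>2)) (at t within {0..x})"
        by (rule has_vector_derivative_real_field[OF has_field_derivative_at_within[OF P]])
    qed
    moreover have "((\<lambda>t. of_real (exp (- t\<^sup>2)) :: complex) has_integral of_real (q x)) {0..x}"
      unfolding q_def by (intro has_integral_of_real integrable_integral integrable_continuous_interval continuous_intros)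
    then have "((\<lambda>t. exp (- (of_real t :: complex)\<^sup>2)) has_integral of_real (q x)) {0..x}"
      by (simp flip: exp_of_real)
    ultimately have "P (of_real x) - P (of_real 0) = of_real (q x)" by (rule has_integral_unique)
    then show ?thesis by (simp add: P0)
  qed
  have qlim: "(q \<longlongrightarrow> sqrt pi / 2) at_top"
  proof -
    let ?g = "\<lambda>x::real. indicator {0..} x *\<^sub>R exp (- x\<^sup>2) :: real"
    have g: "integrable lborel ?g" "integral\<^sup>L lborel ?g = sqrt pi / 2"
      using gaussian_moment_0 by (auto simp: has_bochner_integral_iff)
    have "((\<lambda>y. integral\<^sup>L lborel (\<lambda>x. indicator {..y} x *\<^sub>R ?g x)) \<longlongrightarrow> integral\<^sup>L lborel ?g) at_top"
      by (rule tendsto_integral_at_top) (use g in auto)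
    also have "(\<lambda>y. integral\<^sup>L lborel (\<lambda>x. indicator {..y} x *\<^sub>R ?g x)) = q"
    proof
      fix y :: real
      have "integral\<^sup>L lborel (\<lambda>x. indicator {..y} x *\<^sub>R ?g x) = (LINT x:{0..y}|lborel. exp (- x\<^sup>2))"
        unfolding set_lebesgue_integral_def by (intro Bochner_Integration.integral_cong) (auto simp: indicator_def)
      also have "\<dots> = q y"
        unfolding q_def by (intro set_borel_integral_eq_integral borel_integrable_atLeastAtMost') (auto intro!: continuous_intros)
      finally show "integral\<^sup>L lborel (\<lambda>x. indicator {..y} x *\<^sub>R ?g x) = q y" .
    qed
    finally show ?thesis unfolding g(2) .
  qed
  have q_mono: "q x \<le> q y" if "0 \<le> x" "x \<le> y" for x y
    unfolding q_def using that
    by (intro integral_subset_le integrable_continuous_interval continuous_intros) auto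
  \<comment> \<open>For t >= 1 one has e^(-t^2) <= e^(-t), so q(t) + e^(-t) is nonincreasing.
    Together with the monotonicity of q this encloses the limit.\<close>
  have q_upper: "q y + exp (- y) \<le> q x + exp (- x)" if "1 \<le> x" "x \<le> y" for x y
  proof (rule DERIV_nonpos_imp_decreasing_open[OF that(2)])
    fix t assume t: "x < t" "t < y"
    have "(q has_real_derivative exp (- t\<^sup>2)) (at t)"
      using q[of t y] t that at_within_Icc_at[of 0 t y] by simp
    then have "((\<lambda>t. q t + exp (- t)) has_real_derivative exp (- t\<^sup>2) - exp (- t)) (at t)"
      by (auto intro!: derivative_eq_intros)
    moreover have "exp (- t\<^sup>2) - exp (- t) \<le> 0" using t that self_le_power[of t 2] by simp
    ultimately show "\<exists>z. ((\<lambda>t. q t + exp (- t)) has_real_derivative z) (at t) \<and> z \<le> 0" by blast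
  next
    show "continuous_on {x..y} (\<lambda>t. q t + exp (- t))"
      using q[of _ y] that
      by (intro continuous_intros DERIV_continuous_on[of _ _ "\<lambda>x. exp (- x\<^sup>2)"])
        (auto intro: DERIV_subset[of q _ _ "{0..y}"])
  qed
  have q_rate: "\<bar>q x - sqrt pi / 2\<bar> \<le> exp (- x)" if "x \<ge> 1" for x
  proof -
    have "q x \<le> sqrt pi / 2"
      by (rule tendsto_lowerbound[OF qlim]) (use that in \<open>auto intro!: eventually_at_top_linorderI[of x] q_mono\<close>)
    moreover have "((\<lambda>y. q y + exp (- y)) \<longlongrightarrow> sqrt pi / 2 + 0) at_top"
      by (intro tendsto_add qlim) real_asymp
    then have "sqrt pi / 2 + 0 \<le> q x + exp (- x)"
      by (rule tendsto_upperbound) (use that in \<open>auto intro!: eventually_at_top_linorderI[of x] q_upper\<close>)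
    ultimately show ?thesis by (simp add: abs_le_iff)
  qed
  show ?thesis
  proof (rule that[OF P odd])
    fix w :: complex assume w: "Re w \<ge> 1"
    have "norm (P w - P (of_real (Re w))) \<le> exp (- Re (w ^ 2)) * norm (w - of_real (Re w))"
    proof (rule field_differentiable_bound[of "closed_segment w (of_real (Re w))"])
      fix u assume u: "u \<in> closed_segment w (of_real (Re w))"
      show "(P has_field_derivative exp (- u\<^sup>2)) (at u within closed_segment w (of_real (Re w)))"
        by (rule has_field_derivative_at_within[OF P])
      obtain s where s: "0 \<le> s" "s \<le> 1" "u = (1 - s) *\<^sub>R w + s *\<^sub>R of_real (Re w)"
        using u by (auto simp: closed_segment_def)
      have "Re u = Re w" by (simp add: s(3) algebra_simps)
      moreover have "\<bar>Im u\<bar> \<le> \<bar>Im w\<bar>" using s by (simp add: s(3) abs_mult mult_left_le_one_le)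
      then have "(Im u)\<^sup>2 \<le> (Im w)\<^sup>2" by (simp add: abs_le_square_iff)
      ultimately have "Re (w ^ 2) \<le> Re (u ^ 2)" by (simp add: power2_eq_square)
      then show "norm (exp (- u\<^sup>2)) \<le> exp (- Re (w ^ 2))" by simp
    qed auto
    also have "norm (w - of_real (Re w)) = \<bar>Im w\<bar>" by (simp add: cmod_def)
    also have "P (of_real (Re w)) = of_real (q (Re w))" using w by (intro Pq) auto
    finally have "norm (P w - of_real (q (Re w))) \<le> \<bar>Im w\<bar> * exp (- Re (w ^ 2))" by (simp add: mult.commute)
    moreover have "norm (of_real (q (Re w)) - of_real (sqrt pi / 2) :: complex) \<le> exp (- Re w)"
      unfolding of_real_diff[symmetric] norm_of_real using q_rate[OF w] .
    ultimately show "norm (P w - of_real (sqrt pi / 2)) \<le> exp (- Re w) + \<bar>Im w\<bar> * exp (- Re (w ^ 2))"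
      using norm_triangle_ineq[of "P w - of_real (q (Re w))" "of_real (q (Re w)) - of_real (sqrt pi / 2)"] by simp
  qed
qed

text \<open>Substituting w = sqrt(N) \<open>csqrt \<kappa>\<close> v turns the integral into a
  difference of values of the primitive at opposite points. Because \<open>Re \<kappa> > 0\<close>,
  the principal root has positive real part, so these points run off in the directions where the
  primitive converges.\<close>

lemma gauss_segment:
  assumes \<kappa>: "Re \<kappa> > 0" and \<eta>: "\<eta> > 0"
  shows "(\<lambda>N. norm (integral {-\<eta>..\<eta>} (\<lambda>v. exp (- (of_nat N * \<kappa> * (of_real v)\<^sup>2))) - of_real (sqrt (pi / real N)) / csqrt \<kappa>))
    \<in> O(\<lambda>N. 1 / real N)"
proof -
  obtain P :: "complex \<Rightarrow> complex" where P: "\<And>w. (P has_field_derivative exp (- w\<^sup>2)) (at w)" and odd: "\<And>w. P (- w) = - P w"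
    and P_bound: "\<And>w. Re w \<ge> 1 \<Longrightarrow> norm (P w - of_real (sqrt pi / 2)) \<le> exp (- Re w) + \<bar>Im w\<bar> * exp (- Re (w ^ 2))"
    by (rule erf_like_ex) blast
  define s where "s = csqrt \<kappa>"
  have s2: "s ^ 2 = \<kappa>" by (simp add: s_def)
  have s0: "s \<noteq> 0" using \<kappa> by (auto simp: s_def)
  have Res: "Re s > 0"
  proof -
    have "Re s \<ge> 0" unfolding s_def by (rule Re_csqrt)
    moreover have "Re \<kappa> = (Re s)\<^sup>2 - (Im s)\<^sup>2"
      unfolding s2[symmetric] by (simp add: power2_eq_square)
    then have "Re s \<noteq> 0" using \<kappa> zero_le_power2[of "Im s"] by (cases "Re s = 0") auto
    ultimately show ?thesis by simp
  qed
  define w where "w = (\<lambda>N::nat. of_real (sqrt (real N) * \<eta>) * s)"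
  have int_eq: "integral {-\<eta>..\<eta>} (\<lambda>v. exp (- (of_nat N * \<kappa> * (of_real v)\<^sup>2))) = 2 * P (w N) / (of_real (sqrt (real N)) * s)"
    if N: "N \<ge> 1" for N
  proof -
    define c where "c = of_real (sqrt (real N)) * s"
    have c0: "c \<noteq> 0" using N s0 by (simp add: c_def)
    have "of_real (sqrt (real N)) ^ 2 = (of_nat N :: complex)"
      unfolding of_real_power[symmetric] by simp
    then have c2: "c ^ 2 = of_nat N * \<kappa>" unfolding c_def power_mult_distrib s2 by simp
    have "((\<lambda>v. exp (- (of_nat N * \<kappa> * (of_real v)\<^sup>2))) has_integral P (c * of_real \<eta>) / c - P (c * of_real (-\<eta>)) / c) {-\<eta>..\<eta>}"
    proof (rule fundamental_theorem_of_calculus)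
      fix v assume "v \<in> {-\<eta>..\<eta>}"
      have "((\<lambda>z. P (c * z) / c) has_field_derivative exp (- (c * of_real v)\<^sup>2) * c / c) (at (of_real v))"
        by (intro DERIV_cdivide DERIV_chain2[OF P]) (auto intro!: derivative_eq_intros)
      then have "((\<lambda>z. P (c * z) / c) has_field_derivative exp (- (of_nat N * \<kappa> * (of_real v)\<^sup>2))) (at (of_real v))"
        using c0 by (simp add: power_mult_distrib c2)
      then show "((\<lambda>v. P (c * of_real v) / c) has_vector_derivative exp (- (of_nat N * \<kappa> * (of_real v)\<^sup>2))) (at v within {-\<eta>..\<eta>})"
        by (rule has_vector_derivative_real_field[OF has_field_derivative_at_within])
    qed (use \<eta> in auto)
    then have "integral {-\<eta>..\<eta>} (\<lambda>v. exp (- (of_nat N * \<kappa> * (of_real v)\<^sup>2))) = P (c * of_real \<eta>) / c - P (- (c * of_real \<eta>)) / c"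
      by (simp add: integral_unique)
    also have "\<dots> = 2 * P (c * of_real \<eta>) / c" by (simp add: odd)
    also have "c * of_real \<eta> = w N" by (simp add: c_def w_def mult_ac)
    finally show ?thesis by (simp add: c_def)
  qed
  \<comment> \<open>This is the bound of \<open>erf_like_ex\<close> at \<open>w N\<close>. Both
    summands decay exponentially in a power of N.\<close>
  define t where "t = (\<lambda>N::nat. exp (- (sqrt (real N) * (\<eta> * Re s))) + sqrt (real N) * (\<eta> * \<bar>Im s\<bar>) * exp (- (real N * (\<eta>\<^sup>2 * Re \<kappa>))))"
  have pos: "\<eta> * Re s > 0" "\<eta>\<^sup>2 * Re \<kappa> > 0" "\<eta> * \<bar>Im s\<bar> \<ge> 0" using \<eta> Res \<kappa> by auto
  have tbig: "t \<in> O(\<lambda>N. 1 / sqrt (real N))"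
  proof -
    have "(\<lambda>N::nat. exp (- (sqrt (real N) * c))) \<in> O(\<lambda>N. 1 / sqrt (real N))" if "c > 0" for c :: real
      using that by real_asymp
    note 1 = this[OF pos(1)]
    have "(\<lambda>N::nat. sqrt (real N) * exp (- (real N * c))) \<in> O(\<lambda>N. 1 / sqrt (real N))" if "c > 0" for c :: real
      using that by real_asymp
    note 2 = this[OF pos(2)]
    have "(\<lambda>N. c * f N) \<in> O(g)" if "f \<in> O(g)" for c and f g :: "nat \<Rightarrow> real"
      using that by (cases "c = 0") simp_all
    from sum_in_bigo(1)[OF 1 this[OF 2, of "\<eta> * \<bar>Im s\<bar>"]] show ?thesis unfolding t_def by (simp add: mult_ac)
  qed
  have "eventually (\<lambda>N. norm (integral {-\<eta>..\<eta>} (\<lambda>v. exp (- (of_nat N * \<kappa> * (of_real v)\<^sup>2))) - of_real (sqrt (pi / real N)) / csqrt \<kappa>)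
      \<le> 2 / norm s * norm (t N / sqrt (real N))) at_top"
  proof -
    have "eventually (\<lambda>N::nat. sqrt (real N) * c \<ge> 1) at_top" if "c > 0" for c :: real
      using that by real_asymp
    from this[OF pos(1)] show ?thesis using eventually_ge_at_top[of 1]
    proof eventually_elim
      case (elim N)
      have "Re (w N) = sqrt (real N) * (\<eta> * Re s)" by (simp add: w_def mult_ac)
      moreover have "\<bar>Im (w N)\<bar> = sqrt (real N) * (\<eta> * \<bar>Im s\<bar>)" using \<eta> by (simp add: w_def mult_ac abs_mult)
      moreover have "Re ((w N) ^ 2) = real N * (\<eta>\<^sup>2 * Re \<kappa>)"
      proof -
        have "(w N) ^ 2 = of_real (real N * \<eta>\<^sup>2) * \<kappa>"
          unfolding w_def power_mult_distrib s2 of_real_power[symmetric] by simp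
        then show ?thesis by (simp add: mult_ac)
      qed
      ultimately have B: "norm (P (w N) - of_real (sqrt pi / 2)) \<le> t N"
        using P_bound[of "w N"] elim by (simp add: t_def)
      have nX: "norm (2 * X / (of_real (sqrt (real N)) * s)) = 2 / norm s * (norm X / sqrt (real N))" for X
        by (simp add: norm_mult norm_divide)
      have "integral {-\<eta>..\<eta>} (\<lambda>v. exp (- (of_nat N * \<kappa> * (of_real v)\<^sup>2))) - of_real (sqrt (pi / real N)) / csqrt \<kappa>
        = 2 * (P (w N) - of_real (sqrt pi / 2)) / (of_real (sqrt (real N)) * s)"
        unfolding int_eq[OF elim(2)] s_def[symmetric] real_sqrt_divide using s0 elim by (simp add: field_simps)
      also have "norm \<dots> = 2 / norm s * (norm (P (w N) - of_real (sqrt pi / 2)) / sqrt (real N))"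
        by (rule nX)
      also have "\<dots> \<le> 2 / norm s * (t N / sqrt (real N))"
        using B by (intro mult_left_mono divide_right_mono) auto
      also have "\<dots> \<le> 2 / norm s * norm (t N / sqrt (real N))"
        using abs_ge_self[of "t N / sqrt (real N)"] by (intro mult_left_mono) auto
      finally show ?case .
    qed
  qed
  then have "(\<lambda>N. norm (integral {-\<eta>..\<eta>} (\<lambda>v. exp (- (of_nat N * \<kappa> * (of_real v)\<^sup>2))) - of_real (sqrt (pi / real N)) / csqrt \<kappa>))
      \<in> O(\<lambda>N. t N / sqrt (real N))"
    by (intro bigoI[where c = "2 / norm s"]) (simp only: real_norm_def abs_norm_cancel)
  also have "(\<lambda>N. t N / sqrt (real N)) \<in> O(\<lambda>N. 1 / sqrt (real N) / sqrt (real N))"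
    by (intro landau_o.big.divide_right tbig) (auto simp: eventually_sequentially intro!: exI[of _ 1])
  also have "(\<lambda>N. 1 / sqrt (real N) / sqrt (real N)) = (\<lambda>N::nat. 1 / real N)" by simp
  finally show ?thesis .
qed

section \<open>Laplace's method on a symmetric interval\<close>

lemma norm_exp_diff_le:
  fixes x y :: complex
  assumes "Re x \<le> m" "Re y \<le> m"
  shows "norm (exp x - exp y) \<le> norm (x - y) * exp m"
proof -
  have "norm (exp x - exp y) \<le> exp m * norm (x - y)"
  proof (rule field_differentiable_bound[of "closed_segment x y"])
    fix u assume "u \<in> closed_segment x y"
    then obtain s where s: "0 \<le> s" "s \<le> 1" "u = (1 - s) *\<^sub>R x + s *\<^sub>R y"
      by (auto simp: closed_segment_def)
    have "(1 - s) * Re x + s * Re y \<le> (1 - s) * m + s * m"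
      using s assms by (intro add_mono mult_left_mono) auto
    then have "Re u \<le> m" by (simp add: s(3) algebra_simps)
    then show "norm (exp u) \<le> exp m" by simp
  qed (auto intro!: derivative_eq_intros)
  then show ?thesis by (simp add: mult.commute)
qed

text \<open>The majorant 1/(1 + y^2) is chosen for its elementary integral, the arctangent. The
  constant arises from 1 + y^2 <= (1 + 3/a)(1 + a y^2/3) <= (1 + 3/a) exp(a y^2/3), raised to the
  third power.\<close>

lemma poly_exp_bound:
  fixes a :: real
  assumes a: "a > 0"
  obtains K where "K > 0" "\<And>y. 0 \<le> y \<Longrightarrow> y * exp (- (a * y\<^sup>2)) \<le> K / (1 + y\<^sup>2)"
    "\<And>y. 0 \<le> y \<Longrightarrow> y ^ 3 * exp (- (a * y\<^sup>2)) \<le> K / (1 + y\<^sup>2)"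
proof -
  define K where "K = (1 + 3 / a) ^ 3"
  have main: "(1 + y\<^sup>2) ^ 3 * exp (- (a * y\<^sup>2)) \<le> K" for y
  proof -
    have "1 + y\<^sup>2 \<le> (1 + 3 / a) * (1 + a * y\<^sup>2 / 3)"
      using a by (simp add: field_simps)
    also have "\<dots> \<le> (1 + 3 / a) * exp (a * y\<^sup>2 / 3)"
      using a exp_ge_add_one_self[of "a * y\<^sup>2 / 3"] by (intro mult_left_mono) auto
    finally have "(1 + y\<^sup>2) ^ 3 \<le> ((1 + 3 / a) * exp (a * y\<^sup>2 / 3)) ^ 3"
      by (intro power_mono) auto
    also have "\<dots> = K * exp (a * y\<^sup>2)"
      unfolding power_mult_distrib K_def by (simp add: exp_of_nat_mult[symmetric])
    finally show ?thesis by (simp add: exp_minus field_simps)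
  qed
  have red: "x * exp (- (a * y\<^sup>2)) \<le> K / (1 + y\<^sup>2)" if "x * (1 + y\<^sup>2) \<le> (1 + y\<^sup>2) ^ 3" for x y
  proof -
    have "x * (1 + y\<^sup>2) * exp (- (a * y\<^sup>2)) \<le> K"
      by (rule order.trans[OF mult_right_mono[OF that] main]) simp
    moreover have "1 + y\<^sup>2 > 0" by (simp add: add_pos_nonneg)
    ultimately show ?thesis by (simp add: pos_le_divide_eq mult_ac)
  qed
  have pw: "y * (1 + y\<^sup>2) \<le> (1 + y\<^sup>2) ^ 3" "y ^ 3 * (1 + y\<^sup>2) \<le> (1 + y\<^sup>2) ^ 3" if "0 \<le> y" for y :: real
  proof -
    have y: "y \<le> 1 + y\<^sup>2" using zero_le_power2[of "y - 1"] that by (simp add: power2_eq_square algebra_simps)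
    have sq: "1 \<le> 1 + y\<^sup>2" by simp
    have "y * (1 + y\<^sup>2) \<le> (1 + y\<^sup>2) * (1 + y\<^sup>2)" using y by (intro mult_right_mono) auto
    also have "\<dots> \<le> (1 + y\<^sup>2) * (1 + y\<^sup>2) * (1 + y\<^sup>2)" using sq mult_left_mono[OF sq, of "(1 + y\<^sup>2) * (1 + y\<^sup>2)"] by simp
    finally show "y * (1 + y\<^sup>2) \<le> (1 + y\<^sup>2) ^ 3" by (simp add: power3_eq_cube)
    have "y * (y ^ 2) * (1 + y\<^sup>2) \<le> (1 + y\<^sup>2) * (1 + y\<^sup>2) * (1 + y\<^sup>2)"
      using y that by (intro mult_right_mono mult_mono) auto
    then show "y ^ 3 * (1 + y\<^sup>2) \<le> (1 + y\<^sup>2) ^ 3" by (simp add: power3_eq_cube power2_eq_square mult_ac)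
  qed
  have "K > 0" using a by (simp add: K_def add_pos_pos)
  then show ?thesis by (rule that) (auto intro!: red pw)
qed

text \<open>In the scaled variable y = sqrt(N) |v|, replacing the exponent by its quadratic part
  costs M y^3 / sqrt(N), and replacing Q by q0 costs B (y / sqrt(N) + 1/N), both damped by a
  Gaussian in y. Passing back to v in the integral supplies the second factor N^(-1/2).\<close>

lemma laplace_segment:
  fixes r :: "real \<Rightarrow> complex" and Q :: "nat \<Rightarrow> real \<Rightarrow> complex"
  assumes \<kappa>: "Re \<kappa> > 0" and \<eta>: "\<eta> > 0" and M: "M \<ge> 0" "M * \<eta> \<le> Re \<kappa> / 2" and B: "B \<ge> 0"
    and r: "\<And>v. \<bar>v\<bar> \<le> \<eta> \<Longrightarrow> norm (r v + \<kappa> * (of_real v)\<^sup>2) \<le> M * \<bar>v\<bar> ^ 3" "continuous_on {-\<eta>..\<eta>} r"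
    and Q: "\<And>N v. N \<ge> N0 \<Longrightarrow> \<bar>v\<bar> \<le> \<eta> \<Longrightarrow> norm (Q N v - q0) \<le> B * (\<bar>v\<bar> + 1 / real N)"
      "\<And>N. N \<ge> N0 \<Longrightarrow> continuous_on {-\<eta>..\<eta>} (Q N)"
  shows "(\<lambda>N. norm (integral {-\<eta>..\<eta>} (\<lambda>v. exp (of_nat N * r v) * Q N v) - q0 * (of_real (sqrt (pi / real N)) / csqrt \<kappa>)))
    \<in> O(\<lambda>N. 1 / real N)"
proof -
  define a where "a = Re \<kappa> / 2"
  have a: "a > 0" using \<kappa> by (simp add: a_def)
  obtain K where K: "K > 0" "\<And>y. 0 \<le> y \<Longrightarrow> y * exp (- (a * y\<^sup>2)) \<le> K / (1 + y\<^sup>2)"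
    "\<And>y. 0 \<le> y \<Longrightarrow> y ^ 3 * exp (- (a * y\<^sup>2)) \<le> K / (1 + y\<^sup>2)"
    using poly_exp_bound[OF a] by metis
  let ?G = "\<lambda>N v. exp (- (of_nat N * \<kappa> * (of_real v)\<^sup>2)) * q0"
  let ?F = "\<lambda>N v. exp (of_nat N * r v) * Q N v"
  define E where "E = K * (norm q0 * M + B)"
  have E0: "E \<ge> 0" using K M B by (simp add: E_def)
  define bd where "bd = (\<lambda>(N::nat) v::real. E * (1 / (sqrt (real N) * (1 + real N * v\<^sup>2))) + B / real N)"
  have pointwise: "norm (?F N v - ?G N v) \<le> bd N v" if N: "N \<ge> N0" "N \<ge> 1" and v: "\<bar>v\<bar> \<le> \<eta>" for N v
  proof -
    define y where "y = sqrt (real N) * \<bar>v\<bar>"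
    have y: "y \<ge> 0" "y\<^sup>2 = real N * v\<^sup>2" by (auto simp: y_def power_mult_distrib)
    have N': "real N > 0" using N by simp
    \<comment> \<open>The condition \<open>M * \<eta> \<le> Re \<kappa> / 2\<close> lets the cubic
      remainder consume at most half of the Gaussian decay; \<open>a\<close> is the half that is
      left.\<close>
    have m1: "Re (of_nat N * r v) \<le> - (a * y\<^sup>2)"
    proof -
      have "Re (r v + \<kappa> * (of_real v)\<^sup>2) \<le> M * \<bar>v\<bar> ^ 3" using complex_Re_le_cmod r(1)[OF v] by (rule order.trans)
      also have "M * \<bar>v\<bar> ^ 3 = M * \<bar>v\<bar> * v\<^sup>2" by (simp add: power3_eq_cube power2_eq_square)
      also have "\<dots> \<le> a * v\<^sup>2"
        unfolding a_def using M v mult_left_mono[OF v M(1)] by (intro mult_right_mono) auto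
      finally have "Re (r v) + Re \<kappa> * v\<^sup>2 \<le> a * v\<^sup>2" by (simp add: power2_eq_square)
      then have "Re (r v) \<le> - (a * v\<^sup>2)" unfolding a_def by (simp add: algebra_simps)
      then have "real N * Re (r v) \<le> real N * - (a * v\<^sup>2)" by (intro mult_left_mono) auto
      then show ?thesis unfolding y(2) by (simp add: mult_ac)
    qed
    have m2: "Re (- (of_nat N * \<kappa> * (of_real v)\<^sup>2)) \<le> - (a * y\<^sup>2)"
    proof -
      have "Re (- (of_nat N * \<kappa> * (of_real v)\<^sup>2)) = - (2 * (a * y\<^sup>2))" unfolding y(2) a_def by (simp add: power2_eq_square)
      then show ?thesis using a by simp
    qed
    have d1: "norm (exp (of_nat N * r v) - exp (- (of_nat N * \<kappa> * (of_real v)\<^sup>2))) \<le> M * K / (sqrt (real N) * (1 + real N * v\<^sup>2))"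
    proof -
      have "norm (of_nat N * r v - (- (of_nat N * \<kappa> * (of_real v)\<^sup>2))) = real N * norm (r v + \<kappa> * (of_real v)\<^sup>2)"
        by (metis (no_types, opaque_lifting) diff_minus_eq_add distrib_left mult.assoc norm_mult norm_of_nat)
      also have "\<dots> \<le> real N * (M * \<bar>v\<bar> ^ 3)" by (intro mult_left_mono r v) auto
      also have "\<dots> = M * y ^ 3 / sqrt (real N)"
        using N' by (simp add: y_def power_mult_distrib power3_eq_cube field_simps)
      finally have "norm (exp (of_nat N * r v) - exp (- (of_nat N * \<kappa> * (of_real v)\<^sup>2))) \<le> M * y ^ 3 / sqrt (real N) * exp (- (a * y\<^sup>2))"
        using norm_exp_diff_le[OF m1 m2] by (meson exp_ge_zero mult_right_mono order.trans)
      also have "\<dots> = M / sqrt (real N) * (y ^ 3 * exp (- (a * y\<^sup>2)))" by simp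
      also have "\<dots> \<le> M / sqrt (real N) * (K / (1 + y\<^sup>2))" using M K y(1) by (intro mult_left_mono) auto
      finally show ?thesis by (simp add: y(2))
    qed
    have d2: "norm (exp (of_nat N * r v) * (Q N v - q0)) \<le> B * K / (sqrt (real N) * (1 + real N * v\<^sup>2)) + B / real N"
    proof -
      have "norm (exp (of_nat N * r v) * (Q N v - q0)) \<le> exp (- (a * y\<^sup>2)) * (B * (\<bar>v\<bar> + 1 / real N))"
        unfolding norm_mult using m1 by (intro mult_mono Q N v) auto
      also have "\<dots> = B / sqrt (real N) * (y * exp (- (a * y\<^sup>2))) + B / real N * exp (- (a * y\<^sup>2))"
        using N' by (simp add: y_def field_simps)
      also have "\<dots> \<le> B / sqrt (real N) * (K / (1 + y\<^sup>2)) + B / real N * 1"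
        using B K y(1) a by (intro add_mono mult_left_mono) auto
      finally show ?thesis by (simp add: y(2))
    qed
    have "norm (?F N v - ?G N v) = norm ((exp (of_nat N * r v) - exp (- (of_nat N * \<kappa> * (of_real v)\<^sup>2))) * q0 + exp (of_nat N * r v) * (Q N v - q0))"
      by (simp add: algebra_simps)
    also have "\<dots> \<le> norm (exp (of_nat N * r v) - exp (- (of_nat N * \<kappa> * (of_real v)\<^sup>2))) * norm q0 + norm (exp (of_nat N * r v) * (Q N v - q0))"
      by (metis norm_triangle_ineq norm_mult)
    also have "\<dots> \<le> M * K / (sqrt (real N) * (1 + real N * v\<^sup>2)) * norm q0 + (B * K / (sqrt (real N) * (1 + real N * v\<^sup>2)) + B / real N)"
      by (intro add_mono mult_right_mono d1 d2) auto
    also have "\<dots> = bd N v"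
      unfolding bd_def E_def by (simp add: algebra_simps add_divide_distrib)
    finally show ?thesis .
  qed
  have bd_int: "(bd N has_integral E * (arctan (sqrt (real N) * \<eta>) / real N - arctan (sqrt (real N) * (-\<eta>)) / real N) + 2 * \<eta> * (B / real N)) {-\<eta>..\<eta>}"
    if N: "N \<ge> 1" for N
  proof -
    have "((\<lambda>v. 1 / (sqrt (real N) * (1 + real N * v\<^sup>2))) has_integral arctan (sqrt (real N) * \<eta>) / real N - arctan (sqrt (real N) * (-\<eta>)) / real N) {-\<eta>..\<eta>}"
    proof (rule fundamental_theorem_of_calculus)
      fix v assume "v \<in> {-\<eta>..\<eta>}"
      have "((\<lambda>v. arctan (sqrt (real N) * v) / real N) has_real_derivative (inverse (1 + (sqrt (real N) * v)\<^sup>2) * sqrt (real N)) / real N) (at v)"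
        using N by (auto intro!: derivative_eq_intros)
      also have "(inverse (1 + (sqrt (real N) * v)\<^sup>2) * sqrt (real N)) / real N = 1 / (sqrt (real N) * (1 + real N * v\<^sup>2))"
      proof -
        have "sqrt (real N) / real N = 1 / sqrt (real N)" using N by (simp add: real_div_sqrt field_simps)
        then show ?thesis by (simp add: power_mult_distrib divide_inverse mult_ac)
      qed
      finally show "((\<lambda>v. arctan (sqrt (real N) * v) / real N) has_vector_derivative 1 / (sqrt (real N) * (1 + real N * v\<^sup>2))) (at v within {-\<eta>..\<eta>})"
        by (simp add: has_real_derivative_iff_has_vector_derivative[symmetric] has_field_derivative_at_within)
    qed (use \<eta> in auto)
    moreover have "((\<lambda>v::real. B / real N) has_integral 2 * \<eta> * (B / real N)) {-\<eta>..\<eta>}"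
      using has_integral_const_real[of "B / real N" "-\<eta>" \<eta>] \<eta> by simp
    ultimately show ?thesis unfolding bd_def by (intro has_integral_add has_integral_mult_right)
  qed
  have contF: "continuous_on {-\<eta>..\<eta>} (?F N)" if "N \<ge> N0" for N
    by (intro continuous_intros r Q that)
  have contG: "continuous_on {-\<eta>..\<eta>} (?G N)" for N by (intro continuous_intros)
  have diff: "norm (integral {-\<eta>..\<eta>} (?F N) - integral {-\<eta>..\<eta>} (?G N)) \<le> (E * pi + 2 * \<eta> * B) * norm (1 / real N)"
    if N: "N \<ge> N0" "N \<ge> 1" for N
  proof -
    have "integral {-\<eta>..\<eta>} (?F N) - integral {-\<eta>..\<eta>} (?G N) = integral {-\<eta>..\<eta>} (\<lambda>v. ?F N v - ?G N v)"
      by (intro integral_diff[symmetric] integrable_continuous_interval contF contG N)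
    also have "norm \<dots> \<le> integral {-\<eta>..\<eta>} (bd N)"
    proof (rule integral_norm_bound_integral)
      show "(\<lambda>v. ?F N v - ?G N v) integrable_on {-\<eta>..\<eta>}"
        by (intro integrable_continuous_interval continuous_on_diff contF contG N)
      show "bd N integrable_on {-\<eta>..\<eta>}" using bd_int[OF N(2)] by blast
      show "norm (?F N v - ?G N v) \<le> bd N v" if "v \<in> {-\<eta>..\<eta>}" for v
        using that by (intro pointwise N) auto
    qed
    also have "\<dots> = E * (arctan (sqrt (real N) * \<eta>) / real N - arctan (sqrt (real N) * (-\<eta>)) / real N) + 2 * \<eta> * (B / real N)"
      by (rule integral_unique[OF bd_int[OF N(2)]])
    also have "\<dots> \<le> E * (pi / real N) + 2 * \<eta> * (B / real N)"
      unfolding diff_divide_distrib[symmetric] using arctan_bounded[of "sqrt (real N) * \<eta>"]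
      by (intro add_right_mono mult_left_mono E0 divide_right_mono) (auto simp: arctan_minus)
    finally show ?thesis by (simp add: algebra_simps)
  qed
  have "(\<lambda>N. norm (integral {-\<eta>..\<eta>} (?F N) - integral {-\<eta>..\<eta>} (?G N))) \<in> O(\<lambda>N. 1 / real N)"
    by (rule bigoI[where c = "E * pi + 2 * \<eta> * B"])
       (use diff in \<open>auto simp: eventually_sequentially intro!: exI[of _ "max N0 1"]\<close>)
  moreover have "(\<lambda>N. norm q0 * norm (integral {-\<eta>..\<eta>} (\<lambda>v. exp (- (of_nat N * \<kappa> * (of_real v)\<^sup>2))) - of_real (sqrt (pi / real N)) / csqrt \<kappa>)) \<in> O(\<lambda>N. 1 / real N)"
    using gauss_segment[OF \<kappa> \<eta>] by (cases "q0 = 0") simp_all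
  ultimately have "(\<lambda>N. norm (integral {-\<eta>..\<eta>} (?F N) - integral {-\<eta>..\<eta>} (?G N)) +
     norm q0 * norm (integral {-\<eta>..\<eta>} (\<lambda>v. exp (- (of_nat N * \<kappa> * (of_real v)\<^sup>2))) - of_real (sqrt (pi / real N)) / csqrt \<kappa>)) \<in> O(\<lambda>N. 1 / real N)"
    by (rule sum_in_bigo)
  moreover have "norm (integral {-\<eta>..\<eta>} (?F N) - q0 * (of_real (sqrt (pi / real N)) / csqrt \<kappa>)) \<le>
      norm (integral {-\<eta>..\<eta>} (?F N) - integral {-\<eta>..\<eta>} (?G N)) +
      norm q0 * norm (integral {-\<eta>..\<eta>} (\<lambda>v. exp (- (of_nat N * \<kappa> * (of_real v)\<^sup>2))) - of_real (sqrt (pi / real N)) / csqrt \<kappa>)" for N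
  proof -
    have eq: "integral {-\<eta>..\<eta>} (?F N) - q0 * (of_real (sqrt (pi / real N)) / csqrt \<kappa>) =
      (integral {-\<eta>..\<eta>} (?F N) - integral {-\<eta>..\<eta>} (?G N)) +
      q0 * (integral {-\<eta>..\<eta>} (\<lambda>v. exp (- (of_nat N * \<kappa> * (of_real v)\<^sup>2))) - of_real (sqrt (pi / real N)) / csqrt \<kappa>)"
      by (simp add: algebra_simps)
    show ?thesis unfolding eq norm_mult[symmetric] by (rule norm_triangle_ineq)
  qed
  ultimately show ?thesis
    by (elim landau_o.big_trans[rotated] | intro bigoI[where c = 1] always_eventually allI)+ (simp add: order.trans[OF _ abs_ge_self])
qed

section \<open>The dilogarithm\<close>

lemma suminf_tail_bound:
  fixes f :: "nat \<Rightarrow> complex"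
  assumes f: "\<And>n. n \<ge> K \<Longrightarrow> norm (f n) \<le> B * q ^ n" and q: "0 \<le> q" "q < 1"
  shows "summable f" "norm (suminf f - (\<Sum>n<K. f n)) \<le> B * q ^ K / (1 - q)"
proof -
  have geo: "(\<lambda>n. B * q ^ (n + K)) sums (B * q ^ K / (1 - q))"
    using sums_mult[OF geometric_sums[of q], of "B * q ^ K"] q by (simp add: power_add mult_ac)
  have le: "norm (f (n + K)) \<le> B * q ^ (n + K)" for n using f by simp
  have "summable (\<lambda>n. f (n + K))"
    by (rule summable_comparison_test'[OF sums_summable[OF geo], of 0]) (use le in auto)
  then show s: "summable f" by (simp add: summable_iff_shift)
  have "norm (\<Sum>n. f (n + K)) \<le> (\<Sum>n. B * q ^ (n + K))"
    by (rule norm_suminf_le[OF le sums_summable[OF geo]])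
  then show "norm (suminf f - (\<Sum>n<K. f n)) \<le> B * q ^ K / (1 - q)"
    using suminf_minus_initial_segment[OF s, of K] sums_unique[OF geo] by simp
qed

lemma Li2_tail_bound:
  assumes "norm w \<le> q" "q < 1"
  shows "norm (Li2 w - (\<Sum>n<K. w ^ Suc n / of_nat (Suc n) ^ 2)) \<le> q ^ Suc K / (1 - q)"
proof -
  have q: "0 \<le> q" using assms norm_ge_zero order.trans by blast
  have "norm (w ^ Suc n / of_nat (Suc n) ^ 2) \<le> q * q ^ n" for n
  proof -
    have "norm (w ^ Suc n / of_nat (Suc n) ^ 2) = norm w ^ Suc n / real (Suc n) ^ 2"
      by (simp add: norm_divide norm_power norm_mult del: of_nat_Suc)
    also have "\<dots> \<le> q ^ Suc n / 1" using assms q by (intro frac_le power_mono) auto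
    finally show ?thesis by simp
  qed
  from suminf_tail_bound(2)[of K "\<lambda>n. w ^ Suc n / of_nat (Suc n) ^ 2", OF this q assms(2)]
  show ?thesis unfolding Li2_def by simp
qed

lemma norm_Li2_le:
  assumes "norm w \<le> q" "q < 1"
  shows "norm (Li2 w) \<le> q / (1 - q)"
  using Li2_tail_bound[OF assms, of 0] by simp

lemma Ln_sums:
  assumes "norm w < 1"
  shows "(\<lambda>n. w ^ Suc n / of_nat (Suc n)) sums (- Ln (1 - w))"
proof -
  have "(\<lambda>n. - (w ^ n / of_nat n)) sums Ln (1 - w)"
    using Ln_series'[of "- w"] assms by simp
  from sums_minus[OF this] have "(\<lambda>n. w ^ n / of_nat n) sums (- Ln (1 - w))" by simp
  then show ?thesis by (subst sums_Suc_iff) simp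
qed

lemma Ln_tail_bound:
  assumes "norm w \<le> q" "q < 1"
  shows "norm (- Ln (1 - w) - (\<Sum>n<K. w ^ Suc n / of_nat (Suc n))) \<le> q ^ Suc K / (1 - q) / real (Suc K)"
proof -
  have q: "0 \<le> q" using assms norm_ge_zero order.trans by blast
  have "norm (w ^ Suc n / of_nat (Suc n)) \<le> q / real (Suc K) * q ^ n" if "n \<ge> K" for n
  proof -
    have "norm (w ^ Suc n / of_nat (Suc n)) = norm w ^ Suc n / real (Suc n)"
      by (simp add: norm_divide norm_power norm_mult del: of_nat_Suc)
    also have "\<dots> \<le> q ^ Suc n / real (Suc K)" using assms q that by (intro frac_le power_mono) auto
    finally show ?thesis by simp
  qed
  from suminf_tail_bound(2)[of K "\<lambda>n. w ^ Suc n / of_nat (Suc n)", OF this q assms(2)]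
  show ?thesis using sums_unique[OF Ln_sums[of w]] assms by (simp add: mult_ac)
qed

lemma summable_inverse_squares: "summable (\<lambda>n. 1 / of_nat n ^ 2 :: complex)"
  using inverse_power_summable[of 2, where ?'a = complex] by (simp add: inverse_eq_divide)

lemma Li2_power_series:
  assumes "norm w \<le> 1"
  shows "summable (\<lambda>n. 1 / of_nat n ^ 2 * w ^ n)" "Li2 w = (\<Sum>n. 1 / of_nat n ^ 2 * w ^ n)"
proof -
  have S: "summable (\<lambda>n. norm (1 / of_nat n ^ 2 :: complex))"
    using inverse_power_summable[of 2, where ?'a = real] by (simp add: inverse_eq_divide norm_divide norm_power)
  show s: "summable (\<lambda>n. 1 / of_nat n ^ 2 * w ^ n)"
  proof (rule summable_comparison_test'[OF S, of 0])
    fix n :: nat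
    have "norm w ^ n \<le> 1" using assms by (intro power_le_one) auto
    then show "norm (1 / of_nat n ^ 2 * w ^ n) \<le> norm (1 / of_nat n ^ 2 :: complex)"
      unfolding norm_mult norm_power using mult_left_le[of "norm w ^ n" "norm (1 / of_nat n ^ 2 :: complex)"] by simp
  qed
  show "Li2 w = (\<Sum>n. 1 / of_nat n ^ 2 * w ^ n)"
    using suminf_split_head[OF s] unfolding Li2_def by simp
qed

lemma Li2_deriv:
  assumes w: "norm w < 1" "w \<noteq> 0"
  shows "(Li2 has_field_derivative (- Ln (1 - w) / w)) (at w)"
proof -
  let ?c = "\<lambda>n. 1 / of_nat n ^ 2 :: complex"
  have "((\<lambda>x. \<Sum>n. ?c n * x ^ n) has_field_derivative (\<Sum>n. diffs ?c n * w ^ n)) (at w)"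
    by (rule termdiffs_strong[of _ 1]) (use summable_inverse_squares w in auto)
  also have "(\<lambda>n. diffs ?c n * w ^ n) = (\<lambda>n. (w ^ Suc n / of_nat (Suc n)) / w)"
    using w by (auto simp: fun_eq_iff diffs_def power2_eq_square divide_simps simp del: of_nat_Suc)
  also have "(\<Sum>n. (w ^ Suc n / of_nat (Suc n)) / w) = - Ln (1 - w) / w"
    by (rule sums_unique[OF sums_divide[OF Ln_sums[OF w(1)]], symmetric])
  finally show ?thesis
  proof (rule has_field_derivative_transform_within_open[of _ _ _ "ball 0 1"])
    fix x :: complex assume "x \<in> ball 0 1"
    then show "(\<Sum>n. ?c n * x ^ n) = Li2 x" using Li2_power_series(2)[of x] by (simp add: dist_norm)
  qed (use w in \<open>auto simp: dist_norm\<close>)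
qed

text \<open>The coefficients 1/n^2 are summable, so convergence is uniform up to the unit circle.
  The boundary values at 1 and at -i are both used.\<close>

lemma continuous_on_Li2: "continuous_on (cball 0 1) Li2"
proof -
  have S: "summable (\<lambda>n. norm (1 / of_nat n ^ 2 :: complex))"
    using inverse_power_summable[of 2, where ?'a = real] by (simp add: inverse_eq_divide norm_divide norm_power)
  have "uniform_limit (cball 0 1) (\<lambda>n w. \<Sum>i<n. 1 / of_nat i ^ 2 * w ^ i) (\<lambda>w. \<Sum>i. 1 / of_nat i ^ 2 * w ^ i :: complex) sequentially"
  proof (rule Weierstrass_m_test[OF _ S])
    fix n and w :: complex assume "w \<in> cball 0 1"
    then have "norm w ^ n \<le> 1" by (intro power_le_one) auto
    then show "norm (1 / of_nat n ^ 2 * w ^ n) \<le> norm (1 / of_nat n ^ 2 :: complex)"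
      unfolding norm_mult norm_power using mult_left_le[of "norm w ^ n" "norm (1 / of_nat n ^ 2 :: complex)"] by simp
  qed
  then have "continuous_on (cball 0 1) (\<lambda>w. \<Sum>i. 1 / of_nat i ^ 2 * w ^ i :: complex)"
  proof (rule uniform_limit_theorem[rotated])
    show "\<forall>\<^sub>F n in sequentially. continuous_on (cball 0 1) (\<lambda>w. \<Sum>i<n. 1 / of_nat i ^ 2 * w ^ i :: complex)"
      by (intro always_eventually allI continuous_on_sum continuous_on_mult continuous_on_const continuous_on_power continuous_on_id)
  qed simp
  then show ?thesis
    by (rule continuous_on_eq) (simp add: Li2_power_series(2))
qed

lemma Li2_1: "Li2 1 = of_real (pi ^ 2 / 6)"
proof -
  have "(\<lambda>n. of_real (1 / (real n + 1)\<^sup>2)) sums (of_real (pi\<^sup>2 / 6) :: complex)"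
    using inverse_squares_sums by (subst sums_of_real_iff) (simp add: add.commute)
  then show ?thesis unfolding Li2_def by (simp add: sums_iff add.commute)
qed

text \<open>The imaginary part is minus Catalan's constant 1 - 1/9 + 1/25 - ..., since only odd
  powers of -i have an imaginary part.\<close>

lemma Im_Li2_minus_i: "Im (Li2 (-\<i>)) \<le> - (227/250)"
proof -
  define a where "a = (\<lambda>n::nat. 1 / real (2 * n + 1) ^ 2)"
  have "(\<lambda>n. 1 / of_nat n ^ 2 * (-\<i>) ^ n) sums Li2 (-\<i>)"
    using Li2_power_series[of "-\<i>"] by (simp add: sums_iff)
  then have "(\<lambda>n. Im (1 / of_nat n ^ 2 * (-\<i>) ^ n)) sums Im (Li2 (-\<i>))"
    by (rule sums_Im)
  moreover have "Im (1 / of_nat n ^ 2 * (-\<i>) ^ n) = (if odd n then - ((-1) ^ (n div 2) * a (n div 2)) else 0)" for n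
  proof (cases "odd n")
    case True
    then obtain k where k: "n = 2 * k + 1" by (rule oddE)
    have "(-\<i>) ^ n = - ((-1) ^ k * \<i>)" unfolding k by (simp add: power_mult)
    then have "1 / of_nat n ^ 2 * (-\<i>) ^ n = of_real (- ((-1) ^ k * a k)) * \<i>"
      by (simp add: a_def k)
    moreover have "Im (of_real c * \<i>) = c" for c by simp
    ultimately show ?thesis using True k by simp
  next
    case False
    then obtain k where k: "n = 2 * k" by (auto elim: evenE)
    have "1 / of_nat n ^ 2 * (-\<i>) ^ n = of_real (1 / real n ^ 2 * (-1) ^ k)" unfolding k by (simp add: power_mult)
    then show ?thesis using False Im_complex_of_real[of "1 / real n ^ 2 * (-1) ^ k"] by simp
  qed
  ultimately have "(\<lambda>n. if odd n then - ((-1) ^ (n div 2) * a (n div 2)) else 0) sums Im (Li2 (-\<i>))" by simp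
  then have "(\<lambda>n. if odd (2 * n + 1) then - ((-1) ^ ((2 * n + 1) div 2) * a ((2 * n + 1) div 2)) else 0) sums Im (Li2 (-\<i>))"
    by (rule sums_mono_reindex[THEN iffD2, rotated -1]) (auto simp: strict_mono_def elim!: oddE)
  then have s: "(\<lambda>n. - ((-1) ^ n * a n)) sums Im (Li2 (-\<i>))" by simp
  \<comment> \<open>A partial sum of even length of an alternating series is a lower bound; four
    terms give slightly more than 227/250.\<close>
  have leib: "(\<Sum>i<2*n. (-1)^i * a i) \<le> (\<Sum>i. (-1)^i * a i)" for n
  proof (rule summable_Leibniz'(2))
    show "a \<longlonglongrightarrow> 0" unfolding a_def by real_asymp
    show "0 \<le> a n" "a (Suc n) \<le> a n" for n
      unfolding a_def by (auto intro!: frac_le power_mono)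
  qed
  have "Im (Li2 (-\<i>)) = - (\<Sum>i. (-1)^i * a i)"
    using s sums_minus[OF s] by (simp add: sums_iff suminf_minus)
  also have "\<dots> \<le> - (\<Sum>i<2*2. (-1)^i * a i)" using leib[of 2] by simp
  also have "(\<Sum>i<2*2. (-1)^i * a i) = 1 - 1/9 + 1/25 - 1/49"
    by (simp add: a_def eval_nat_numeral)
  finally show ?thesis by simp
qed

section \<open>Location of the saddle point\<close>

text \<open>The equation of $z_0$ in terms of $w = e^z$. Since $\mathrm{Im}\,z_0 \approx 7.42$ lies between
  $2\pi$ and $3\pi$, one has $z = \mathrm{Ln}\,w + 2\pi i$.\<close>

definition saddle_fun :: "complex \<Rightarrow> complex" where
  "saddle_fun w = (Ln w + 2 * of_real pi * \<i>) * Ln (1 - w) + Li2 w - of_real (pi ^ 2 / 6)"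

text \<open>Differentiating the factor \<open>Ln w\<close> produces Ln(1 - w)/w, which cancels the
  derivative of the dilogarithm.\<close>

lemma saddle_fun_deriv:
  assumes w: "norm w < 1" "Im w > 0"
  shows "(saddle_fun has_field_derivative - ((Ln w + 2 * of_real pi * \<i>) / (1 - w))) (at w)"
proof -
  have w0: "w \<noteq> 0" "w \<notin> \<real>\<^sub>\<le>\<^sub>0" using w by (auto simp: complex_nonpos_Reals_iff)
  have "Re w < 1" using w(1) complex_Re_le_cmod[of w] by linarith
  then have w1: "1 - w \<notin> \<real>\<^sub>\<le>\<^sub>0" "1 - w \<noteq> 0" by (auto simp: complex_nonpos_Reals_iff complex_eq_iff)
  show ?thesis unfolding saddle_fun_def
    by (rule derivative_eq_intros Li2_deriv[OF w(1) w0(1)] refl w0 w1 | simp)+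
      (use w0 w1 in \<open>simp add: field_simps\<close>)
qed

text \<open>Applying ln x <= x - 1 to 1/sqrt(r) rather than to 1/r gives 2 (sqrt(r) - r), whose
  maximum is 1/2.\<close>

lemma log_mult_bound:
  assumes "0 < r" "r \<le> 1" shows "r * (- ln r) \<le> (1/2 :: real)"
proof -
  have "- ln r = 2 * ln (1 / sqrt r)" using assms by (simp add: ln_div ln_sqrt)
  also have "\<dots> \<le> 2 * (1 / sqrt r - 1)" using ln_le_minus_one[of "1 / sqrt r"] assms by simp
  finally have "r * (- ln r) \<le> r * (2 * (1 / sqrt r - 1))" using assms by (intro mult_left_mono) auto
  also have "\<dots> = 2 * (sqrt r - r)"
  proof -
    have "r * (2 * (1 / sqrt r - 1)) = 2 * (r / sqrt r - r)" by (simp add: algebra_simps)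
    then show ?thesis using assms by (simp add: real_div_sqrt)
  qed
  also have "\<dots> \<le> 1/2"
    using zero_le_power2[of "sqrt r - 1/2"] assms by (simp add: power2_eq_square algebra_simps)
  finally show ?thesis .
qed

text \<open>The half disc is convex. If two points had the same value, the mean value theorem, with
  the function multiplied by i/(v - u), would give an x where z/(1 - x) is real, for z = Ln x + 2 pi
  i. But Im z (1 - Re x) + Re z Im x is at least 6 * 7/20 - 1/2. The radius 13/20 covers e^z for all
  z in the disc that defines \<open>z0\<close>.\<close>

lemma saddle_fun_inj:
  assumes "Im u > 0" "norm u < 13/20" "Im v > 0" "norm v < 13/20" "saddle_fun u = saddle_fun v"
  shows "u = v"
proof (rule ccontr)
  assume "u \<noteq> v"
  let ?d = "v - u"
  have sub: "closed_segment u v \<subseteq> {x. Im x > 0} \<inter> ball 0 (13/20)"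
    by (rule closed_segment_subset) (use assms in \<open>auto simp: dist_norm intro: convex_Int convex_halfspace_Im_gt convex_ball\<close>)
  have "\<exists>x. x \<in> closed_segment u v \<and> Re (saddle_fun v * (\<i> / ?d)) - Re (saddle_fun u * (\<i> / ?d)) =
      Re ((- ((Ln x + 2 * of_real pi * \<i>) / (1 - x)) * (\<i> / ?d)) * (v - u))"
  proof (rule complex_mvt_line)
    fix x assume "x \<in> closed_segment u v"
    then have "x \<in> {x. Im x > 0} \<inter> ball 0 (13/20)" using sub by blast
    then show "((\<lambda>w. saddle_fun w * (\<i> / ?d)) has_field_derivative - ((Ln x + 2 * of_real pi * \<i>) / (1 - x)) * (\<i> / ?d)) (at x)"
      by (intro DERIV_cmult_right saddle_fun_deriv) (auto simp: dist_norm)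
  qed
  then obtain x where x: "x \<in> closed_segment u v" and
     eq: "Re ((- ((Ln x + 2 * of_real pi * \<i>) / (1 - x)) * (\<i> / ?d)) * (v - u)) = 0"
    using assms(5) by auto
  have "x \<in> {x. Im x > 0} \<inter> ball 0 (13/20)" using x sub by blast
  then have x': "Im x > 0" "norm x < 13/20" by (auto simp: dist_norm)
  then have x0: "x \<noteq> 0" by auto
  define z where "z = Ln x + 2 * of_real pi * \<i>"
  have Rez: "Re z = ln (norm x)" using x0 by (simp add: z_def)
  have Imz: "Im z \<ge> 6"
  proof -
    have "Im (Ln x) > 0" using Im_Ln_pos_lt_imp[OF x'(1)] by simp
    then show ?thesis using pi_gt3 by (simp add: z_def)
  qed
  have h: "(- (z / (1 - x)) * (\<i> / ?d)) * (v - u) = - (\<i> * (z / (1 - x)))" using \<open>u \<noteq> v\<close> by simp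
  have "Re (- (\<i> * q)) = Im q" for q by simp
  from this[of "z / (1 - x)"] have "Im (z / (1 - x)) = 0" using eq[folded z_def] unfolding h by linarith
  moreover have "Im (z / (1 - x)) = (Im z * (1 - Re x) + Re z * Im x) / (norm (1 - x))\<^sup>2"
    by (simp add: Im_divide cmod_power2)
  moreover have "Im z * (1 - Re x) + Re z * Im x > 0"
  proof -
    have "Re x < 13/20" using complex_Re_le_cmod[of x] x' by linarith
    then have "Im z * (1 - Re x) \<ge> 6 * (7/20)" using Imz by (intro mult_mono) auto
    moreover have "Re z * Im x \<ge> - (1/2)"
    proof -
      have "Im x \<le> norm x" by (rule abs_le_D1[OF abs_Im_le_cmod])
      moreover have "- Re z \<ge> 0" using Rez x0 x'(2) by simp
      ultimately have "Im x * (- Re z) \<le> norm x * (- Re z)" by (rule mult_right_mono)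
      also have "\<dots> \<le> 1/2" unfolding Rez using x0 x'(2) by (intro log_mult_bound) auto
      finally show ?thesis by (simp add: mult.commute)
    qed
    ultimately show ?thesis by simp
  qed
  moreover have "norm (1 - x) \<noteq> 0" using x'(1) by (auto simp: complex_eq_iff)
  ultimately show False by simp
qed

section \<open>Numerical enclosure of the saddle point\<close>

lemma exp_ge_even_Taylor:
  assumes "even n"
  shows "exp x \<ge> (\<Sum>m<n. x ^ m / fact m :: real)"
proof -
  obtain t where "exp x = (\<Sum>m<n. x ^ m / fact m) + exp t / fact n * x ^ n"
    using Maclaurin_exp_le[of x n] by blast
  \<comment> \<open>For even n the Lagrange remainder is nonnegative whatever the sign of x, so the
    bound also serves negative arguments.\<close>
  moreover have "exp t / fact n * x ^ n \<ge> 0"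
    using zero_le_even_power[OF assms, of x] by simp
  ultimately show ?thesis by linarith
qed

lemma ln_5_bounds: "1609/1000 \<le> ln (5::real)" "ln (5::real) \<le> 3221/2000"
proof -
  have "(\<Sum>m<10. (-(1609/1000)) ^ m / fact m :: real) \<ge> 1/5"
    by (simp add: eval_nat_numeral fact_numeral)
  with exp_ge_even_Taylor[of 10 "-(1609/1000)"] have "exp (-(1609/1000)) \<ge> (1/5 :: real)" by simp
  then have "exp (1609/1000) \<le> (5::real)" by (simp add: exp_minus field_simps)
  then show "1609/1000 \<le> ln (5::real)" by (subst ln_ge_iff) auto
  have "(\<Sum>m<10. (3221/2000) ^ m / fact m :: real) \<ge> 5"
    by (simp add: eval_nat_numeral fact_numeral)
  with exp_ge_even_Taylor[of 10 "(3221/2000)"] have "exp (3221/2000) \<ge> (5 :: real)" by simp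
  then show "ln (5::real) \<le> 3221/2000" by (metis exp_gt_zero ln_exp ln_mono zero_less_numeral)
qed

text \<open>The argument is the ratio of real to imaginary part of \<open>wc\<close>. The truncated
  arctangent series differ from the arctangent by functions with derivative t^6/(1 + t^2) and t^8/(1
  + t^2) respectively, which fixes the signs of the errors.\<close>

lemma arctan_bounds_369: "54/125 \<le> arctan (369/800)" "arctan (369/800) \<le> 4329/10000"
proof -
  have 1: "arctan x \<le> x - x^3/3 + x^5/5" if "x \<ge> 0" for x :: real
  proof -
    have "(\<lambda>x. x - x^3/3 + x^5/5 - arctan x) 0 \<le> (\<lambda>x. x - x^3/3 + x^5/5 - arctan x) x"
    proof (rule DERIV_nonneg_imp_nondecreasing[OF that])
      fix t :: real
      have d: "((\<lambda>x. x - x^3/3 + x^5/5 - arctan x) has_real_derivative (1 - t^2 + t^4 - inverse (1 + t\<^sup>2))) (at t)"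
        by (auto intro!: derivative_eq_intros)
      have eq: "1 - t^2 + t^4 - inverse (1 + t\<^sup>2) = t^6 / (1 + t\<^sup>2)"
        using add_pos_nonneg[of 1 "t\<^sup>2"] by (simp add: field_simps eval_nat_numeral)
      have "t^6 / (1 + t\<^sup>2) \<ge> 0" by (intro divide_nonneg_nonneg) (auto simp: zero_le_even_power)
      then show "\<exists>y. ((\<lambda>x. x - x^3/3 + x^5/5 - arctan x) has_real_derivative y) (at t) \<and> 0 \<le> y"
        using d unfolding eq by (intro exI[of _ "t^6 / (1 + t\<^sup>2)"] conjI)
    qed
    then show ?thesis by simp
  qed
  have 2: "x - x^3/3 + x^5/5 - x^7/7 \<le> arctan x" if "x \<ge> 0" for x :: real
  proof -
    have "(\<lambda>x. arctan x - (x - x^3/3 + x^5/5 - x^7/7)) 0 \<le> (\<lambda>x. arctan x - (x - x^3/3 + x^5/5 - x^7/7)) x"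
    proof (rule DERIV_nonneg_imp_nondecreasing[OF that])
      fix t :: real
      have d: "((\<lambda>x. arctan x - (x - x^3/3 + x^5/5 - x^7/7)) has_real_derivative (inverse (1 + t\<^sup>2) - (1 - t^2 + t^4 - t^6))) (at t)"
        by (auto intro!: derivative_eq_intros)
      have eq: "inverse (1 + t\<^sup>2) - (1 - t^2 + t^4 - t^6) = t^8 / (1 + t\<^sup>2)"
        using add_pos_nonneg[of 1 "t\<^sup>2"] by (simp add: field_simps eval_nat_numeral)
      have "t^8 / (1 + t\<^sup>2) \<ge> 0" by (intro divide_nonneg_nonneg) (auto simp: zero_le_even_power)
      then show "\<exists>y. ((\<lambda>x. arctan x - (x - x^3/3 + x^5/5 - x^7/7)) has_real_derivative y) (at t) \<and> 0 \<le> y"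
        using d unfolding eq by (intro exI[of _ "t^8 / (1 + t\<^sup>2)"] conjI)
    qed
    then show ?thesis by simp
  qed
  show "arctan (369/800) \<le> 4329/10000" by (rule order.trans[OF 1]) (simp_all add: eval_nat_numeral)
  show "54/125 \<le> arctan (369/800)" by (rule order.trans[OF _ 2]) (simp_all add: eval_nat_numeral)
qed

text \<open>A point of modulus exactly $1/5$ with rational coordinates close to $e^{z_0}$.\<close>

definition wc :: complex where "wc = Complex (369/4405) (800/4405)"

text \<open>(369, 800, 881) is a Pythagorean triple and 4405 = 5 * 881. The exact modulus reduces
  the real part of the logarithm to - ln 5.\<close>

lemma norm_wc: "norm wc = 1/5"
proof -
  have "norm wc = sqrt ((1/5)\<^sup>2)" unfolding wc_def cmod_def by (simp add: power2_eq_square)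
  then show ?thesis unfolding real_sqrt_abs by simp
qed

lemma Ln_wc: "- 3221/2000 \<le> Re (Ln wc)" "Re (Ln wc) \<le> - 1609/1000"
   "7421/1000 \<le> Im (Ln wc) + 2 * pi" "Im (Ln wc) + 2 * pi \<le> 2969/400"
proof -
  have wc0: "wc \<noteq> 0" using norm_wc by auto
  have "Re (Ln wc) = - ln 5" using wc0 by (simp add: norm_wc ln_div)
  then show "- 3221/2000 \<le> Re (Ln wc)" "Re (Ln wc) \<le> - 1609/1000" using ln_5_bounds by auto
  have "Im (Ln wc) = arctan (800/369)"
    using Arg_eq_Im_Ln[OF wc0] arg_conv_arctan[of wc] by (simp add: wc_def)
  also have "\<dots> = pi / 2 - arctan (369/800)"
    using arctan_inverse[of "369/800"] by simp
  finally show "7421/1000 \<le> Im (Ln wc) + 2 * pi" "Im (Ln wc) + 2 * pi \<le> 2969/400"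
    using arctan_bounds_369 pi_approx by auto
qed

lemma pi_less: "pi < 16/5"
  using pi_approx by simp

lemma saddle_fun_wc: "norm (saddle_fun wc) \<le> 23/2000"
proof -
  define S1 where "S1 = (\<Sum>n<4. wc ^ Suc n / of_nat (Suc n))"
  define S2 where "S2 = (\<Sum>n<4. wc ^ Suc n / of_nat (Suc n) ^ 2)"
  have p2: "wc ^ 2 = Complex (-503839/19404025) (23616/776161)"
    by (simp add: wc_def power2_eq_square complex_eq_iff)
  have p3: "wc ^ 3 = Complex (-658236591/85474730125) (-7408544/3418989205)"
    unfolding power3_eq_cube using p2 by (simp add: power2_eq_square) (simp add: wc_def complex_eq_iff)
  have p4: "wc ^ 4 = Complex (-94718422079/376516186200625) (-23797323648/15060647448025)"
  proof -
    have "wc ^ 4 = wc ^ 2 * wc ^ 2" by (simp add: power4_eq_xxxx power2_eq_square)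
    then show ?thesis unfolding p2 by (simp add: complex_eq_iff)
  qed
  have S1: "S1 = wc + wc^2 / 2 + wc^3 / 3 + wc^4 / 4"
    by (simp add: S1_def eval_nat_numeral)
  have S2: "S2 = wc + wc^2 / 4 + wc^3 / 9 + wc^4 / 16"
    by (simp add: S2_def eval_nat_numeral)
  have S1b: "\<bar>Re S1 - (13631/200000)\<bar> \<le> 1/1000000" "\<bar>Im S1 - (48927/250000)\<bar> \<le> 1/1000000"
    unfolding S1 p2 p3 p4 by (simp_all add: wc_def abs_le_iff)
  have S2b: "\<bar>Re S2 - (15281/200000)\<bar> \<le> 1/1000000" "\<bar>Im S2 - (188879/1000000)\<bar> \<le> 1/1000000"
    unfolding S2 p2 p3 p4 by (simp_all add: wc_def abs_le_iff)
  define z where "z = Ln wc + 2 * of_real pi * \<i>"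
  \<comment> \<open>A rational approximation of \<open>Ln wc + 2 * pi * i\<close>.\<close>
  define c0 where "c0 = Complex (-(161/100)) (37109/5000)"
  have zc: "norm (z - c0) \<le> 1/500"
  proof -
    have "Re (z - c0) = Re (Ln wc) + 161/100" "Im (z - c0) = Im (Ln wc) + 2 * pi - 37109/5000"
      by (simp_all add: z_def c0_def)
    then have "\<bar>Re (z - c0)\<bar> \<le> 1/1000" "\<bar>Im (z - c0)\<bar> \<le> 9/10000"
      using Ln_wc unfolding abs_le_iff by auto
    then show ?thesis using cmod_le[of "z - c0"] by linarith
  qed
  have nc0: "norm c0 \<le> 226/25" using cmod_le[of c0] by (simp add: c0_def)
  define e1 where "e1 = - Ln (1 - wc) - S1"
  define e2 where "e2 = Li2 wc - S2"
  have e1: "norm e1 \<le> 1/12500"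
    using Ln_tail_bound[of wc "1/5" 4] by (simp add: e1_def S1_def norm_wc eval_nat_numeral)
  have e2: "norm e2 \<le> 1/2500"
    using Li2_tail_bound[of wc "1/5" 4] by (simp add: e2_def S2_def norm_wc eval_nat_numeral)
  have nS1: "norm S1 \<le> 27/100" using cmod_le[of S1] S1b unfolding abs_le_iff by linarith
  \<comment> \<open>This is \<open>saddle_fun wc\<close> with both series cut after four terms, the
    logarithm replaced by \<open>c0\<close> and pi^2/6 by 1.64493. Only rational numbers remain, and
    the replacements are estimated separately.\<close>
  define r where "r = S2 - c0 * S1 - of_real (164493/100000)"
  have r: "norm r \<le> 83/10000"
  proof -
    have "Re r = Re S2 + (161/100) * Re S1 + (37109/5000) * Im S1 - (164493/100000)" "Im r = Im S2 + (161/100) * Im S1 - (37109/5000) * Re S1"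
      by (simp_all add: r_def c0_def)
    then have "\<bar>Re r\<bar> \<le> 4/625" "\<bar>Im r\<bar> \<le> 19/10000" using S1b S2b unfolding abs_le_iff by linarith+
    then show ?thesis using cmod_le[of r] by linarith
  qed
  have pi6: "\<bar>pi ^ 2 / 6 - (164493/100000)\<bar> \<le> 1/50000"
  proof -
    have "pi ^ 2 \<le> (31415927/10000000) ^ 2" "(15707963/5000000) ^ 2 \<le> pi ^ 2" using pi_approx by (auto intro!: power_mono)
    then show ?thesis by (simp add: power2_eq_square abs_le_iff)
  qed
  have "saddle_fun wc = r - (z - c0) * (S1 + e1) - c0 * e1 + e2 - of_real (pi ^ 2 / 6 - (164493/100000))"
    unfolding saddle_fun_def z_def[symmetric] r_def e1_def e2_def by (simp add: algebra_simps)
  also have "norm \<dots> \<le> norm r + norm (z - c0) * (norm S1 + norm e1) + norm c0 * norm e1 + norm e2 + \<bar>pi ^ 2 / 6 - (164493/100000)\<bar>"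
  proof -
    have "norm (r - a - b' + c - d) \<le> norm r + norm a + norm b' + norm c + norm d" for a b' c d :: complex
      by norm
    from this[of "(z - c0) * (S1 + e1)" "c0 * e1" e2 "of_real (pi ^ 2 / 6 - (164493/100000))"]
    have "norm (r - (z - c0) * (S1 + e1) - c0 * e1 + e2 - of_real (pi ^ 2 / 6 - (164493/100000))) \<le>
      norm r + norm (z - c0) * norm (S1 + e1) + norm c0 * norm e1 + norm e2 + \<bar>pi ^ 2 / 6 - (164493/100000)\<bar>"
      by (simp only: norm_mult norm_of_real)
    moreover have "norm (z - c0) * norm (S1 + e1) \<le> norm (z - c0) * (norm S1 + norm e1)"
      by (intro mult_left_mono norm_triangle_ineq) auto
    ultimately show ?thesis by linarith
  qed
  also have "\<dots> \<le> 23/2000"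
  proof -
    have "norm S1 + norm e1 \<le> 271/1000" using nS1 e1 by linarith
    then have "norm (z - c0) * (norm S1 + norm e1) \<le> (1/500) * (271/1000)"
      using zc by (intro mult_mono) auto
    moreover have "norm c0 * norm e1 \<le> (226/25) * (1/12500)"
      using nc0 e1 by (intro mult_mono) auto
    ultimately show ?thesis using e2 r pi6 by linarith
  qed
  finally show ?thesis .
qed

lemma near_wc:
  assumes "norm (w - wc) \<le> 3/2000"
  shows "0 < Im w" "norm w < 13/20" "norm (Ln w - Ln wc) \<le> 19/2500" "w \<noteq> 0" "norm (1 - w) \<le> 93557/100000" "norm (1 - w) \<ge> 93/100"
    "2/25 < Re w" "Re w < 43/500" "9/50 < Im w" "Im w < 23/125"
proof -
  have comp: "\<bar>Re w - 369/4405\<bar> \<le> 3/2000" "\<bar>Im w - 800/4405\<bar> \<le> 3/2000"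
    using abs_Re_le_cmod[of "w - wc"] abs_Im_le_cmod[of "w - wc"] assms by (auto simp: wc_def)
  then show box: "2/25 < Re w" "Re w < 43/500" "9/50 < Im w" "Im w < 23/125" unfolding abs_le_iff by linarith+
  then show "0 < Im w" by simp
  show "w \<noteq> 0" using box by auto
  show "norm w < 13/20" using cmod_le[of w] box by linarith
  have n1: "norm (1 - wc) \<le> 46703/50000"
    unfolding cmod_def wc_def by (rule real_le_lsqrt) (auto simp: power2_eq_square)
  have "norm (1 - w) \<le> norm (1 - wc) + norm (w - wc)"
    using norm_triangle_ineq4[of "1 - wc" "w - wc"] by simp
  then show "norm (1 - w) \<le> 93557/100000" using n1 assms by linarith
  have n2: "norm (1 - wc) \<ge> 467/500"
    unfolding cmod_def wc_def by (rule real_le_rsqrt) (auto simp: power2_eq_square)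
  have "norm (1 - w) \<ge> norm (1 - wc) - norm (w - wc)"
    using norm_triangle_ineq2[of "1 - wc" "w - wc"] by simp
  then show "norm (1 - w) \<ge> 93/100" using n2 assms by linarith
  \<comment> \<open>On the small disc |x| is at least 1/5 - 3/2000 > 99/500, which bounds the
    derivative 1/x.\<close>
  have "norm (Ln w - Ln wc) \<le> 1 / (99/500) * norm (w - wc)"
  proof (rule field_differentiable_bound[of "cball wc (3/2000)"])
    fix x assume "x \<in> cball wc (3/2000)"
    then have x: "norm (x - wc) \<le> 3/2000" by (simp add: dist_norm norm_minus_commute)
    have "\<bar>Im x - 800/4405\<bar> \<le> 3/2000"
      using abs_Im_le_cmod[of "x - wc"] x by (auto simp: wc_def)
    then have "Im x > 0" unfolding abs_le_iff by linarith
    then have "x \<notin> \<real>\<^sub>\<le>\<^sub>0" by (auto simp: complex_nonpos_Reals_iff)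
    then show "(Ln has_field_derivative inverse x) (at x within cball wc (3/2000))"
      by (intro has_field_derivative_at_within[OF has_field_derivative_Ln])
    have "norm x \<ge> 99/500" using norm_triangle_ineq2[of wc "wc - x"] x norm_wc by (simp add: norm_minus_commute)
    then have "inverse (norm x) \<le> inverse (99/500)" by (intro le_imp_inverse_le) auto
    then show "norm (inverse x) \<le> 1 / (99/500)" by (simp add: norm_inverse)
  qed (use assms in \<open>auto simp: dist_norm norm_minus_commute\<close>)
  also have "\<dots> \<le> 19/2500" using assms by simp
  finally show "norm (Ln w - Ln wc) \<le> 19/2500" .
qed

text \<open>Banach's fixed point theorem for a simplified Newton iteration: \<open>m\<close> below approximates the derivative
  of \<open>saddle_fun\<close> at \<open>wc\<close>.\<close>

lemma saddle_fun_zero_exists: "\<exists>w. norm (w - wc) \<le> 3/2000 \<and> saddle_fun w = 0"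
proof -
  define m where "m = Complex (16/5) (-(15/2))"
  have nm: "norm m \<ge> 81/10" "norm m \<le> 41/5"
  proof -
    have "norm m = sqrt (6649/100)" unfolding m_def cmod_def by (simp add: power2_eq_square)
    moreover have "81/10 \<le> sqrt (6649/100)" by (rule real_le_rsqrt) (simp add: power2_eq_square)
    moreover have "sqrt (6649/100) \<le> 41/5" by (rule real_le_lsqrt) (simp_all add: power2_eq_square)
    ultimately show "norm m \<ge> 81/10" "norm m \<le> 41/5" by linarith+
  qed
  have m0: "m \<noteq> 0" using nm by auto
  define T where "T = (\<lambda>w. w - saddle_fun w / m)"
  let ?B = "cball wc (3/2000)"
  have B: "w \<in> ?B \<longleftrightarrow> norm (w - wc) \<le> 3/2000" for w by (simp add: dist_norm norm_minus_commute)
  have lip: "norm (T u - T v) \<le> (1/50) * norm (u - v)" if "u \<in> ?B" "v \<in> ?B" for u v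
  proof (rule field_differentiable_bound[OF convex_cball _ _ that])
    fix w assume "w \<in> ?B"
    then have w: "norm (w - wc) \<le> 3/2000" by (simp only: B)
    note nw = near_wc[OF w]
    define z where "z = Ln w + 2 * of_real pi * \<i>"
    have nz: "1 - w \<noteq> 0" using nw(1) by (auto simp: complex_eq_iff)
    show "(T has_field_derivative 1 - (- (z / (1 - w))) / m) (at w within ?B)"
    proof -
      have "(saddle_fun has_field_derivative - (z / (1 - w))) (at w)"
        unfolding z_def using nw(1,2) by (intro saddle_fun_deriv) auto
      from DERIV_diff[OF DERIV_ident DERIV_cdivide[OF this]] show ?thesis
        unfolding T_def by (rule has_field_derivative_at_within)
    qed
    \<comment> \<open>The numerator m (1 - w) + z is expanded around \<open>wc\<close>: its value
      there, and the variation of each of the two terms.\<close>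
    have "1 - (- (z / (1 - w))) / m = (m * (1 - wc) + (Ln wc + 2 * of_real pi * \<i>) - m * (w - wc) + (Ln w - Ln wc)) / (m * (1 - w))"
      using nz m0 by (simp add: z_def field_simps)
    also have "norm \<dots> = norm (m * (1 - wc) + (Ln wc + 2 * of_real pi * \<i>) - m * (w - wc) + (Ln w - Ln wc)) / (norm m * norm (1 - w))"
      by (simp add: norm_divide norm_mult)
    also have "\<dots> \<le> ((2/25) + (41/5) * (3/2000) + (19/2500)) / ((81/10) * (93/100))"
    proof (intro frac_le mult_mono)
      have "norm (m * (1 - wc) + (Ln wc + 2 * of_real pi * \<i>)) \<le> 2/25"
      proof -
        have "Re (m * (1 - wc)) = 69152/44050" "Im (m * (1 - wc)) = -32830/4405"
          by (simp_all add: m_def wc_def)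
        then have "\<bar>Re (m * (1 - wc) + (Ln wc + 2 * of_real pi * \<i>))\<bar> \<le> 51/1250" "\<bar>Im (m * (1 - wc) + (Ln wc + 2 * of_real pi * \<i>))\<bar> \<le> 4/125"
          using Ln_wc unfolding abs_le_iff by auto
        then show ?thesis using cmod_le[of "m * (1 - wc) + (Ln wc + 2 * of_real pi * \<i>)"] by linarith
      qed
      moreover have "norm (m * (w - wc)) \<le> (41/5) * (3/2000)"
        unfolding norm_mult using nm w by (intro mult_mono) auto
      moreover have "norm (a - b' + c) \<le> norm a + norm b' + norm c" for a b' c :: complex by norm
      ultimately show "norm (m * (1 - wc) + (Ln wc + 2 * of_real pi * \<i>) - m * (w - wc) + (Ln w - Ln wc)) \<le> (2/25) + (41/5) * (3/2000) + (19/2500)"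
        using nw(3) by (smt (verit))
    qed (use nm nw in auto)
    also have "\<dots> \<le> 1/50" by simp
    finally show "norm (1 - (- (z / (1 - w))) / m) \<le> 1/50" .
  qed
  \<comment> \<open>The centre is moved by at most 71/50000, and the contraction adds at most 1/50
    of the radius; the sum stays below 3/2000.\<close>
  have "T ` ?B \<subseteq> ?B"
  proof
    fix y assume "y \<in> T ` ?B"
    then obtain w where w: "w \<in> ?B" "y = T w" by auto
    have "norm (T w - T wc) \<le> (1/50) * norm (w - wc)" using w by (intro lip) auto
    also have "\<dots> \<le> (1/50) * (3/2000)" using w B by (intro mult_left_mono) auto
    finally have 1: "norm (T w - T wc) \<le> 3/100000" by simp
    have "norm (T wc - wc) = norm (saddle_fun wc) / norm m" by (simp add: T_def norm_divide)
    also have "\<dots> \<le> (23/2000) / (81/10)" using saddle_fun_wc nm by (intro frac_le) auto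
    also have "\<dots> \<le> 71/50000" by simp
    finally have 2: "norm (T wc - wc) \<le> 71/50000" .
    have "norm (T w - wc) \<le> norm (T w - T wc) + norm (T wc - wc)" by norm
    with 1 2 have "norm (T w - wc) \<le> 3/2000" by linarith
    then show "y \<in> ?B" using w(2) by (simp only: B)
  qed
  moreover have "complete ?B" by (simp add: compact_imp_complete)
  ultimately obtain w where "w \<in> ?B" "T w = w"
    using Banach_fix[of ?B "(1/50)" T] lip by (auto simp: dist_norm)
  then show ?thesis using m0 B by (auto simp: T_def)
qed

text \<open>Resolves the definite description. The zero of \<open>saddle_fun\<close> near
  \<open>wc\<close> yields a root in the prescribed disc, and any root z' in that disc makes e^(z')
  a zero of \<open>saddle_fun\<close> in the half disc where that function is injective.\<close>

lemma z0_props: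
  obtains w where "norm (w - wc) \<le> 3/2000" "saddle_fun w = 0" "z0 = Ln w + 2 * of_real pi * \<i>" "exp z0 = w"
proof -
  obtain w where w: "norm (w - wc) \<le> 3/2000" "saddle_fun w = 0" using saddle_fun_zero_exists by blast
  note nw = near_wc[OF w(1)]
  define z where "z = Ln w + 2 * of_real pi * \<i>"
  have ez: "exp z = w"
    unfolding z_def exp_add using nw(4) exp_two_pi_i by (simp add: mult_ac)
  have zz: "\<bar>Re z - Re (Ln wc)\<bar> \<le> 19/2500" "\<bar>Im z - (Im (Ln wc) + 2 * pi)\<bar> \<le> 19/2500"
    using abs_Re_le_cmod[of "Ln w - Ln wc"] abs_Im_le_cmod[of "Ln w - Ln wc"] nw(3) by (auto simp: z_def)
  have key: "z' = z" if z': "dist z' (Complex (- 1.61) 7.42) \<le> 1"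
      "Ln (1 - exp z') + 1 / z' * (Li2 (exp z') - of_real (pi ^ 2 / 6)) = 0" for z'
  proof -
    have "\<bar>Re z' + (161/100)\<bar> \<le> 1" "\<bar>Im z' - (371/50)\<bar> \<le> 1"
      using z'(1) abs_Re_le_cmod[of "z' - Complex (- 1.61) 7.42"] abs_Im_le_cmod[of "z' - Complex (- 1.61) 7.42"]
      by (auto simp: dist_norm)
    then have bd: "Re z' \<le> - 61/100" "321/50 \<le> Im z'" "Im z' \<le> 421/50" unfolding abs_le_iff by linarith+
    define v where "v = exp z'"
    \<comment> \<open>In the disc the real part is at most -0.61, and e^(-0.61) <= 1/1.61 <
      13/20.\<close>
    have nv: "norm v < 13/20"
    proof -
      have "norm v \<le> exp (-(61/100))" using bd by (simp add: v_def)
      also have "\<dots> = 1 / exp ((61/100) :: real)" by (simp add: exp_minus inverse_eq_divide)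
      also have "\<dots> \<le> 1 / (1 + (61/100))" using exp_ge_add_one_self[of "(61/100) :: real"] by (intro divide_left_mono) auto
      also have "\<dots> < 13/20" by simp
      finally show ?thesis .
    qed
    \<comment> \<open>The whole disc lies in the strip between heights 2 pi and 3 pi. After
      subtracting 2 pi i the principal logarithm inverts the exponential, and e^(z') has positive
      imaginary part.\<close>
    have im: "0 < Im z' - 2 * pi" "Im z' - 2 * pi < pi" using bd pi_gt3 pi_less by linarith+
    have Iv: "Im v > 0"
    proof -
      have "sin (Im z') = sin (Im z' - 2 * pi)" by (simp add: sin_diff)
      also have "\<dots> > 0" using im by (intro sin_gt_zero) auto
      finally show ?thesis by (simp add: v_def Im_exp)
    qed
    have Lv: "Ln v + 2 * of_real pi * \<i> = z'"
    proof -
      have "exp (z' - 2 * of_real pi * \<i>) = v"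
        unfolding v_def exp_diff using exp_two_pi_i by (simp add: mult_ac)
      moreover have "Ln (exp (z' - 2 * of_real pi * \<i>)) = z' - 2 * of_real pi * \<i>"
        using im by (intro Ln_exp) auto
      ultimately show ?thesis by simp
    qed
    have "z' \<noteq> 0" using bd by auto
    then have "saddle_fun v = z' * (Ln (1 - exp z') + 1 / z' * (Li2 (exp z') - of_real (pi ^ 2 / 6)))"
      unfolding saddle_fun_def Lv by (simp add: v_def algebra_simps)
    then have "saddle_fun v = saddle_fun w" using z'(2) w(2) by simp
    then have "v = w" by (rule saddle_fun_inj[OF Iv nv nw(1,2)])
    then show ?thesis using Lv by (simp add: z_def)
  qed
  have "z0 = z"
    unfolding z0_def
  proof (rule the_equality)
    have "z \<noteq> 0" using zz Ln_wc by auto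
    then have "Ln (1 - exp z) + 1 / z * (Li2 (exp z) - of_real (pi ^ 2 / 6)) = saddle_fun w / z"
      unfolding saddle_fun_def z_def[symmetric] ez by (simp add: field_simps)
    moreover have "dist z (Complex (- 1.61) 7.42) \<le> 1"
    proof -
      have "\<bar>Re (z - Complex (- 1.61) 7.42)\<bar> \<le> 1/10" "\<bar>Im (z - Complex (- 1.61) 7.42)\<bar> \<le> 1/10"
        using zz Ln_wc unfolding abs_le_iff by auto
      then show ?thesis unfolding dist_norm using cmod_le[of "z - Complex (- 1.61) 7.42"] by linarith
    qed
    ultimately show "dist z (Complex (- 1.61) 7.42) \<le> 1 \<and> Ln (1 - exp z) + 1 / z * (Li2 (exp z) - of_real (pi ^ 2 / 6)) = 0"
      using w(2) by simp
  qed (use key in blast)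
  with w ez show ?thesis by (intro that) (auto simp: z_def)
qed

lemma z0_bounds:
  "- 8091/5000 \<le> Re z0" "Re z0 \<le> - 16013/10000" "74133/10000 \<le> Im z0" "Im z0 \<le> 37151/5000"
  "2/25 < Re (exp z0)" "Re (exp z0) < 43/500" "9/50 < Im (exp z0)" "Im (exp z0) < 23/125" "norm (1 - exp z0) \<le> 93557/100000"
  and z0_eq: "z0 * Ln (1 - exp z0) + Li2 (exp z0) - of_real (pi ^ 2 / 6) = 0"
proof -
  obtain w where w: "norm (w - wc) \<le> 3/2000" "saddle_fun w = 0" "z0 = Ln w + 2 * of_real pi * \<i>" "exp z0 = w"
    by (rule z0_props)
  note nw = near_wc[OF w(1)]
  have zz: "\<bar>Re z0 - Re (Ln wc)\<bar> \<le> 19/2500" "\<bar>Im z0 - (Im (Ln wc) + 2 * pi)\<bar> \<le> 19/2500"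
    using abs_Re_le_cmod[of "Ln w - Ln wc"] abs_Im_le_cmod[of "Ln w - Ln wc"] nw(3) by (auto simp: w(3))
  then show "- 8091/5000 \<le> Re z0" "Re z0 \<le> - 16013/10000" "74133/10000 \<le> Im z0" "Im z0 \<le> 37151/5000"
    using Ln_wc unfolding abs_le_iff by linarith+
  show "2/25 < Re (exp z0)" "Re (exp z0) < 43/500" "9/50 < Im (exp z0)" "Im (exp z0) < 23/125" "norm (1 - exp z0) \<le> 93557/100000"
    using nw by (auto simp: w(4))
  show "z0 * Ln (1 - exp z0) + Li2 (exp z0) - of_real (pi ^ 2 / 6) = 0"
    unfolding w(4) using w(2) unfolding saddle_fun_def w(3)[symmetric] .
qed

text \<open>A lower bound for ln b, the growth rate at \<open>z0\<close>. All other parts of the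
  contour are compared with this number.\<close>

lemma b_gt: "331/5000 \<le> - ln (norm (1 - exp z0))"
proof -
  have "(\<Sum>m<4. (-(331/5000)) ^ m / fact m :: real) \<ge> 93557/100000"
    by (simp add: eval_nat_numeral fact_numeral)
  with exp_ge_even_Taylor[of 4 "-(331/5000)"] have e: "exp (-(331/5000)) \<ge> ((93557/100000) :: real)" by simp
  have "norm (1 - exp z0) > 0" using z0_bounds(7) by (auto simp: complex_eq_iff)
  then have "ln (norm (1 - exp z0)) \<le> ln (exp (-(331/5000)))"
    using e z0_bounds(9) by (subst ln_le_cancel_iff) auto
  then show ?thesis by simp
qed

section \<open>Exponential growth rate along the contour\<close>

text \<open>The exponential rate of \<open>integrand l N z\<close> as \<open>N\<close> grows.\<close>

definition growth :: "complex \<Rightarrow> real" where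
  "growth z = 1 - ln (norm z) - Re (log_quot_prim z / z)"

lemma Re_log_quot:
  assumes "w \<in> slit_domain" "w \<noteq> 0"
  shows "Re (log_quot w) = ln (norm (1 - exp w)) - ln (norm w)"
proof -
  have "norm (1 - exp w) = norm w * exp (Re (log_quot w))"
    unfolding one_minus_exp_eq[OF assms(1)] by (simp add: norm_mult)
  then show ?thesis using assms(2) by (simp add: ln_mult)
qed

lemma norm_one_minus_exp_pos:
  assumes "w \<in> slit_domain" "w \<noteq> 0"
  shows "norm (1 - exp w) > 0"
  using exp_eq_1_slit_domain[OF assms(1)] assms(2) by auto

text \<open>Writes the main part of \<open>growth\<close> as an average over the segment from 0 to
  z, so that pointwise relations for \<open>Re (log_quot w)\<close> pass to
  \<open>growth\<close>.\<close>

lemma log_quot_prim_integral: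
  assumes z: "z \<in> slit_domain" "z \<noteq> 0"
  shows "((\<lambda>t. Re (log_quot (of_real t * z))) has_integral Re (log_quot_prim z / z)) {0..1}"
proof -
  have "((\<lambda>t. log_quot (of_real t * z) * z / z) has_integral log_quot_prim (of_real 1 * z) / z - log_quot_prim (of_real 0 * z) / z) {0..1}"
  proof (rule fundamental_theorem_of_calculus)
    fix t :: real assume t: "t \<in> {0..1}"
    have "of_real t * z \<in> slit_domain" using t by (intro slit_domain_scale z) auto
    then have "((\<lambda>x. log_quot_prim (x * z)) has_field_derivative log_quot (of_real t * z) * z) (at (of_real t))"
      by (intro DERIV_chain2[OF log_quot_prim_deriv]) (auto intro!: derivative_eq_intros)
    from DERIV_cdivide[OF this, of z]
    show "((\<lambda>t. log_quot_prim (of_real t * z) / z) has_vector_derivative log_quot (of_real t * z) * z / z) (at t within {0..1})"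
      by (rule has_vector_derivative_real_field[OF has_field_derivative_at_within])
  qed simp
  then have "((\<lambda>t. log_quot (of_real t * z)) has_integral log_quot_prim z / z) {0..1}"
    using z by simp
  from has_integral_linear[OF this bounded_linear_Re] show ?thesis by (simp add: o_def)
qed

lemma slit_domain_uminus: "z \<in> slit_domain \<Longrightarrow> - z \<in> slit_domain"
  and slit_domain_cnj: "z \<in> slit_domain \<Longrightarrow> cnj z \<in> slit_domain"
  by (auto simp: slit_domain_def)

text \<open>From 1 - e^(-w) = - e^(-w) (1 - e^w) the real part of \<open>log_quot\<close> changes by
  - Re w under reflection; averaging t Re z over t gives one half. This carries estimates from the
  left half plane to the right one.\<close>

lemma growth_uminus:
  assumes z: "z \<in> slit_domain" "z \<noteq> 0"
  shows "growth (- z) = growth z + Re z / 2"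
proof -
  have eq: "Re (log_quot (of_real t * (- z))) = Re (log_quot (of_real t * z)) - t * Re z" if t: "t \<in> {0..1}" for t
  proof (cases "t = 0")
    case False
    define w where "w = of_real t * z"
    have s: "w \<in> slit_domain" "w \<noteq> 0" using t False slit_domain_scale[OF z(1), of t] z by (auto simp: w_def)
    have pos: "norm (1 - exp w) > 0" by (rule norm_one_minus_exp_pos[OF s])
    have "1 - exp (- w) = - exp (- w) * (1 - exp w)" by (simp add: exp_minus field_simps)
    then have "norm (1 - exp (- w)) = exp (- Re w) * norm (1 - exp w)"
      by (metis norm_minus_cancel norm_mult norm_exp_eq_Re uminus_complex.sel(1))
    then have "ln (norm (1 - exp (- w))) = - Re w + ln (norm (1 - exp w))"
      using pos by (simp add: ln_mult)
    then have "Re (log_quot (- w)) = Re (log_quot w) - Re w"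
      using s slit_domain_uminus[OF s(1)] by (subst (1 2) Re_log_quot) auto
    then show ?thesis by (simp add: w_def)
  qed simp
  have i1: "((\<lambda>t. Re (log_quot (of_real t * z)) - t * Re z) has_integral Re (log_quot_prim (- z) / (- z))) {0..1}"
  proof (rule has_integral_eq)
    show "((\<lambda>t. Re (log_quot (of_real t * (- z)))) has_integral Re (log_quot_prim (- z) / (- z))) {0..1}"
      using z slit_domain_uminus[OF z(1)] by (intro log_quot_prim_integral) auto
  qed (use eq in auto)
  have "((\<lambda>t::real. t * Re z) has_integral (1\<^sup>2 / 2 * Re z - 0\<^sup>2 / 2 * Re z)) {0..1}"
    by (rule fundamental_theorem_of_calculus)
       (auto intro!: derivative_eq_intros simp flip: has_real_derivative_iff_has_vector_derivative)
  from has_integral_diff[OF log_quot_prim_integral[OF z] this]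
  have "((\<lambda>t. Re (log_quot (of_real t * z)) - t * Re z) has_integral Re (log_quot_prim z / z) - Re z / 2) {0..1}" by simp
  from has_integral_unique[OF i1 this] show ?thesis unfolding growth_def by simp
qed

text \<open>Pointwise |1 - e^(p+iq)| >= e^(p/2) |1 - e^(iq)|. With p = t x, averaging t x / 2 over t
  gives x/4, and the terms ln |z| in \<open>growth\<close> cancel against those in
  \<open>Re (log_quot w)\<close>.\<close>

lemma growth_horizontal:
  assumes y: "y \<noteq> 0" "\<bar>y\<bar> < 2 * pi"
  shows "growth (Complex x y) \<le> growth (Complex 0 y) - x / 4"
proof -
  define z where "z = Complex x y"
  define u where "u = Complex 0 y"
  have z: "z \<in> slit_domain" "z \<noteq> 0" and u: "u \<in> slit_domain" "u \<noteq> 0"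
    using y by (auto simp: z_def u_def slit_domain_def complex_eq_iff)
  have zu: "norm u \<le> norm z" by (simp add: z_def u_def cmod_def)
  have le: "Re (log_quot (of_real t * u)) + (t * (x / 2) - ln (norm z) + ln (norm u)) \<le> Re (log_quot (of_real t * z))"
    if t: "t \<in> {0..1}" for t
  proof (cases "t = 0")
    case True
    then show ?thesis using zu u z by simp
  next
    case False
    then have t0: "t > 0" using t by auto
    have s: "of_real t * z \<in> slit_domain" "of_real t * z \<noteq> 0" "of_real t * u \<in> slit_domain" "of_real t * u \<noteq> 0"
      using t False slit_domain_scale[OF z(1), of t] slit_domain_scale[OF u(1), of t] z u by auto
    have pos: "norm (1 - exp (of_real t * z)) > 0" "norm (1 - exp (of_real t * u)) > 0"
      using norm_one_minus_exp_pos s by auto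
    \<comment> \<open>Dropping the square (1 - e^p)^2 on the right yields the inequality, with
      equality for p = 0.\<close>
    have sq: "(norm (1 - exp (Complex p' q)))\<^sup>2 = (1 - exp p')\<^sup>2 + exp p' * (2 - 2 * cos q)" for p' q
    proof -
      have "(norm (1 - exp (Complex p' q)))\<^sup>2 = (1 - exp p' * cos q)\<^sup>2 + (exp p' * sin q)\<^sup>2"
        by (simp add: cmod_power2 Re_exp Im_exp)
      also have "\<dots> = 1 - 2 * exp p' * cos q + (exp p')\<^sup>2 * ((cos q)\<^sup>2 + (sin q)\<^sup>2)"
        by algebra
      also have "\<dots> = (1 - exp p')\<^sup>2 + exp p' * (2 - 2 * cos q)"
        unfolding sin_cos_squared_add2 by (simp add: power2_eq_square algebra_simps)
      finally show ?thesis .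
    qed
    have tz: "of_real t * z = Complex (t * x) (t * y)" "of_real t * u = Complex 0 (t * y)"
      by (auto simp: z_def u_def complex_eq_iff)
    have "exp (t * (x / 2)) * norm (1 - exp (of_real t * u)) \<le> norm (1 - exp (of_real t * z))"
    proof (rule power2_le_imp_le)
      have "(exp (t * (x / 2)) * norm (1 - exp (of_real t * u)))\<^sup>2 = exp (t * x) * (2 - 2 * cos (t * y))"
        unfolding power_mult_distrib tz sq by (simp add: exp_double[symmetric])
      also have "\<dots> \<le> (norm (1 - exp (of_real t * z)))\<^sup>2"
        unfolding tz sq by simp
      finally show "(exp (t * (x / 2)) * norm (1 - exp (of_real t * u)))\<^sup>2 \<le> (norm (1 - exp (of_real t * z)))\<^sup>2" .
    qed auto
    then have "ln (exp (t * (x / 2)) * norm (1 - exp (of_real t * u))) \<le> ln (norm (1 - exp (of_real t * z)))"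
      using pos by (subst ln_le_cancel_iff) auto
    then have "t * (x / 2) + ln (norm (1 - exp (of_real t * u))) \<le> ln (norm (1 - exp (of_real t * z)))"
      using pos by (subst (asm) ln_mult) auto
    moreover have "ln (norm (of_real t * z)) = ln t + ln (norm z)" "ln (norm (of_real t * u)) = ln t + ln (norm u)"
      using t0 z u by (simp_all add: norm_mult ln_mult)
    ultimately show ?thesis unfolding Re_log_quot[OF s(1,2)] Re_log_quot[OF s(3,4)] by linarith
  qed
  have "((\<lambda>t::real. t * (x / 2) - ln (norm z) + ln (norm u)) has_integral
      ((1\<^sup>2 / 2 * (x / 2) - 1 * ln (norm z) + 1 * ln (norm u)) - (0\<^sup>2 / 2 * (x / 2) - 0 * ln (norm z) + 0 * ln (norm u)))) {0..1}"
    by (rule fundamental_theorem_of_calculus)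
       (auto intro!: derivative_eq_intros simp flip: has_real_derivative_iff_has_vector_derivative)
  from has_integral_add[OF log_quot_prim_integral[OF u] this]
  have "((\<lambda>t::real. Re (log_quot (of_real t * u)) + (t * (x / 2) - ln (norm z) + ln (norm u))) has_integral
     Re (log_quot_prim u / u) + (x / 4 - ln (norm z) + ln (norm u))) {0..1}" by simp
  from has_integral_le[OF this log_quot_prim_integral[OF z]] le
  have "Re (log_quot_prim u / u) + (x / 4 - ln (norm z) + ln (norm u)) \<le> Re (log_quot_prim z / z)" by blast
  then show ?thesis unfolding growth_def z_def[symmetric] u_def[symmetric] by linarith
qed

section \<open>The growth rate in the left half plane through the dilogarithm\<close>

lemma left_half_plane:
  assumes "Re z < 0"
  shows "z \<noteq> 0" "norm (exp z) < 1" "1 - exp z \<notin> \<real>\<^sub>\<le>\<^sub>0" "1 - exp z \<noteq> 0"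
proof -
  show "z \<noteq> 0" and n: "norm (exp z) < 1" using assms by auto
  have "Re (exp z) < 1" using complex_Re_le_cmod[of "exp z"] n by linarith
  then show "1 - exp z \<notin> \<real>\<^sub>\<le>\<^sub>0" "1 - exp z \<noteq> 0" by (auto simp: complex_nonpos_Reals_iff complex_eq_iff)
qed

text \<open>Both sides are logarithms of the same nonvanishing function on a convex set, so they
  differ by a constant. Letting z tend to 0 along the negative reals shows that the constant is 0.
  This is the point where principal branches enter.\<close>

lemma log_quot_eq_Ln:
  assumes "Re z < 0"
  shows "log_quot z = Ln (1 - exp z) - Ln (- z)"
proof -
  let ?S = "{z. Re z < 0}"
  define f where "f = (\<lambda>z. log_quot z - (Ln (1 - exp z) - Ln (- z)))"
  have nz: "1 - exp w \<notin> \<real>\<^sub>\<le>\<^sub>0" "- w \<notin> \<real>\<^sub>\<le>\<^sub>0" "w \<in> slit_domain" "1 - exp w \<noteq> 0" "w \<noteq> 0" if "Re w < 0" for w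
    using left_half_plane[OF that] that by (auto simp: complex_nonpos_Reals_iff slit_domain_def)
  have exp_f: "exp (f w) = 1" if "Re w < 0" for w
  proof -
    have "exp (f w) = exp (log_quot w) / ((1 - exp w) / (- w))"
      using nz[OF that] by (simp add: f_def exp_diff)
    also have "\<dots> = 1" using one_minus_exp_eq[OF nz(3)[OF that]] nz(4,5)[OF that] by simp
    finally show ?thesis .
  qed
  have df: "(f has_field_derivative 0) (at w within ?S)" if w: "w \<in> ?S" for w
  proof -
    have w': "Re w < 0" using w by simp
    define d where "d = deriv log_quot w - ((- exp w) / (1 - exp w) - (- 1) / (- w))"
    have d: "(f has_field_derivative d) (at w)"
    proof -
      have "((\<lambda>z. Ln (1 - exp z)) has_field_derivative 1 / (1 - exp w) * (- exp w)) (at w)"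
        by (rule DERIV_chain2[where f = Ln]) (use nz[OF w'] in \<open>auto intro!: derivative_eq_intros simp: inverse_eq_divide\<close>)
      moreover have "((\<lambda>z. Ln (- z)) has_field_derivative 1 / (- w) * (- 1)) (at w)"
        by (rule DERIV_chain2[where f = Ln]) (use nz[OF w'] in \<open>auto intro!: derivative_eq_intros simp: inverse_eq_divide\<close>)
      ultimately have "(f has_field_derivative deriv log_quot w - (1 / (1 - exp w) * (- exp w) - 1 / (- w) * (- 1))) (at w)"
        unfolding f_def by (intro DERIV_diff log_quot_deriv nz w')
      then show ?thesis by (simp add: d_def)
    qed
    have "((\<lambda>x. exp (f x)) has_field_derivative exp (f w) * d) (at w)"
      using d by (auto intro!: derivative_eq_intros)
    moreover have "((\<lambda>x. exp (f x)) has_field_derivative 0) (at w)"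
    proof (rule has_field_derivative_transform_within_open[of "\<lambda>_. 1" _ _ ?S])
      show "open ?S" by (rule open_halfspace_Re_lt)
    qed (use exp_f w in auto)
    ultimately have "exp (f w) * d = 0" by (rule DERIV_unique)
    then show ?thesis using d by (simp add: has_field_derivative_at_within)
  qed
  then obtain c where c: "\<And>w. Re w < 0 \<Longrightarrow> f w = c"
    using has_field_derivative_zero_constant[of ?S f] convex_halfspace_Re_lt[of 0] by auto
  have real: "Ln (1 - exp (of_real x)) - Ln (- of_real x) = of_real (ln ((1 - exp x) / (- x)))" if "x < 0" for x
  proof -
    have "Ln (1 - exp (of_real x)) = of_real (ln (1 - exp x))"
      using that Ln_of_real[of "1 - exp x"] by (simp add: exp_of_real)
    moreover have "Ln (- of_real x) = of_real (ln (- x))"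
      using that Ln_of_real[of "- x"] by simp
    moreover have "ln ((1 - exp x) / (- x)) = ln (1 - exp x) - ln (- x)"
      using that ln_div[of "1 - exp x" "- x"] by simp
    ultimately show ?thesis by (simp only: of_real_diff)
  qed
  have "((\<lambda>x. log_quot (of_real x) - of_real (ln ((1 - exp x) / (- x)))) \<longlongrightarrow> log_quot 0 - of_real 0) (at_left (0::real))"
  proof (intro tendsto_diff tendsto_of_real)
    have "isCont log_quot 0" using log_quot_deriv[of 0] DERIV_isCont by force
    moreover have "((\<lambda>x. of_real x :: complex) \<longlongrightarrow> 0) (at_left 0)"
      by (auto intro!: tendsto_eq_intros)
    ultimately show "((\<lambda>x. log_quot (of_real x)) \<longlongrightarrow> log_quot 0) (at_left (0::real))"
      by (rule isCont_tendsto_compose)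
    show "((\<lambda>x::real. ln ((1 - exp x) / (- x))) \<longlongrightarrow> 0) (at_left 0)" by real_asymp
  qed
  moreover have "eventually (\<lambda>x. log_quot (of_real x) - of_real (ln ((1 - exp x) / (- x))) = c) (at_left (0::real))"
  proof (rule eventually_mono[OF eventually_at_left_real[of "-1" 0]])
    fix x :: real assume "x \<in> {-1<..<0}"
    then have x: "x < 0" by simp
    show "log_quot (of_real x) - of_real (ln ((1 - exp x) / (- x))) = c"
      using c[of "of_real x"] x unfolding f_def real[OF x] by simp
  qed simp
  ultimately have "((\<lambda>x::real. c) \<longlongrightarrow> log_quot 0 - of_real 0) (at_left (0::real))"
    by (rule Lim_transform_eventually)
  then have "((\<lambda>x::real. c) \<longlongrightarrow> 0) (at_left (0::real))" by simp
  then have "c = 0" by (simp add: tendsto_const_iff)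
  with c[OF assms] show ?thesis by (simp add: f_def)
qed

text \<open>The derivatives agree by \<open>log_quot_eq_Ln\<close>, and the additive constant is
  found in the limit at 0 from the left, where Li2(1) = pi^2/6.\<close>

lemma log_quot_prim_eq_Li2:
  assumes "Re z < 0"
  shows "log_quot_prim z = z - z * Ln (- z) - Li2 (exp z) + of_real (pi ^ 2 / 6)"
proof -
  let ?S = "{z. Re z < 0}"
  define f where "f = (\<lambda>z. log_quot_prim z - (z - z * Ln (- z) - Li2 (exp z) + of_real (pi ^ 2 / 6)))"
  have df: "(f has_field_derivative 0) (at w within ?S)" if w: "w \<in> ?S" for w
  proof -
    have w': "Re w < 0" using w by simp
    have nz: "- w \<notin> \<real>\<^sub>\<le>\<^sub>0" "w \<in> slit_domain" "w \<noteq> 0" using w' by (auto simp: complex_nonpos_Reals_iff slit_domain_def)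
    have e: "norm (exp w) < 1" "exp w \<noteq> 0" using w' by auto
    have "((\<lambda>z. Ln (- z)) has_field_derivative 1 / (- w) * (- 1)) (at w)"
      by (rule DERIV_chain2[where f = Ln]) (use nz in \<open>auto intro!: derivative_eq_intros simp: inverse_eq_divide\<close>)
    moreover have "((\<lambda>z. Li2 (exp z)) has_field_derivative (- Ln (1 - exp w) / exp w) * exp w) (at w)"
      by (rule DERIV_chain2[where f = Li2]) (rule Li2_deriv[OF e] DERIV_exp)+
    ultimately have "(f has_field_derivative log_quot w - (1 - (1 * Ln (- w) + 1 / (- w) * (- 1) * w) - (- Ln (1 - exp w) / exp w) * exp w + 0)) (at w)"
      unfolding f_def by (intro DERIV_diff DERIV_add DERIV_mult DERIV_ident DERIV_const log_quot_prim_deriv nz)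
    also have "log_quot w - (1 - (1 * Ln (- w) + 1 / (- w) * (- 1) * w) - (- Ln (1 - exp w) / exp w) * exp w + 0) = 0"
      unfolding log_quot_eq_Ln[OF w'] using nz by simp
    finally show ?thesis by (rule has_field_derivative_at_within)
  qed
  then obtain c where c: "\<And>w. Re w < 0 \<Longrightarrow> f w = c"
    using has_field_derivative_zero_constant[of ?S f] convex_halfspace_Re_lt[of 0] by auto
  have "((\<lambda>x. log_quot_prim (of_real x) - (of_real x - of_real (x * ln (- x)) - Li2 (of_real (exp x)) + of_real (pi ^ 2 / 6))) \<longlongrightarrow>
      log_quot_prim 0 - (0 - of_real 0 - Li2 1 + of_real (pi ^ 2 / 6))) (at_left (0::real))"
  proof (intro tendsto_diff tendsto_add tendsto_const)
    show l0: "((\<lambda>x. of_real x :: complex) \<longlongrightarrow> 0) (at_left 0)"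
      by (auto intro!: tendsto_eq_intros)
    have "isCont log_quot_prim 0" using log_quot_prim_deriv[of 0] DERIV_isCont by force
    then show "((\<lambda>x. log_quot_prim (of_real x)) \<longlongrightarrow> log_quot_prim 0) (at_left (0::real))"
      using l0 by (rule isCont_tendsto_compose)
    have "((\<lambda>x::real. x * ln (- x)) \<longlongrightarrow> 0) (at_left 0)" by real_asymp
    then show "((\<lambda>x. of_real (x * ln (- x)) :: complex) \<longlongrightarrow> of_real 0) (at_left 0)" by (rule tendsto_of_real)
    have "((\<lambda>x::real. exp x) \<longlongrightarrow> 1) (at_left 0)" by real_asymp
    then have "((\<lambda>x. of_real (exp x) :: complex) \<longlongrightarrow> of_real 1) (at_left 0)" by (rule tendsto_of_real)
    moreover have "eventually (\<lambda>x. (of_real (exp x) :: complex) \<in> cball 0 1) (at_left 0)"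
      using eventually_at_left_real[of "-1" 0] by (rule eventually_mono) auto
    ultimately show "((\<lambda>x. Li2 (of_real (exp x))) \<longlongrightarrow> Li2 1) (at_left 0)"
      by (intro continuous_on_tendsto_compose[OF continuous_on_Li2]) auto
  qed
  moreover have "eventually (\<lambda>x. log_quot_prim (of_real x) - (of_real x - of_real (x * ln (- x)) - Li2 (of_real (exp x)) + of_real (pi ^ 2 / 6)) = c) (at_left (0::real))"
  proof (rule eventually_mono[OF eventually_at_left_real[of "-1" 0]])
    fix x :: real assume x: "x \<in> {-1<..<0}"
    have "Ln (- of_real x) = of_real (ln (- x))"
      using x Ln_of_real[of "- x"] by simp
    then show "log_quot_prim (of_real x) - (of_real x - of_real (x * ln (- x)) - Li2 (of_real (exp x)) + of_real (pi ^ 2 / 6)) = c"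
      using c[of "of_real x"] x by (simp add: f_def exp_of_real)
  qed simp
  ultimately have "((\<lambda>x::real. c) \<longlongrightarrow> log_quot_prim 0 - (0 - of_real 0 - Li2 1 + of_real (pi ^ 2 / 6))) (at_left (0::real))"
    by (rule Lim_transform_eventually)
  then have "c = 0" by (simp add: tendsto_const_iff Li2_1)
  with c[OF assms] show ?thesis by (simp add: f_def)
qed

text \<open>The terms 1 and - ln |z| in \<open>growth\<close> cancel against the elementary part of
  \<open>log_quot_prim z / z\<close>.\<close>

lemma growth_eq_Li2:
  assumes "Re z < 0"
  shows "growth z = Re ((Li2 (exp z) - of_real (pi ^ 2 / 6)) / z)"
proof -
  have z: "z \<noteq> 0" using assms by auto
  have "log_quot_prim z / z = 1 - Ln (- z) - (Li2 (exp z) - of_real (pi ^ 2 / 6)) / z"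
    unfolding log_quot_prim_eq_Li2[OF assms] using z by (simp add: field_simps)
  then have "Re (log_quot_prim z / z) = 1 - Re (Ln (- z)) - Re ((Li2 (exp z) - of_real (pi ^ 2 / 6)) / z)" by simp
  moreover have "Re (Ln (- z)) = ln (norm z)" using z by simp
  ultimately show ?thesis unfolding growth_def by linarith
qed

lemma growth_le_left:
  assumes "Re z < 0" "norm (exp z) \<le> q" "q < 1"
  shows "growth z \<le> (q / (1 - q) + pi ^ 2 / 6) / norm z"
proof -
  have "growth z \<le> norm ((Li2 (exp z) - of_real (pi ^ 2 / 6)) / z)"
    unfolding growth_eq_Li2[OF assms(1)] by (rule complex_Re_le_cmod)
  also have "\<dots> = norm (Li2 (exp z) - of_real (pi ^ 2 / 6)) / norm z" by (simp add: norm_divide)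
  also have "norm (Li2 (exp z) - of_real (pi ^ 2 / 6)) \<le> norm (Li2 (exp z)) + norm (of_real (pi ^ 2 / 6) :: complex)"
    by (rule norm_triangle_ineq4)
  also have "\<dots> \<le> q / (1 - q) + pi ^ 2 / 6"
    using norm_Li2_le[OF assms(2,3)] by (intro add_mono) (auto simp del: of_real_divide of_real_power)
  finally show ?thesis by (simp add: divide_right_mono)
qed

lemma continuous_on_growth: "continuous_on (slit_domain - {0}) growth"
proof -
  have "continuous_on (slit_domain - {0}) log_quot_prim"
    using log_quot_prim_deriv by (intro DERIV_continuous_on) (auto intro: has_field_derivative_at_within)
  then show ?thesis unfolding growth_def by (intro continuous_intros) auto
qed

text \<open>The dilogarithm formula extends to the imaginary axis by continuity. At this height e^z
  = -i, and division by a purely imaginary number picks out imaginary parts, so pi^2/6 drops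
  out.\<close>

lemma growth_imaginary:
  "growth (Complex 0 (3 * pi / 2)) = Im (Li2 (- \<i>)) / (3 * pi / 2)"
proof -
  define y where "y = 3 * pi / 2"
  have y: "0 < y" "y < 2 * pi" by (auto simp: y_def)
  let ?S = "{z. Re z \<le> 0} \<inter> (slit_domain - {0})"
  define f where "f = (\<lambda>z. growth z - Re ((Li2 (exp z) - of_real (pi ^ 2 / 6)) / z))"
  have "continuous_on ?S f"
    unfolding f_def
    by (intro continuous_intros continuous_on_subset[OF continuous_on_growth] continuous_on_compose2[OF continuous_on_Li2]) auto
  moreover have "((\<lambda>x. Complex x y) \<longlongrightarrow> Complex 0 y) (at_left 0)"
    unfolding Complex_eq by (auto intro!: tendsto_eq_intros)
  moreover have "Complex 0 y \<in> ?S" using y by (auto simp: slit_domain_def complex_eq_iff)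
  moreover have "eventually (\<lambda>x. Complex x y \<in> ?S) (at_left 0)"
    using eventually_at_left_real[of "-1" 0] by (rule eventually_mono) (auto simp: slit_domain_def complex_eq_iff)
  ultimately have "((\<lambda>x. f (Complex x y)) \<longlongrightarrow> f (Complex 0 y)) (at_left 0)"
    by (rule continuous_on_tendsto_compose)
  moreover have "eventually (\<lambda>x. f (Complex x y) = 0) (at_left 0)"
    using eventually_at_left_real[of "-1" 0] by (rule eventually_mono) (auto simp: f_def growth_eq_Li2)
  ultimately have "((\<lambda>x::real. 0) \<longlongrightarrow> f (Complex 0 y)) (at_left (0::real))"
    by (rule Lim_transform_eventually)
  then have "f (Complex 0 y) = 0" by (simp add: tendsto_const_iff)
  moreover have "exp (Complex 0 y) = - \<i>"
  proof -
    have "cos y = 0" "sin y = - 1"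
      using cos_add[of pi "pi/2"] sin_add[of pi "pi/2"] by (simp_all add: y_def)
    then show ?thesis by (simp add: complex_eq_iff Re_exp Im_exp)
  qed
  moreover have "Re (u / Complex 0 y) = Im u / y" for u
    using y by (simp add: Re_divide power2_eq_square)
  ultimately have "growth (Complex 0 y) = Im (Li2 (- \<i>) - of_real (pi ^ 2 / 6)) / y"
    unfolding f_def by (metis eq_iff_diff_eq_0)
  then show ?thesis by (simp add: y_def)
qed

text \<open>With $D(s) = s F'(s) - F(s)$ one has $(F(s)/s)' = D(s)/s^2$ and $D' = s F''$, so the sign
  pattern of $F''$ controls the monotonicity of $F(s)/s$.\<close>

lemma ray_maximum:
  fixes F u u' :: "real \<Rightarrow> real"
  assumes s: "0 < s1" "s1 \<le> t" "t < 1" "1 < s2"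
    and F: "\<And>s. s1 \<le> s \<Longrightarrow> s \<le> s2 \<Longrightarrow> (F has_real_derivative u s) (at s)"
    and u: "\<And>s. s1 \<le> s \<Longrightarrow> s \<le> s2 \<Longrightarrow> (u has_real_derivative u' s) (at s)"
    and up: "\<And>s. s1 \<le> s \<Longrightarrow> s \<le> t \<Longrightarrow> u' s \<ge> 0"
    and down: "\<And>s. t < s \<Longrightarrow> s \<le> s2 \<Longrightarrow> u' s < 0"
    and crit: "F 1 = u 1" and left: "F s1 / s1 < F 1"
    and x: "s1 \<le> x" "x \<le> s2" "x \<noteq> 1"
  shows "F x / x < F 1"
proof -
  define D where "D = (\<lambda>s. s * u s - F s)"
  define K where "K = (\<lambda>s. F s / s)"
  have dD: "(D has_real_derivative s * u' s) (at s)" if "s1 \<le> s" "s \<le> s2" for s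
    unfolding D_def by (rule derivative_eq_intros F u that refl | simp)+
  have dK: "(K has_real_derivative D s / s ^ 2) (at s)" if "s1 \<le> s" "s \<le> s2" for s
    unfolding K_def D_def using that s
    by (auto intro!: derivative_eq_intros F simp: power2_eq_square mult.commute)
  have contD: "continuous_on {c..d} D" and contK: "continuous_on {c..d} K" if "s1 \<le> c" "d \<le> s2" for c d
    by (intro continuous_at_imp_continuous_on ballI DERIV_isCont[OF dD] DERIV_isCont[OF dK]; use that in simp)+
  have D1: "D 1 = 0" using crit by (simp add: D_def)
  have Dpos: "D r > 0" if "t \<le> r" "r < 1" for r
  proof -
    have "D 1 < D r"
    proof (rule DERIV_neg_imp_decreasing_open[OF that(2)])
      fix y assume y: "r < y" "y < 1"
      then show "\<exists>z. (D has_real_derivative z) (at y) \<and> z < 0"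
        using dD[of y] down[of y] s that by (intro exI[of _ "y * u' y"]) (auto intro!: mult_pos_neg)
    qed (use contD that s in auto)
    then show ?thesis using D1 by simp
  qed
  have Dneg: "D r < 0" if "1 < r" "r \<le> s2" for r
  proof -
    have "D r < D 1"
    proof (rule DERIV_neg_imp_decreasing_open[OF that(1)])
      fix y assume y: "1 < y" "y < r"
      then show "\<exists>z. (D has_real_derivative z) (at y) \<and> z < 0"
        using dD[of y] down[of y] s that by (intro exI[of _ "y * u' y"]) (auto intro!: mult_pos_neg)
    qed (use contD that s in auto)
    then show ?thesis using D1 by simp
  qed
  have Dmono: "D c \<le> D d" if "s1 \<le> c" "c \<le> d" "d \<le> t" for c d
  proof (rule DERIV_nonneg_imp_nondecreasing[OF that(2)])
    fix y assume y: "c \<le> y" "y \<le> d"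
    then show "\<exists>z. (D has_real_derivative z) (at y) \<and> 0 \<le> z"
      using dD[of y] up[of y] s that by (intro exI[of _ "y * u' y"]) auto
  qed
  have Kinc: "K c < K d" if "s1 \<le> c" "c < d" "d \<le> s2" "\<And>y. c < y \<Longrightarrow> y < d \<Longrightarrow> D y > 0" for c d
  proof (rule DERIV_pos_imp_increasing_open[OF that(2)])
    fix y assume y: "c < y" "y < d"
    then show "\<exists>z. (K has_real_derivative z) (at y) \<and> 0 < z"
      using dK[of y] that s by (intro exI[of _ "D y / y ^ 2"]) auto
  qed (use contK that in auto)
  have Kdec: "K d < K c" if "s1 \<le> c" "c < d" "d \<le> s2" "\<And>y. c < y \<Longrightarrow> y < d \<Longrightarrow> D y < 0" for c d
  proof (rule DERIV_neg_imp_decreasing_open[OF that(2)])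
    fix y assume y: "c < y" "y < d"
    then show "\<exists>z. (K has_real_derivative z) (at y) \<and> z < 0"
      using dK[of y] that s by (intro exI[of _ "D y / y ^ 2"]) (auto intro!: divide_neg_pos)
  qed (use contK that in auto)
  have "K x < K 1"
  proof -
    consider "1 < x" | "t \<le> x" "x < 1" | "x < t" "D x \<ge> 0" | "x < t" "D x < 0" using x by linarith
    \<comment> \<open>Up to \<open>t\<close> the function D is nondecreasing, so it can change sign
      there only from negative to positive: K first falls and then rises, and is bounded by its
      values at the two ends. Beyond \<open>t\<close>, D is positive before 1 and negative after
      it.\<close>
    then show ?thesis
    proof cases
      case 1
      then show ?thesis using s x by (intro Kdec) (auto intro!: Dneg)
    next
      case 2
      then show ?thesis using s x by (intro Kinc) (auto intro!: Dpos)
    next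
      case 3
      have "K x \<le> K t"
      proof (rule DERIV_nonneg_imp_nondecreasing[of x t K])
        fix y assume y: "x \<le> y" "y \<le> t"
        then have "D y \<ge> 0" using Dmono[of x y] 3 x by simp
        then show "\<exists>z. (K has_real_derivative z) (at y) \<and> 0 \<le> z"
          using dK[of y] y s x by (intro exI[of _ "D y / y ^ 2"]) auto
      qed (use 3 in simp)
      also have "K t < K 1" using s x by (intro Kinc) (auto intro!: Dpos)
      finally show ?thesis .
    next
      case 4
      have neg: "D y < 0" if "s1 \<le> y" "y \<le> x" for y using Dmono[of y x] that 4 by simp
      have "K x \<le> K s1"
      proof (cases "x = s1")
        case False
        then have "K x < K s1" using s x by (intro Kdec) (auto intro!: neg)
        then show ?thesis by simp
      qed simp
      also have "K s1 < K 1" using left by (simp add: K_def)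
      finally show ?thesis .
    qed
  qed
  then show ?thesis by (simp add: K_def)
qed

lemma Re_has_real_derivative_of_real:
  assumes "(g has_field_derivative d) (at (of_real s))"
  shows "((\<lambda>s. Re (g (of_real s))) has_real_derivative Re d) (at s)"
proof -
  have "((\<lambda>s. g (of_real s)) has_vector_derivative d) (at s)"
    using has_vector_derivative_real_field[OF assms] .
  from bounded_linear.has_vector_derivative[OF bounded_linear_Re this]
  show ?thesis by (simp add: has_real_derivative_iff_has_vector_derivative)
qed

text \<open>On the rising branch sin x >= x - x^3/6 is evaluated at 49/100; the falling branch is
  reflected at pi/2, with pi - 53/20 > 49/100.\<close>

lemma sin_ge_on_middle:
  assumes "1/2 \<le> x" "x \<le> 53/20" shows "sin x \<ge> (47/100 :: real)"
proof -
  have s: "sin y \<ge> 47/100" if "49/100 \<le> y" "y \<le> pi / 2" for y :: real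
  proof -
    have m: "sin (49/100) \<le> sin y" using that by (intro sin_mono_le_eq[THEN iffD2]) auto
    have "(49/100) - (49/100)^3 / 6 \<le> sin (49/100 :: real)"
    proof -
      have "(\<lambda>x. sin x - (x - x^3/6)) 0 \<le> (\<lambda>x. sin x - (x - x^3/6)) (49/100 :: real)"
      proof (rule DERIV_nonneg_imp_nondecreasing[of 0 "49/100" "\<lambda>x. sin x - (x - x^3/6)"])
        fix t :: real
        have "((\<lambda>x. sin x - (x - x^3/6)) has_real_derivative cos t - (1 - t^2 / 2)) (at t)"
          by (auto intro!: derivative_eq_intros)
        moreover have "0 \<le> cos t - (1 - t^2 / 2)"
        proof -
          have "(sin (t / 2))\<^sup>2 \<le> (t / 2)\<^sup>2" using abs_sin_x_le_abs_x[of "t / 2"] by (simp only: abs_le_square_iff)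
          moreover have "cos t = 1 - 2 * (sin (t / 2))\<^sup>2" using cos_double_sin[of "t / 2"] by simp
          ultimately show ?thesis by (simp add: power2_eq_square)
        qed
        ultimately show "\<exists>y. ((\<lambda>x. sin x - (x - x^3/6)) has_real_derivative y) (at t) \<and> 0 \<le> y" by blast
      qed simp
      then show ?thesis by simp
    qed
    moreover have "47/100 \<le> (49/100) - (49/100)^3 / (6::real)" by (simp add: power3_eq_cube)
    ultimately show ?thesis using m by linarith
  qed
  show ?thesis
  proof (cases "x \<le> pi / 2")
    case True
    then show ?thesis using s[of x] assms by simp
  next
    case False
    have "3.14 < pi" using pi_approx by simp
    then have "157/50 < pi" by simp
    then have "sin (pi - x) \<ge> 47/100" using False assms by (intro s) linarith+
    then show ?thesis by simp
  qed
qed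

section \<open>Comparison of the growth rate with its value at the saddle point\<close>

lemma Re_z0_neg: "Re z0 < 0" and Im_z0_pos: "Im z0 > 0" and z0_nonzero [simp]: "z0 \<noteq> 0"
  using z0_bounds by auto

lemma norm_z0: "norm z0 \<ge> 37/5"
  using abs_Im_le_cmod[of z0] z0_bounds(3) by simp

lemma growth_z0: "growth z0 = - ln (norm (1 - exp z0))"
proof -
  have "1 - exp z0 \<noteq> 0" using z0_bounds(7) by (auto simp: complex_eq_iff)
  then have "Re (Ln (1 - exp z0)) = ln (norm (1 - exp z0))" by simp
  moreover have "(Li2 (exp z0) - of_real (pi ^ 2 / 6)) / z0 = - Ln (1 - exp z0)"
    using z0_eq by (simp add: divide_eq_eq) (simp add: algebra_simps eq_neg_iff_add_eq_0)
  ultimately show ?thesis unfolding growth_eq_Li2[OF Re_z0_neg] by simp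
qed

lemma growth_z0_gt: "331/5000 \<le> growth z0"
  using b_gt growth_z0 by simp

text \<open>The ray through $z_0$ meets the line $\mathrm{Im}\,z = 3\pi/2$ at \<open>s1\<close> times $z_0$.\<close>

definition s1 :: real where "s1 = (3 * pi / 2) / Im z0"

lemma s1_bounds: "0 < s1" "s1 < 7/10" "s1 * Im z0 = 3 * pi / 2"
proof -
  show "0 < s1" "s1 * Im z0 = 3 * pi / 2" using Im_z0_pos by (auto simp: s1_def)
  show "s1 < 7/10" unfolding s1_def using z0_bounds(3) pi_less by (simp add: divide_simps)
qed

text \<open>Moving left from the imaginary axis costs at most -x/4, which is at most 0.2573 up to
  the corner on the ray, while the value on the axis is at most -0.1925. The sum 0.0648 is below
  0.0662.\<close>

lemma growth_horizontal_line:
  assumes "x \<ge> s1 * Re z0"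
  shows "growth (Complex x (3 * pi / 2)) < growth z0"
proof -
  have p1: "pi < 31416/10000" using pi_approx by simp
  have "s1 \<le> (31416/10000 * 3 / 2) / (74133/10000)"
    unfolding s1_def using z0_bounds(3) p1 by (intro frac_le) auto
  then have "s1 * (- Re z0) \<le> (31416/10000 * 3 / 2) / (74133/10000) * (16182/10000)"
    using z0_bounds(1,2) s1_bounds(1) by (intro mult_mono) auto
  then have x: "- x / 4 \<le> 2573/10000" using assms by simp
  have "growth (Complex x (3 * pi / 2)) \<le> growth (Complex 0 (3 * pi / 2)) - x / 4"
    by (rule growth_horizontal) auto
  also have "growth (Complex 0 (3 * pi / 2)) \<le> - (227/250) / (3 * pi / 2)"
    unfolding growth_imaginary using Im_Li2_minus_i by (intro divide_right_mono) auto
  also have "\<dots> \<le> - (1925/10000)"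
    using p1 by (simp add: divide_simps)
  finally show ?thesis using x growth_z0_gt by linarith
qed

lemma growth_left:
  assumes "Re z \<le> - 32"
  shows "growth z < growth z0"
proof -
  have neg: "Re z < 0" using assms by simp
  have nz: "norm z \<ge> 32" using abs_Re_le_cmod[of z] assms by linarith
  have "exp (Re z) \<le> exp (- 32)" using assms by simp
  also have "\<dots> = 1 / exp (32 :: real)" by (simp add: exp_minus inverse_eq_divide)
  also have "\<dots> \<le> 1 / 33" using exp_ge_add_one_self[of "32::real"] by (intro divide_left_mono) auto
  finally have "norm (exp z) \<le> 1 / 33" by simp
  from growth_le_left[OF neg this]
  have "growth z \<le> (1 / 32 + pi ^ 2 / 6) / norm z" by simp
  also have "\<dots> \<le> (1 / 32 + pi ^ 2 / 6) / 32"
    using nz by (intro divide_left_mono) (auto intro!: mult_pos_pos add_pos_pos)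
  also have "pi ^ 2 \<le> (16/5) ^ 2" using pi_less by (intro power_mono) auto
  finally have "growth z \<le> (1 / 32 + (16/5) ^ 2 / 6) / 32" by simp
  then show ?thesis using growth_z0_gt by (simp add: power2_eq_square)
qed

text \<open>Reflection to the left half plane bounds the growth rate at -z by less than 1/2, and
  passing from -z back to z subtracts at least 2.\<close>

lemma growth_right:
  assumes "Re z \<ge> 4"
  shows "growth z < growth z0"
proof -
  have z: "z \<in> slit_domain" "z \<noteq> 0" using assms by (auto simp: slit_domain_def)
  have nz: "norm z \<ge> 4" using complex_Re_le_cmod[of z] assms by linarith
  have "exp (- Re z) \<le> exp (- 4)" using assms by simp
  also have "\<dots> = 1 / exp (4 :: real)" by (simp add: exp_minus inverse_eq_divide)
  also have "\<dots> \<le> 1 / 5" using exp_ge_add_one_self[of "4::real"] by (intro divide_left_mono) auto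
  finally have "norm (exp (- z)) \<le> 1 / 5" by simp
  then have "growth (- z) \<le> (1 / 4 + pi ^ 2 / 6) / norm z"
    using growth_le_left[of "- z" "1/5"] assms by simp
  also have "\<dots> \<le> (1 / 4 + pi ^ 2 / 6) / 4"
    using nz by (intro divide_left_mono) (auto intro!: mult_pos_pos add_pos_pos)
  also have "pi ^ 2 \<le> (16/5) ^ 2" using pi_less by (intro power_mono) auto
  finally have "growth (- z) \<le> (1 / 4 + (16/5) ^ 2 / 6) / 4" by simp
  then show ?thesis using growth_z0_gt growth_uminus[OF z] assms by (simp add: power2_eq_square)
qed

text \<open>Along the ray the rate is Re((Li2(w) - pi^2/6)/z0) divided by s. For s >= 6/5 the
  dilogarithm is small because |w| <= 3/20, and the factor 1/s then brings the crude bound below the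
  value at \<open>z0\<close>.\<close>

lemma growth_ray_far:
  assumes s: "s \<ge> 6/5"
  shows "growth (of_real s * z0) < growth z0"
proof -
  define w where "w = exp (of_real s * z0)"
  have s0: "s > 0" using s by simp
  have neg: "Re (of_real s * z0) < 0" using s0 Re_z0_neg by (simp add: mult_pos_neg)
  have "(\<Sum>m<6. (19215/10000) ^ m / fact m :: real) \<ge> 20/3"
    by (simp add: eval_nat_numeral fact_numeral)
  with exp_ge_even_Taylor[of 6 "19215/10000"] have e: "exp (19215/10000) \<ge> (20/3 :: real)" by simp
  have "(6/5) * (16013/10000) \<le> s * (- Re z0)" using s z0_bounds(2) by (intro mult_mono) auto
  then have "exp (s * Re z0) \<le> exp (- (19215/10000))" by simp
  also have "\<dots> = 1 / exp (19215/10000 :: real)" by (simp add: exp_minus inverse_eq_divide)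
  also have "\<dots> \<le> 1 / (20/3)" using e by (intro divide_left_mono) auto
  finally have "norm w \<le> 3/20" by (simp add: w_def)
  from norm_Li2_le[OF this] have L: "norm (Li2 w) \<le> 3/17" by simp
  have "growth (of_real s * z0) = Re ((Li2 w - of_real (pi ^ 2 / 6)) / z0) / s"
    unfolding growth_eq_Li2[OF neg] w_def[symmetric] using s0
    by (simp add: Re_divide_of_real[symmetric] mult.commute[of "of_real s"] del: Re_divide_of_real)
  \<comment> \<open>The term with pi^2/6 contributes positively because \<open>Re z0\<close> is
    negative; its size is estimated through Re z0 / |z0|^2.\<close>
  also have "Re ((Li2 w - of_real (pi ^ 2 / 6)) / z0) \<le> (3/17) / (37/5) + (16/5)^2 / 6 * ((8091/5000) / (37/5)^2)"
  proof -
    have "Re (Li2 w / z0) \<le> norm (Li2 w / z0)" by (rule complex_Re_le_cmod)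
    also have "\<dots> \<le> (3/17) / (37/5)" unfolding norm_divide using L norm_z0 by (intro frac_le) auto
    finally have 1: "Re (Li2 w / z0) \<le> (3/17) / (37/5)" .
    have q: "Re (of_real c / z0) = c * (Re z0 / (norm z0)\<^sup>2)" for c :: real
      by (simp add: Re_divide cmod_power2)
    have "Re z0 / (norm z0)\<^sup>2 \<le> 0" using Re_z0_neg by (intro divide_nonpos_nonneg) auto
    have "- Re (of_real (pi ^ 2 / 6) / z0) = pi ^ 2 / 6 * ((- Re z0) / (norm z0)\<^sup>2)"
      unfolding q by simp
    also have "\<dots> \<le> (16/5)^2 / 6 * ((8091/5000) / (37/5)^2)"
      using pi_less z0_bounds(1,2) norm_z0 \<open>Re z0 / (norm z0)\<^sup>2 \<le> 0\<close>
      by (intro mult_mono divide_right_mono power_mono frac_le) auto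
    finally show ?thesis using 1 by (simp add: diff_divide_distrib)
  qed
  finally have "growth (of_real s * z0) \<le> ((3/17) / (37/5) + (16/5)^2 / 6 * ((8091/5000) / (37/5)^2)) / s"
    using s0 by (simp add: divide_right_mono)
  also have "\<dots> \<le> ((3/17) / (37/5) + (16/5)^2 / 6 * ((8091/5000) / (37/5)^2)) / (6/5)"
    using s by (intro divide_left_mono) auto
  also have "\<dots> < 331/5000" by (simp add: power2_eq_square)
  finally show ?thesis using growth_z0_gt by linarith
qed

text \<open>\<open>ray_maximum\<close> is applied to F(s) = s times the growth rate at s z0. The
  equation of \<open>z0\<close> is the condition F(1) = F'(1), and the sign of F'' is that of the
  real function \<open>J\<close>, which changes sign once, before s = 1.\<close>

lemma growth_ray_near:
  assumes s: "s1 \<le> s" "s \<le> 6/5" "s \<noteq> 1"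
  shows "growth (of_real s * z0) < growth z0"
proof -
  define a where "a = Re z0"
  define y where "y = Im z0"
  have a: "a < 0" and y: "y > 0" using Re_z0_neg Im_z0_pos by (auto simp: a_def y_def)
  have yb: "74133/10000 \<le> y" "y \<le> 74302/10000" and ab: "-16182/10000 \<le> a" "a \<le> -16013/10000"
    using z0_bounds(1-4) by (auto simp: a_def y_def)
  define F where "F = (\<lambda>s. Re ((Li2 (exp (of_real s * z0)) - of_real (pi ^ 2 / 6)) / z0))"
  define u where "u = (\<lambda>s::real. Re (- Ln (1 - exp (of_real s * z0))))"
  define u' where "u' = (\<lambda>s::real. Re (z0 * exp (of_real s * z0) / (1 - exp (of_real s * z0))))"
  \<comment> \<open>The second derivative of F is \<open>J\<close> times e^(s a) / |1 - e^(s z0)|^2,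
    a positive factor.\<close>
  define J where "J = (\<lambda>s. (- a) * (exp (s * a) - cos (s * y)) - y * sin (s * y))"
  have e: "norm (exp (of_real s * z0)) < 1" "1 - exp (of_real s * z0) \<notin> \<real>\<^sub>\<le>\<^sub>0" "1 - exp (of_real s * z0) \<noteq> 0" if "s > 0" for s :: real
    using left_half_plane[of "of_real s * z0"] that Re_z0_neg by (simp_all add: mult_pos_neg)
  have dE: "((\<lambda>\<zeta>. exp (\<zeta> * z0)) has_field_derivative exp (of_real s * z0) * z0) (at (of_real s))" for s :: real
    by (auto intro!: derivative_eq_intros)
  have F: "(F has_real_derivative u s) (at s)" if "s > 0" for s
  proof -
    have "((\<lambda>\<zeta>. Li2 (exp (\<zeta> * z0))) has_field_derivative (- Ln (1 - exp (of_real s * z0)) / exp (of_real s * z0)) * (exp (of_real s * z0) * z0)) (at (of_real s))"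
      by (rule DERIV_chain2[where f = Li2]) (rule Li2_deriv dE e that exp_not_eq_zero)+
    from DERIV_cdivide[OF DERIV_diff[OF this DERIV_const], of _ z0]
    have "((\<lambda>\<zeta>. (Li2 (exp (\<zeta> * z0)) - of_real (pi ^ 2 / 6)) / z0) has_field_derivative - Ln (1 - exp (of_real s * z0))) (at (of_real s))"
      by simp
    from Re_has_real_derivative_of_real[OF this] show ?thesis unfolding F_def u_def .
  qed
  have u: "(u has_real_derivative u' s) (at s)" if "s > 0" for s
  proof -
    have "((\<lambda>\<zeta>. - Ln (1 - exp (\<zeta> * z0))) has_field_derivative - (inverse (1 - exp (of_real s * z0)) * (0 - exp (of_real s * z0) * z0))) (at (of_real s))"
      by (intro DERIV_minus DERIV_chain2[where f = Ln] has_field_derivative_Ln e that DERIV_diff DERIV_const dE)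
    also have "- (inverse (1 - exp (of_real s * z0)) * (0 - exp (of_real s * z0) * z0)) = z0 * exp (of_real s * z0) / (1 - exp (of_real s * z0))"
      by (simp add: divide_inverse)
    finally show ?thesis using Re_has_real_derivative_of_real unfolding u_def u'_def by blast
  qed
  have u'J: "u' s = exp (s * a) * J s / (norm (1 - exp (of_real s * z0)))\<^sup>2" for s
  proof -
    define \<rho> c i where "\<rho> = exp (s * a)" and "c = cos (s * y)" and "i = sin (s * y)"
    have ci: "c\<^sup>2 + i\<^sup>2 = 1" by (simp add: c_def i_def)
    have ex: "Re (exp (of_real s * z0)) = \<rho> * c" "Im (exp (of_real s * z0)) = \<rho> * i"
      by (simp_all add: Re_exp Im_exp \<rho>_def c_def i_def a_def y_def)
    have "u' s = (Re (z0 * exp (of_real s * z0)) * (1 - \<rho> * c) + Im (z0 * exp (of_real s * z0)) * (- (\<rho> * i))) / (norm (1 - exp (of_real s * z0)))\<^sup>2"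
      unfolding u'_def Re_divide cmod_power2 by (simp add: ex)
    also have "Re (z0 * exp (of_real s * z0)) * (1 - \<rho> * c) + Im (z0 * exp (of_real s * z0)) * (- (\<rho> * i))
      = \<rho> * (a * c - y * i - \<rho> * a * (c\<^sup>2 + i\<^sup>2))"
      unfolding times_complex.sel ex a_def[symmetric] y_def[symmetric] by (simp add: power2_eq_square algebra_simps)
    also have "\<dots> = \<rho> * J s" unfolding ci J_def \<rho>_def c_def i_def by (simp add: algebra_simps)
    finally show ?thesis by (simp add: \<rho>_def)
  qed
  have sgn: "u' s \<ge> 0 \<longleftrightarrow> J s \<ge> 0" if "s > 0" for s
    unfolding u'J using e(3)[OF that] by (simp add: zero_le_divide_iff zero_le_mult_iff)
  \<comment> \<open>At this parameter the ray reaches height 2 pi, where \<open>J\<close> is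
    negative; at \<open>s1\<close> the height is 3 pi / 2 and \<open>J\<close> is positive.\<close>
  define sm where "sm = 2 * pi / y"
  have p3: "pi < 31416/10000" "31415/10000 < pi" using pi_approx by simp_all
  have sm: "s1 < sm" "sm < 1" "84/100 < sm" "sm * y = 2 * pi"
    unfolding sm_def s1_def y_def[symmetric] using y yb p3 by (auto simp: divide_simps)
  \<comment> \<open>Between heights 3 pi / 2 and 2 pi the cosine is nonnegative and the sine
    nonpositive, so no term of the derivative of \<open>J\<close> is positive.\<close>
  have Jdec: "J d < J c" if "s1 \<le> c" "c < d" "d \<le> sm" for c d
  proof (rule DERIV_neg_imp_decreasing_open[OF that(2)])
    fix s assume sx: "c < s" "s < d"
    have s0: "s > 0" using sx that s1_bounds(1) by linarith
    have sy: "3 * pi / 2 \<le> s * y" "s * y \<le> 2 * pi"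
      using mult_right_mono[of s1 s y] mult_right_mono[of s sm y] sx that y sm s1_bounds(3) by (auto simp: y_def)
    have "cos (s * y) = cos (2 * pi - s * y)" "sin (s * y) = - sin (2 * pi - s * y)" by (simp_all add: cos_diff sin_diff)
    moreover have "cos (2 * pi - s * y) \<ge> 0"
      by (rule cos_ge_zero) (use sy pi_gt_zero in linarith)+
    moreover have "sin (2 * pi - s * y) \<ge> 0"
      by (rule sin_ge_zero) (use sy pi_gt_zero in linarith)+
    ultimately have cs: "cos (s * y) \<ge> 0" "sin (s * y) \<le> 0" by auto
    have "(J has_real_derivative (- a) * (exp (s * a) * a + sin (s * y) * y) - y * (cos (s * y) * y)) (at s)"
      unfolding J_def by (auto intro!: derivative_eq_intros)
    moreover have "(- a) * (exp (s * a) * a + sin (s * y) * y) - y * (cos (s * y) * y) < 0"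
    proof -
      have "exp (s * a) * a + sin (s * y) * y < 0" using a y cs
        by (intro add_neg_nonpos mult_pos_neg mult_nonpos_nonneg) auto
      then have "(- a) * (exp (s * a) * a + sin (s * y) * y) < 0" using a by (intro mult_pos_neg) auto
      moreover have "y * (cos (s * y) * y) \<ge> 0" using y cs by simp
      ultimately show ?thesis by linarith
    qed
    ultimately show "\<exists>z. (J has_real_derivative z) (at s) \<and> z < 0" by blast
  next
    show "continuous_on {c..d} J" unfolding J_def by (intro continuous_intros)
  qed
  have Jsm: "J sm < 0"
  proof -
    have "J sm = (- a) * (exp (sm * a) - 1)" by (simp add: J_def sm)
    moreover have "exp (sm * a) < 1" using sm a by (simp add: mult_pos_neg)
    moreover have "(- a) * (exp (sm * a) - 1) < 0"
      by (rule mult_pos_neg) (use a calculation(2) in auto)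
    ultimately show ?thesis by simp
  qed
  have Js1: "J s1 > 0"
  proof -
    have sy: "s1 * y = 3 * pi / 2" using s1_bounds(3) by (simp add: y_def)
    have "cos (s1 * y) = 0" "sin (s1 * y) = - 1"
      unfolding sy using cos_add[of pi "pi/2"] sin_add[of pi "pi/2"] by simp_all
    then have "J s1 = (- a) * exp (s1 * a) + y" unfolding J_def by simp
    moreover have "(- a) * exp (s1 * a) > 0" by (rule mult_pos_pos) (use a in auto)
    ultimately show ?thesis using y by linarith
  qed
  have "\<exists>t\<ge>s1. t \<le> sm \<and> J t = 0"
    by (rule IVT2') (use Js1 Jsm sm in \<open>auto intro!: continuous_intros simp: J_def\<close>)
  then obtain t where t: "s1 \<le> t" "t \<le> sm" "J t = 0" by blast
  \<comment> \<open>Above height 2 pi the sine is positive again. Either cos \<open>\<phi>\<close>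
    >= e^(s a), and both terms of \<open>J\<close> have the right sign, or \<open>\<phi>\<close> is
    at least 1/2 and the sine term dominates.\<close>
  have Jneg_far: "J s < 0" if s: "sm \<le> s" "s \<le> 6/5" for s
  proof (cases "s = sm")
    case False
    define \<phi> where "\<phi> = s * y - 2 * pi"
    have "s * y \<le> (6/5) * (74302/10000)" using s yb y sm by (intro mult_mono) auto
    then have \<phi>: "0 < \<phi>" "\<phi> \<le> 53/20"
      using mult_strict_right_mono[of sm s y] False s y sm p3 by (auto simp: \<phi>_def)
    have sc: "sin (s * y) = sin \<phi>" "cos (s * y) = cos \<phi>" by (simp_all add: \<phi>_def sin_diff cos_diff)
    have sp: "sin \<phi> > 0" using \<phi> p3 by (intro sin_gt_zero) auto
    show ?thesis
    proof (cases "exp (s * a) \<le> cos \<phi>")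
      case True
      then have "(- a) * (exp (s * a) - cos \<phi>) \<le> 0" using a by (intro mult_nonneg_nonpos) auto
      moreover have "y * sin \<phi> > 0" using y sp by simp
      ultimately show ?thesis unfolding J_def sc by linarith
    next
      case False
      have "(84/100) * (16013/10000) \<le> s * (- a)" using s sm ab by (intro mult_mono) auto
      then have "exp (s * a) \<le> exp (- 1)" by simp
      also have "\<dots> = 1 / exp (1::real)" by (simp add: exp_minus inverse_eq_divide)
      also have "\<dots> \<le> 1 / 2" using exp_ge_add_one_self[of "1::real"] by (intro divide_left_mono) auto
      finally have ex: "exp (s * a) \<le> 1/2" .
      have "\<phi> \<ge> 1/2"
      proof (rule ccontr)
        assume "\<not> \<phi> \<ge> 1/2"
        then have "cos (1/2) \<le> cos \<phi>" using \<phi> p3 by (intro cos_monotone_0_pi_le) auto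
        moreover have "cos (1/2 :: real) \<ge> 1/2"
          using cos_double_sin[of "1/4 :: real"] abs_sin_x_le_abs_x[of "1/4 :: real"] abs_le_square_iff[of "sin (1/4 :: real)" "1/4"]
          by (simp add: power2_eq_square)
        ultimately show False using ex False by linarith
      qed
      then have sg: "sin \<phi> \<ge> 47/100" using \<phi> by (intro sin_ge_on_middle) auto
      have "(- a) * (exp (s * a) - cos \<phi>) \<le> (16182/10000) * (1/2 + 1)"
        using ab ex False cos_ge_minus_one[of \<phi>] by (intro mult_mono) linarith+
      also have "\<dots> < (74133/10000) * (47/100 :: real)" by simp
      also have "\<dots> \<le> y * sin \<phi>" using yb sg by (intro mult_mono) auto
      finally show ?thesis unfolding J_def sc by simp
    qed
  qed (use Jsm in simp)
  have "F s / s < F 1"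
  proof (rule ray_maximum[where ?s1.0 = s1 and ?s2.0 = "6/5" and t = t and u = u and u' = u'])
    show "0 < s1" by (rule s1_bounds)
    show "s1 \<le> t" by (rule t)
    show "t < 1" using t sm by linarith
    show "(1::real) < 6/5" by simp
    show "(F has_real_derivative u s) (at s)" if "s1 \<le> s" for s using that s1_bounds by (intro F) auto
    show "(u has_real_derivative u' s) (at s)" if "s1 \<le> s" for s using that s1_bounds by (intro u) auto
    show "u' s \<ge> 0" if "s1 \<le> s" "s \<le> t" for s
    proof -
      have "J s \<ge> 0" using Jdec[of s t] that t by (cases "s = t") auto
      then show ?thesis using sgn[of s] that s1_bounds by auto
    qed
    show "u' s < 0" if "t < s" "s \<le> 6/5" for s
    proof -
      have "J s < 0"
      proof (cases "s \<le> sm")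
        case True
        then show ?thesis using Jdec[of t s] that t by auto
      next
        case False
        then show ?thesis using that by (intro Jneg_far) auto
      qed
      then show ?thesis using sgn[of s] that t s1_bounds by auto
    qed
    have F1: "F 1 = growth z0" unfolding F_def using growth_eq_Li2[OF Re_z0_neg] by simp
    show "F 1 = u 1" unfolding F1 growth_z0 u_def using e(3)[of 1] by simp
    have "of_real s1 * z0 = Complex (s1 * Re z0) (3 * pi / 2)"
      using s1_bounds(3) by (simp add: complex_eq_iff)
    then have "growth (of_real s1 * z0) < growth z0" using growth_horizontal_line[of "s1 * Re z0"] by simp
    moreover have "growth (of_real s1 * z0) = F s1 / s1"
    proof -
      have "Re (of_real s1 * z0) < 0" using s1_bounds Re_z0_neg by (simp add: mult_pos_neg)
      then show ?thesis unfolding F_def using s1_bounds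
        by (subst growth_eq_Li2) (simp_all add: Re_divide_of_real[symmetric] mult.commute[of "of_real s1"] del: Re_divide_of_real)
    qed
    ultimately show "F s1 / s1 < F 1" unfolding F1 by simp
  qed (use s in auto)
  moreover have "growth (of_real s * z0) = F s / s"
  proof -
    have s0: "s > 0" using s s1_bounds by auto
    have "Re (of_real s * z0) < 0" using s0 Re_z0_neg by (simp add: mult_pos_neg)
    then show ?thesis unfolding F_def using s0
      by (subst growth_eq_Li2) (simp_all add: Re_divide_of_real[symmetric] mult.commute[of "of_real s"] del: Re_divide_of_real)
  qed
  moreover have "F 1 = growth z0" unfolding F_def using growth_eq_Li2[OF Re_z0_neg] by simp
  ultimately show ?thesis by simp
qed

section \<open>The contour\<close>

lemma power_le_fact_exp: "x \<ge> 0 \<Longrightarrow> x ^ n / fact n \<le> exp (x::real)"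
  using sum_le_suminf[of "\<lambda>n. x ^ n / fact n" "{n}"] summable_exp[of x]
  by (simp add: exp_def scaleR_conv_of_real field_simps)

text \<open>The error of the trapezoidal approximation after division by z; it is O(1/N) on compact
  sets avoiding 0, so its exponential tends to 1.\<close>

definition log_quot_error :: "nat \<Rightarrow> complex \<Rightarrow> complex" where
  "log_quot_error N z = (\<Sum>j=1..N. log_quot (of_nat j * z / of_nat N)) - of_nat N * (log_quot_prim z / z) - log_quot z / 2"

definition amplitude :: "nat \<Rightarrow> complex \<Rightarrow> complex" where
  "amplitude l z = z ^ (l - 1) * exp (- (log_quot z / 2))"

text \<open>At w = z/N this combines the factor e^w from dx with ((e^w - 1)/w)^(l-1) from (x -
  1)^(l-1). Its value at w = 0 is 1.\<close>

definition correction :: "nat \<Rightarrow> complex \<Rightarrow> complex" where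
  "correction l w = exp w * expm1_quot w ^ (l - 1)"

text \<open>The function whose N-th power carries the exponential growth; the sign of -z and the
  term 1 come from extracting N^N / (e^N N!).\<close>

definition base :: "complex \<Rightarrow> complex" where
  "base z = exp (1 - log_quot_prim z / z) / (- z)"

lemma norm_base: "z \<noteq> 0 \<Longrightarrow> norm (base z) = exp (growth z)"
  by (simp add: base_def growth_def norm_divide norm_mult exp_diff mult.commute)

lemma integrand_eq:
  assumes z: "z \<in> slit_domain" "z \<noteq> 0" and N: "N \<ge> 1" and l: "l \<ge> 1"
  shows "integrand l N z = of_real (real N ^ N / (exp (real N) * fact N)) / of_nat N ^ l * amplitude l z *
     correction l (z / of_nat N) * exp (- log_quot_error N z) * base z ^ N"
proof -
  define w where "w = z / of_nat N"
  have zN: "z = of_nat N * w" using N by (simp add: w_def)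
  have e1: "exp w - 1 = w * expm1_quot w" by (simp add: expm1_quot_mult)
  have S: "- (\<Sum>j=1..N. log_quot (of_nat j * z / of_nat N)) = of_nat N * (1 - log_quot_prim z / z) + of_nat N * (- 1) + - (log_quot z / 2) + - log_quot_error N z"
    by (simp add: log_quot_error_def algebra_simps)
  have "exp (- (\<Sum>j=1..N. log_quot (of_nat j * z / of_nat N))) =
     exp (1 - log_quot_prim z / z) ^ N * exp (- 1) ^ N * exp (- (log_quot z / 2)) * exp (- log_quot_error N z)"
    unfolding S exp_add by (simp only: exp_of_nat_mult)
  then have "integrand l N z = exp w * (exp w - 1) ^ (l - 1) / of_nat N * (of_nat N ^ N / fact N * (1 / (- z) ^ N) *
     (exp (1 - log_quot_prim z / z) ^ N * exp (- 1) ^ N * exp (- (log_quot z / 2)) * exp (- log_quot_error N z)))"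
    unfolding integrand_def product_eq[OF z(1) N] w_def[symmetric] by simp
  also have "(exp w - 1) ^ (l - 1) = z ^ (l - 1) * expm1_quot w ^ (l - 1) / of_nat N ^ (l - 1)"
    unfolding e1 using N by (simp add: zN power_mult_distrib)
  also have "exp (- 1) ^ N = 1 / (of_real (exp (real N)) :: complex)"
    unfolding exp_of_nat_mult[symmetric] by (simp add: exp_minus inverse_eq_divide flip: exp_of_real)
  also have "exp w * (z ^ (l - 1) * expm1_quot w ^ (l - 1) / of_nat N ^ (l - 1)) / of_nat N * (of_nat N ^ N / fact N * (1 / (- z) ^ N) *
     (exp (1 - log_quot_prim z / z) ^ N * (1 / of_real (exp (real N))) * exp (- (log_quot z / 2)) * exp (- log_quot_error N z)))
    = of_nat N ^ N / (of_real (exp (real N)) * fact N) / (of_nat N ^ (l - 1) * of_nat N) * (z ^ (l - 1) * exp (- (log_quot z / 2))) *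
     (exp w * expm1_quot w ^ (l - 1)) * exp (- log_quot_error N z) * (exp (1 - log_quot_prim z / z) ^ N / (- z) ^ N)"
    by (simp add: mult_ac)
  also have "of_nat N ^ (l - 1) * of_nat N = (of_nat N ^ l :: complex)"
    using l by (metis Suc_diff_1 Suc_le_eq One_nat_def mult.commute power_Suc)
  also have "exp (1 - log_quot_prim z / z) ^ N / (- z) ^ N = base z ^ N"
    by (simp only: base_def power_divide)
  finally show ?thesis
    by (simp add: amplitude_def correction_def w_def)
qed

lemma log_quot_error_bound:
  assumes K: "compact K" "K \<subseteq> slit_domain - {0}"
  obtains B where "B \<ge> 0" "\<And>z N. z \<in> K \<Longrightarrow> N \<ge> 1 \<Longrightarrow> norm (log_quot_error N z) \<le> B / real N"
proof -
  obtain B where B: "B \<ge> 0" "\<And>z N. z \<in> K \<Longrightarrow> N \<ge> 1 \<Longrightarrow>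
     norm (z * ((\<Sum>j=1..N. log_quot (of_nat j * z / of_nat N)) - log_quot z / 2) - of_nat N * log_quot_prim z) \<le> B / real N"
  proof -
    have sub: "K \<subseteq> slit_domain" using K(2) by blast
    show thesis using log_quot_sum_bound[OF K(1) sub] that by blast
  qed
  have "compact ((\<lambda>z. 1 / z) ` K)" using K by (intro compact_continuous_image continuous_intros) auto
  then obtain R where R: "\<And>z. z \<in> K \<Longrightarrow> norm (1 / z) \<le> R"
    using compact_imp_bounded by (fastforce simp: bounded_iff)
  show ?thesis
  proof (rule that[of "\<bar>R\<bar> * B"])
    fix z and N :: nat assume z: "z \<in> K" and N: "N \<ge> 1"
    have z0: "z \<noteq> 0" using z K by auto
    have "log_quot_error N z = 1 / z * (z * ((\<Sum>j=1..N. log_quot (of_nat j * z / of_nat N)) - log_quot z / 2) - of_nat N * log_quot_prim z)"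
      using z0 by (simp add: log_quot_error_def field_simps)
    then have "norm (log_quot_error N z) = norm (1 / z) * norm (z * ((\<Sum>j=1..N. log_quot (of_nat j * z / of_nat N)) - log_quot z / 2) - of_nat N * log_quot_prim z)"
      by (simp only: norm_mult)
    also have "\<dots> \<le> \<bar>R\<bar> * (B / real N)" using R[OF z] B(2)[OF z N] by (intro mult_mono) auto
    finally show "norm (log_quot_error N z) \<le> \<bar>R\<bar> * B / real N" by simp
  qed (use B in auto)
qed

lemma continuous_on_log_quot: "continuous_on slit_domain log_quot"
  using holomorphic_log_quot by (rule holomorphic_on_imp_continuous_on)

lemma continuous_on_log_quot_prim: "continuous_on slit_domain log_quot_prim"
  using log_quot_prim_deriv by (intro DERIV_continuous_on) (auto intro: has_field_derivative_at_within)

lemma continuous_on_amplitude: "continuous_on slit_domain (amplitude l)"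
  unfolding amplitude_def by (intro continuous_intros continuous_on_log_quot) auto

lemma holomorphic_amplitude: "amplitude l holomorphic_on slit_domain"
  unfolding amplitude_def by (intro holomorphic_intros holomorphic_log_quot) auto

lemma holomorphic_correction: "correction l holomorphic_on A"
  unfolding correction_def by (intro holomorphic_intros holomorphic_expm1_quot)

lemma continuous_on_log_quot_error: "continuous_on (slit_domain - {0}) (log_quot_error N)"
proof -
  have "of_nat j * z / of_nat N \<in> slit_domain" if "z \<in> slit_domain" "j \<in> {1..N}" for j z
    using slit_domain_scale[OF that(1), of "real j / real N"] that(2) by simp
  then show ?thesis unfolding log_quot_error_def
    by (intro continuous_intros continuous_on_subset[OF continuous_on_log_quot_prim] continuous_on_compose2[OF continuous_on_log_quot]) auto
qed

lemma continuous_on_integrand: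
  assumes "N \<ge> 1"
  shows "continuous_on (slit_domain - {0}) (integrand l N)"
proof -
  have "1 - exp (of_nat j * z / of_nat N) \<noteq> 0" if "z \<in> slit_domain - {0}" "j \<in> {1..N}" for j z
    using exp_power_neq_1[of z j N] that by (auto simp: exp_of_nat_mult[symmetric])
  then show ?thesis unfolding integrand_def
    using assms by (intro continuous_intros) auto
qed

text \<open>The elementary inequality N^N <= e^N N! controls the prefactor, the power N^(-l) is at
  most 1, and all other factors except \<open>base z ^ N\<close> are bounded on compact sets
  uniformly in N.\<close>

lemma integrand_bound:
  assumes K: "compact K" "K \<subseteq> slit_domain - {0}" and l: "l \<ge> 1"
  obtains M where "M \<ge> 0" "\<And>z N. z \<in> K \<Longrightarrow> N \<ge> 1 \<Longrightarrow> norm (integrand l N z) \<le> M * exp (real N * growth z)"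
proof -
  obtain B where B: "B \<ge> 0" "\<And>z N. z \<in> K \<Longrightarrow> N \<ge> 1 \<Longrightarrow> norm (log_quot_error N z) \<le> B / real N"
    using log_quot_error_bound[OF K] by metis
  have "compact (amplitude l ` K)"
    using K by (intro compact_continuous_image continuous_on_subset[OF continuous_on_amplitude]) auto
  then obtain Q where Q: "\<And>z. z \<in> K \<Longrightarrow> norm (amplitude l z) \<le> Q"
    using compact_imp_bounded by (fastforce simp: bounded_iff)
  obtain R where R: "\<And>z. z \<in> K \<Longrightarrow> norm z \<le> R"
    using compact_imp_bounded[OF K(1)] by (auto simp: bounded_iff)
  have "compact (correction l ` cball 0 R)"
    by (intro compact_continuous_image holomorphic_on_imp_continuous_on holomorphic_correction compact_cball)
  then obtain W where W: "\<And>z. norm z \<le> R \<Longrightarrow> norm (correction l z) \<le> W"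
    using compact_imp_bounded by (fastforce simp: bounded_iff)
  show ?thesis
  proof (rule that[of "\<bar>Q\<bar> * \<bar>W\<bar> * exp B"])
    fix z and N :: nat assume z: "z \<in> K" and N: "N \<ge> 1"
    have z': "z \<in> slit_domain" "z \<noteq> 0" using z K by auto
    have n1: "real N ^ N / (exp (real N) * fact N) \<le> 1"
      using power_le_fact_exp[of "real N" N] by (simp add: field_simps)
    have n2: "(1::real) \<le> real N ^ l" using N by simp
    have "norm (z / of_nat N) \<le> R"
    proof -
      have "norm z / real N \<le> norm z / 1" using N by (intro divide_left_mono) auto
      then show ?thesis using R[OF z] by (simp add: norm_divide)
    qed
    then have w: "norm (correction l (z / of_nat N)) \<le> \<bar>W\<bar>" using W by fastforce
    have "norm (log_quot_error N z) \<le> B"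
    proof -
      have "B / real N \<le> B / 1" using N B(1) by (intro divide_left_mono) auto
      then show ?thesis using B(2)[OF z N] by simp
    qed
    then have e: "norm (exp (- log_quot_error N z)) \<le> exp B"
      using complex_Re_le_cmod[of "- log_quot_error N z"] by simp
    have b: "norm (base z ^ N) = exp (real N * growth z)"
      by (simp add: norm_power norm_base[OF z'(2)] exp_of_nat_mult)
    have "norm (integrand l N z) = real N ^ N / (exp (real N) * fact N) / real N ^ l * norm (amplitude l z) *
       norm (correction l (z / of_nat N)) * norm (exp (- log_quot_error N z)) * norm (base z ^ N)"
      unfolding integrand_eq[OF z' N l] by (simp add: norm_mult norm_divide norm_power del: norm_exp_eq_Re)
    also have "\<dots> \<le> 1 / 1 * \<bar>Q\<bar> * \<bar>W\<bar> * exp B * exp (real N * growth z)"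
      unfolding b using n1 n2 Q[OF z] w e by (intro mult_mono frac_le) auto
    finally show "norm (integrand l N z) \<le> \<bar>Q\<bar> * \<bar>W\<bar> * exp B * exp (real N * growth z)" by simp
  qed simp
qed

text \<open>On a compact segment the continuous growth rate attains its maximum, so a strict
  pointwise inequality leaves a uniform gap \<open>\<delta>\<close>.\<close>

lemma segment_small:
  assumes seg: "closed_segment u v \<subseteq> slit_domain - {0}" and l: "l \<ge> 1"
    and g: "\<And>z. z \<in> closed_segment u v \<Longrightarrow> growth z < G"
  obtains M \<delta> where "M \<ge> 0" "\<delta> > 0"
     "\<And>N. N \<ge> 1 \<Longrightarrow> norm (contour_integral (linepath u v) (integrand l N)) \<le> M * exp (real N * (G - \<delta>))"
proof -
  obtain M where M: "M \<ge> 0" "\<And>z N. z \<in> closed_segment u v \<Longrightarrow> N \<ge> 1 \<Longrightarrow> norm (integrand l N z) \<le> M * exp (real N * growth z)"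
    using integrand_bound[OF compact_segment seg l] by metis
  obtain x where x: "x \<in> closed_segment u v" "\<And>y. y \<in> closed_segment u v \<Longrightarrow> growth y \<le> growth x"
    using continuous_attains_sup[OF compact_segment _ continuous_on_subset[OF continuous_on_growth seg]] by auto
  define \<delta> where "\<delta> = G - growth x"
  have \<delta>: "\<delta> > 0" using g[OF x(1)] by (simp add: \<delta>_def)
  show ?thesis
  proof (rule that[of "M * norm (v - u)" \<delta>])
    fix N :: nat assume N: "N \<ge> 1"
    have "norm (contour_integral (linepath u v) (integrand l N)) \<le> (M * exp (real N * (G - \<delta>))) * norm (v - u)"
    proof (rule contour_integral_bound_linepath)
      show "integrand l N contour_integrable_on linepath u v"
        using continuous_on_subset[OF continuous_on_integrand[OF N] seg] by (rule contour_integrable_continuous_linepath)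
      fix y assume y: "y \<in> closed_segment u v"
      have "norm (integrand l N y) \<le> M * exp (real N * growth y)" by (rule M(2)[OF y N])
      also have "\<dots> \<le> M * exp (real N * (G - \<delta>))"
        using M(1) x(2)[OF y] by (intro mult_left_mono) (auto simp: \<delta>_def intro!: mult_left_mono)
      finally show "norm (integrand l N y) \<le> M * exp (real N * (G - \<delta>))" .
    qed (use M in auto)
    then show "norm (contour_integral (linepath u v) (integrand l N)) \<le> M * norm (v - u) * exp (real N * (G - \<delta>))"
      by (simp add: mult_ac)
  qed (use M \<delta> in auto)
qed

text \<open>The integrand is real on the real axis, so the lower half of the contour can be
  expressed through the upper half.\<close>

lemma integrand_cnj: "integrand l N (cnj z) = cnj (integrand l N z)"
proof -
  have "cnj z / of_nat N = cnj (z / of_nat N)" "of_nat j * cnj z / of_nat N = cnj (of_nat j * z / of_nat N)" for j by simp_all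
  then show ?thesis unfolding integrand_def by (simp only: exp_cnj complex_cnj_mult complex_cnj_divide complex_cnj_diff complex_cnj_power cnj_prod complex_cnj_one complex_cnj_of_nat)
qed

lemma contour_integral_linepath_cnj:
  assumes "\<And>z. f (cnj z) = cnj (f z)"
  shows "contour_integral (linepath (cnj a) (cnj c)) f = cnj (contour_integral (linepath a c) f)"
proof -
  have "linepath (cnj a) (cnj c) t = cnj (linepath a c t)" for t
    by (simp add: linepath_def scaleR_conv_of_real)
  then have "contour_integral (linepath (cnj a) (cnj c)) f = integral {0..1} (\<lambda>t. cnj (f (linepath a c t) * (c - a)))"
    unfolding contour_integral_integral vector_derivative_linepath_at by (simp add: assms)
  also have "\<dots> = cnj (integral {0..1} (\<lambda>t. f (linepath a c t) * (c - a)))"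
    by (simp only: integral_cnj)
  finally show ?thesis unfolding contour_integral_integral by simp
qed

lemma closed_segment_horizontal:
  assumes "z \<in> closed_segment (Complex x1 y) (Complex x2 y)"
  shows "Im z = y" "min x1 x2 \<le> Re z"
proof -
  have "closed_segment (Complex x1 y) (Complex x2 y) \<subseteq> {z. Im z = y} \<inter> {z. Re z \<ge> min x1 x2}"
    by (rule closed_segment_subset)
       (auto intro!: convex_Int convex_halfspace_Re_ge simp: convex_hyperplane[of "\<i>", unfolded inner_complex_def, simplified])
  then show "Im z = y" "min x1 x2 \<le> Re z" using assms by auto
qed

lemma closed_segment_vertical:
  assumes "z \<in> closed_segment (Complex x y1) (Complex x y2)"
  shows "Re z = x"
proof -
  obtain u where "z = (1 - u) *\<^sub>R Complex x y1 + u *\<^sub>R Complex x y2"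
    using assms by (auto simp: closed_segment_def)
  then have "Re z = (1 - u) * x + u * x" by simp
  then show ?thesis by (simp add: algebra_simps)
qed

section \<open>The pieces of the contour\<close>

abbreviation "ray s \<equiv> of_real s * z0"
abbreviation "y\<^sub>0 \<equiv> 3 * pi / 2"

lemma ray_in_slit: "s > 0 \<Longrightarrow> ray s \<in> slit_domain - {0}"
  using Re_z0_neg by (auto simp: slit_domain_def)

lemma ray_segment:
  assumes "z \<in> closed_segment (ray c) (ray d)" "c \<le> d"
  obtains s where "c \<le> s" "s \<le> d" "z = ray s"
proof -
  obtain t where t: "0 \<le> t" "t \<le> 1" "z = (1 - t) *\<^sub>R (ray c) + t *\<^sub>R (ray d)"
    using assms(1) by (auto simp: closed_segment_def)
  have "z = of_real ((1 - t) * c + t * d) * z0" by (simp add: t(3) scaleR_conv_of_real algebra_simps)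
  moreover have "c \<le> (1 - t) * c + t * d" "(1 - t) * c + t * d \<le> d"
    using t assms(2) mult_left_mono[of c d t] mult_left_mono[of c d "1 - t"] by (simp_all add: algebra_simps)
  ultimately show ?thesis using that by blast
qed

lemma ray_in_segment:
  assumes "c \<le> s" "s \<le> d"
  shows "ray s \<in> closed_segment (ray c) (ray d)"
proof -
  have "linear (\<lambda>s. ray s)" by (intro linearI) (auto simp: algebra_simps scaleR_conv_of_real)
  then have "closed_segment (ray c) (ray d) = (\<lambda>s. ray s) ` closed_segment c d"
    by (rule closed_segment_linear_image)
  then show ?thesis using assms by (auto simp: closed_segment_eq_real_ivl)
qed

lemma ray_segment_slit:
  assumes "0 < c" "c \<le> d"
  shows "closed_segment (ray c) (ray d) \<subseteq> slit_domain - {0}"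
proof
  fix z assume "z \<in> closed_segment (ray c) (ray d)"
  then obtain s where "c \<le> s" "z = ray s" using assms by (elim ray_segment) auto
  then show "z \<in> slit_domain - {0}" using ray_in_slit[of s] assms by simp
qed

lemma ray_s1: "ray s1 = Complex (s1 * Re z0) y\<^sub>0"
  using s1_bounds(3) by (simp add: complex_eq_iff)

lemma horizontal_segment:
  assumes "z \<in> closed_segment (Complex 4 y\<^sub>0) (ray s1)"
  shows "z \<in> slit_domain - {0}" "growth z < growth z0" "Im z > 0"
proof -
  have "s1 * Re z0 \<le> 4" using s1_bounds(1) Re_z0_neg mult_pos_neg[of s1 "Re z0"] by simp
  then have "Im z = y\<^sub>0" "s1 * Re z0 \<le> Re z"
    using closed_segment_horizontal[of z 4 y\<^sub>0 "s1 * Re z0"] assms unfolding ray_s1 by auto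
  then have "z = Complex (Re z) y\<^sub>0" by (simp add: complex_eq_iff)
  then show "growth z < growth z0" using growth_horizontal_line[of "Re z"] \<open>s1 * Re z0 \<le> Re z\<close> by metis
  show "Im z > 0" using \<open>Im z = y\<^sub>0\<close> pi_gt_zero by linarith
  moreover have "\<bar>Im z\<bar> < 2 * pi" using \<open>Im z = y\<^sub>0\<close> pi_gt_zero by linarith
  ultimately show "z \<in> slit_domain - {0}" by (auto simp: slit_domain_def)
qed

lemma right_segment:
  assumes "z \<in> closed_segment (Complex 4 (- y\<^sub>0)) (Complex 4 y\<^sub>0)"
  shows "z \<in> slit_domain - {0}" "growth z < growth z0" "Re z > 0"
  using closed_segment_vertical[OF assms] growth_right[of z] by (auto simp: slit_domain_def)

text \<open>The factor 20 is large enough for 20 Re z0 <= -32, the threshold in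
  \<open>growth_left\<close>.\<close>

lemma left_segment:
  assumes "z \<in> closed_segment (ray 20) (cnj (ray 20))"
  shows "z \<in> slit_domain - {0}" "growth z < growth z0" "Re z < 0"
proof -
  have e1: "ray 20 = Complex (20 * Re z0) (20 * Im z0)" and e2: "cnj (ray 20) = Complex (20 * Re z0) (- (20 * Im z0))"
    by (simp_all add: complex_eq_iff)
  have "Re z = 20 * Re z0"
    by (rule closed_segment_vertical[OF assms[unfolded e2, unfolded e1]])
  then have Re: "Re z \<le> - 32" using z0_bounds(2) by simp
  then show "z \<in> slit_domain - {0}" "Re z < 0" by (auto simp: slit_domain_def)
  show "growth z < growth z0" using Re by (rule growth_left)
qed

lemma cnj_closed_segment: "z \<in> closed_segment (cnj a) (cnj c) \<longleftrightarrow> cnj z \<in> closed_segment a c"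
proof -
  have "closed_segment (cnj a) (cnj c) = cnj ` closed_segment a c"
    by (rule closed_segment_linear_image[symmetric, OF bounded_linear.linear[OF bounded_linear_cnj], symmetric])
  then show ?thesis by (metis (no_types, lifting) complex_cnj_cnj image_iff)
qed

text \<open>The contour is symmetric about the real axis: right edge $\mathrm{Re}\,z = 4$, then left along
  $\mathrm{Im}\,z = 3\pi/2$ up to the ray through $z_0$, along that ray to $20 z_0$, and a vertical left edge.\<close>

lemma C_eq_segments:
  assumes N: "N \<ge> 1" "N \<ge> l" and l: "l \<ge> 1"
  defines "I \<equiv> \<lambda>u v. contour_integral (linepath u v) (integrand l N)"
  shows "2 * of_real pi * \<i> * C 0 1 l N =
     (I (Complex 4 (- y\<^sub>0)) (Complex 4 y\<^sub>0) + I (ray 20) (cnj (ray 20))) +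
     (I (Complex 4 y\<^sub>0) (ray s1) - cnj (I (Complex 4 y\<^sub>0) (ray s1))) +
     (I (ray s1) (ray 20) - cnj (I (ray s1) (ray 20)))"
proof -
  let ?D = "Complex 4 y\<^sub>0" and ?E = "ray s1" and ?F = "ray 20"
  have cD: "Complex 4 (- y\<^sub>0) = cnj ?D" by (simp add: complex_eq_iff)
  have s120: "0 < s1" "s1 \<le> 20" using s1_bounds by auto
  have EF: "z \<in> slit_domain - {0}" "Im z > 0" if z: "z \<in> closed_segment ?E ?F" for z
  proof -
    show "z \<in> slit_domain - {0}" using ray_segment_slit[OF s120] z by blast
    obtain s where "s1 \<le> s" "z = ray s" using z s120 by (elim ray_segment) auto
    then show "Im z > 0" using s1_bounds(1) Im_z0_pos by simp
  qed
  have cnjs: "\<exists>w\<in>closed_segment ?E ?F. z = cnj w" if "z \<in> closed_segment (cnj ?F) (cnj ?E)" for z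
    using that unfolding cnj_closed_segment closed_segment_commute[of ?F ?E] by (intro bexI[of _ "cnj z"]) auto
  have cnjs': "\<exists>w\<in>closed_segment ?D ?E. z = cnj w" if "z \<in> closed_segment (cnj ?E) (cnj ?D)" for z
    using that unfolding cnj_closed_segment closed_segment_commute[of ?E ?D] by (intro bexI[of _ "cnj z"]) auto
  have slit: "closed_segment (cnj ?F) (cnj ?E) \<subseteq> slit_domain - {0}" "closed_segment (cnj ?E) (cnj ?D) \<subseteq> slit_domain - {0}"
    "closed_segment (cnj ?D) ?D \<subseteq> slit_domain - {0}" "closed_segment ?D ?E \<subseteq> slit_domain - {0}"
    "closed_segment ?E ?F \<subseteq> slit_domain - {0}" "closed_segment ?F (cnj ?F) \<subseteq> slit_domain - {0}"
  proof -
    show "closed_segment (cnj ?F) (cnj ?E) \<subseteq> slit_domain - {0}"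
      using cnjs EF(1) slit_domain_cnj by fastforce
    show "closed_segment (cnj ?E) (cnj ?D) \<subseteq> slit_domain - {0}"
      using cnjs' horizontal_segment(1) slit_domain_cnj by fastforce
    show "closed_segment (cnj ?D) ?D \<subseteq> slit_domain - {0}" using right_segment(1) unfolding cD by blast
    show "closed_segment ?D ?E \<subseteq> slit_domain - {0}" using horizontal_segment(1) by blast
    show "closed_segment ?E ?F \<subseteq> slit_domain - {0}" using EF(1) by blast
    show "closed_segment ?F (cnj ?F) \<subseteq> slit_domain - {0}" using left_segment(1) by blast
  qed
  \<comment> \<open>All pieces but the left edge avoid the negative real axis, so the principal
    logarithm is a primitive of 1/z along them.\<close>
  have notneg: "closed_segment (cnj ?F) (cnj ?E) \<subseteq> - \<real>\<^sub>\<le>\<^sub>0" "closed_segment (cnj ?E) (cnj ?D) \<subseteq> - \<real>\<^sub>\<le>\<^sub>0"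
    "closed_segment (cnj ?D) ?D \<subseteq> - \<real>\<^sub>\<le>\<^sub>0" "closed_segment ?D ?E \<subseteq> - \<real>\<^sub>\<le>\<^sub>0" "closed_segment ?E ?F \<subseteq> - \<real>\<^sub>\<le>\<^sub>0"
  proof -
    show "closed_segment (cnj ?F) (cnj ?E) \<subseteq> - \<real>\<^sub>\<le>\<^sub>0"
      using cnjs EF(2) by (fastforce simp: complex_nonpos_Reals_iff)
    show "closed_segment (cnj ?E) (cnj ?D) \<subseteq> - \<real>\<^sub>\<le>\<^sub>0"
      using cnjs' horizontal_segment(3) by (fastforce simp: complex_nonpos_Reals_iff)
    show "closed_segment (cnj ?D) ?D \<subseteq> - \<real>\<^sub>\<le>\<^sub>0" using right_segment(3) unfolding cD by (fastforce simp: complex_nonpos_Reals_iff)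
    show "closed_segment ?D ?E \<subseteq> - \<real>\<^sub>\<le>\<^sub>0" using horizontal_segment(3) by (fastforce simp: complex_nonpos_Reals_iff)
    show "closed_segment ?E ?F \<subseteq> - \<real>\<^sub>\<le>\<^sub>0" using EF(2) by (fastforce simp: complex_nonpos_Reals_iff)
  qed
  define g1 where "g1 = linepath (cnj ?F) (cnj ?E) +++ linepath (cnj ?E) (cnj ?D) +++ linepath (cnj ?D) ?D +++ linepath ?D ?E +++ linepath ?E ?F"
  have g1: "valid_path g1" "pathstart g1 = cnj ?F" "pathfinish g1 = ?F"
    by (simp_all add: g1_def valid_path_join)
  have img1: "path_image g1 \<subseteq> A" if "closed_segment (cnj ?F) (cnj ?E) \<subseteq> A" "closed_segment (cnj ?E) (cnj ?D) \<subseteq> A"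
     "closed_segment (cnj ?D) ?D \<subseteq> A" "closed_segment ?D ?E \<subseteq> A" "closed_segment ?E ?F \<subseteq> A" for A
    using that unfolding g1_def by (intro subset_path_image_join; simp only: path_image_linepath)
  define g where "g = g1 +++ linepath ?F (cnj ?F)"
  have g: "valid_path g" "pathfinish g = pathstart g" "path_image g \<subseteq> slit_domain - {0}"
  proof -
    show "valid_path g" unfolding g_def by (intro valid_path_join g1(1); simp add: g1)
    show "pathfinish g = pathstart g" by (simp add: g_def g1)
    show "path_image g \<subseteq> slit_domain - {0}" unfolding g_def
      by (intro subset_path_image_join img1 slit; simp only: path_image_linepath slit)
  qed
  have w1: "((\<lambda>z. 1 / z) has_contour_integral Ln ?F - Ln (cnj ?F)) g1"
  proof -
    have "((\<lambda>z. 1 / z) has_contour_integral Ln (pathfinish g1) - Ln (pathstart g1)) g1"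
    proof (rule contour_integral_primitive[of "- \<real>\<^sub>\<le>\<^sub>0"])
      fix x :: complex assume "x \<in> - \<real>\<^sub>\<le>\<^sub>0"
      then show "(Ln has_field_derivative 1 / x) (at x within - \<real>\<^sub>\<le>\<^sub>0)"
        using has_field_derivative_Ln[of x] by (auto simp: inverse_eq_divide intro: has_field_derivative_at_within)
    qed (use g1 img1[OF notneg] in auto)
    then show ?thesis by (simp add: g1)
  qed
  \<comment> \<open>The left edge crosses the negative real axis but lies in the left half plane,
    where Ln(-z) is a primitive of 1/z.\<close>
  have w2: "((\<lambda>z. 1 / z) has_contour_integral Ln (- cnj ?F) - Ln (- ?F)) (linepath ?F (cnj ?F))"
  proof -
    have "((\<lambda>z. 1 / z) has_contour_integral (\<lambda>z. Ln (- z)) (pathfinish (linepath ?F (cnj ?F))) - (\<lambda>z. Ln (- z)) (pathstart (linepath ?F (cnj ?F)))) (linepath ?F (cnj ?F))"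
    proof (rule contour_integral_primitive[of "{z. Re z < 0}"])
      fix x :: complex assume "x \<in> {z. Re z < 0}"
      then have x: "- x \<notin> \<real>\<^sub>\<le>\<^sub>0" "x \<noteq> 0" by (auto simp: complex_nonpos_Reals_iff)
      have "((\<lambda>z. Ln (- z)) has_field_derivative inverse (- x) * (- 1)) (at x)"
        by (rule DERIV_chain2[where f = Ln]) (auto intro!: derivative_eq_intros has_field_derivative_Ln x)
      then show "((\<lambda>z. Ln (- z)) has_field_derivative 1 / x) (at x within {z. Re z < 0})"
        using x by (auto simp: inverse_eq_divide intro: has_field_derivative_at_within)
    qed (use left_segment(3) in auto)
    then show ?thesis by simp
  qed
  have "((\<lambda>z. 1 / z) has_contour_integral (Ln ?F - Ln (cnj ?F)) + (Ln (- cnj ?F) - Ln (- ?F))) g"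
    unfolding g_def by (intro has_contour_integral_join w1 w2 g1 valid_path_linepath; simp add: g1)
  \<comment> \<open>The two primitives differ by i pi in the upper and by - i pi in the lower half
    plane; the jumps add up to one full turn.\<close>
  also have "(Ln ?F - Ln (cnj ?F)) + (Ln (- cnj ?F) - Ln (- ?F)) = 2 * of_real pi * \<i>"
  proof -
    have "Im ?F > 0" "Im (cnj ?F) < 0" "?F \<noteq> 0" "cnj ?F \<noteq> 0" using Im_z0_pos by auto
    then have "Ln (- ?F) = Ln ?F - \<i> * of_real pi" "Ln (- cnj ?F) = Ln (cnj ?F) + \<i> * of_real pi"
      using Ln_minus[of ?F] Ln_minus[of "cnj ?F"] by auto
    then show ?thesis by (simp add: algebra_simps)
  qed
  finally have wind: "((\<lambda>z. 1 / z) has_contour_integral 2 * of_real pi * \<i>) g" .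
  have main: "(integrand l N has_contour_integral 2 * of_real pi * \<i> * C 0 1 l N) g"
    by (rule contour_integral_integrand[OF g wind N l])
  have hI: "(integrand l N has_contour_integral I u v) (linepath u v)" if "closed_segment u v \<subseteq> slit_domain - {0}" for u v
    unfolding I_def using continuous_on_subset[OF continuous_on_integrand[OF N(1)] that]
    by (intro has_contour_integral_integral contour_integrable_continuous_linepath)
  have "(integrand l N has_contour_integral (I (cnj ?F) (cnj ?E) + (I (cnj ?E) (cnj ?D) + (I (cnj ?D) ?D + (I ?D ?E + I ?E ?F)))) + I ?F (cnj ?F)) g"
    unfolding g_def g1_def by (intro has_contour_integral_join hI slit valid_path_join valid_path_linepath; simp)
  from has_contour_integral_unique[OF main this]
  have "2 * of_real pi * \<i> * C 0 1 l N = (I (cnj ?F) (cnj ?E) + (I (cnj ?E) (cnj ?D) + (I (cnj ?D) ?D + (I ?D ?E + I ?E ?F)))) + I ?F (cnj ?F)" .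
  \<comment> \<open>A lower piece is the conjugate of an upper one traversed backwards, hence the
    sign.\<close>
  also have "I (cnj ?F) (cnj ?E) = - cnj (I ?E ?F)"
  proof -
    have "I (cnj ?F) (cnj ?E) = cnj (I ?F ?E)" unfolding I_def by (rule contour_integral_linepath_cnj[where f = "integrand l N", OF integrand_cnj])
    also have "I ?F ?E = - I ?E ?F"
      unfolding I_def using continuous_on_subset[OF continuous_on_integrand[OF N(1)] slit(5)]
      by (intro contour_integral_reverse_linepath) (simp add: closed_segment_commute)
    finally show ?thesis by simp
  qed
  also have "I (cnj ?E) (cnj ?D) = - cnj (I ?D ?E)"
  proof -
    have "I (cnj ?E) (cnj ?D) = cnj (I ?E ?D)" unfolding I_def by (rule contour_integral_linepath_cnj[where f = "integrand l N", OF integrand_cnj])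
    also have "I ?E ?D = - I ?D ?E"
      unfolding I_def using continuous_on_subset[OF continuous_on_integrand[OF N(1)] slit(4)]
      by (intro contour_integral_reverse_linepath) (simp add: closed_segment_commute)
    finally show ?thesis by simp
  qed
  finally show ?thesis unfolding cD by simp
qed

section \<open>The contribution of the saddle point\<close>

definition phase :: "complex \<Rightarrow> complex" where
  "phase z = (Li2 (exp z) - of_real (pi ^ 2 / 6)) / z"

text \<open>The derivative of \<open>phase\<close>, written so that it visibly vanishes at
  \<open>z0\<close>: the equation of \<open>z0\<close> says that \<open>phase z0\<close> equals -
  Ln(1 - e^(z0)).\<close>

definition phase1 :: "complex \<Rightarrow> complex" where
  "phase1 z = - (Ln (1 - exp z) + phase z) / z"

definition phase2 :: "complex \<Rightarrow> complex" where
  "phase2 z = (exp z / (1 - exp z) - 2 * phase1 z) / z"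

lemma base_eq_exp_phase:
  assumes "Re z < 0"
  shows "base z = exp (phase z)"
proof -
  have z: "z \<noteq> 0" using assms by auto
  have "1 - log_quot_prim z / z = phase z + Ln (- z)"
    unfolding log_quot_prim_eq_Li2[OF assms] phase_def using z by (simp add: field_simps)
  then show ?thesis unfolding base_def using z by (simp add: exp_add)
qed

lemma phase_deriv:
  assumes "Re z < 0"
  shows "(phase has_field_derivative phase1 z) (at z)"
proof -
  note lh = left_half_plane[OF assms]
  have "((\<lambda>z. Li2 (exp z)) has_field_derivative (- Ln (1 - exp z) / exp z) * exp z) (at z)"
    by (rule DERIV_chain2[where f = Li2]) (rule Li2_deriv[OF lh(2)] DERIV_exp exp_not_eq_zero)+
  then have "((\<lambda>z. (Li2 (exp z) - of_real (pi ^ 2 / 6)) / z) has_field_derivative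
      (((- Ln (1 - exp z) / exp z) * exp z - 0) * z - (Li2 (exp z) - of_real (pi ^ 2 / 6)) * 1) / (z * z)) (at z)"
    by (intro DERIV_divide DERIV_diff DERIV_const DERIV_ident lh)
  also have "(((- Ln (1 - exp z) / exp z) * exp z - 0) * z - (Li2 (exp z) - of_real (pi ^ 2 / 6)) * 1) / (z * z) = phase1 z"
    unfolding phase1_def phase_def using lh(1) by (simp add: field_simps)
  finally show ?thesis unfolding phase_def[abs_def] .
qed

lemma phase1_deriv:
  assumes "Re z < 0"
  shows "(phase1 has_field_derivative phase2 z) (at z)"
proof -
  note lh = left_half_plane[OF assms]
  have "((\<lambda>z. Ln (1 - exp z)) has_field_derivative inverse (1 - exp z) * (0 - exp z)) (at z)"
    by (rule DERIV_chain2[where f = Ln]) (intro has_field_derivative_Ln lh DERIV_diff DERIV_const DERIV_exp)+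
  then have "((\<lambda>z. - (Ln (1 - exp z) + phase z) / z) has_field_derivative
      (- (inverse (1 - exp z) * (0 - exp z) + phase1 z) * z - (- (Ln (1 - exp z) + phase z)) * 1) / (z * z)) (at z)"
    by (intro DERIV_divide DERIV_minus DERIV_add phase_deriv DERIV_ident lh assms)
  also have "(- (inverse (1 - exp z) * (0 - exp z) + phase1 z) * z - (- (Ln (1 - exp z) + phase z)) * 1) / (z * z) = phase2 z"
  proof -
    have "- (Ln (1 - exp z) + phase z) = phase1 z * z" unfolding phase1_def using lh(1) by simp
    then have "(- (inverse (1 - exp z) * (0 - exp z) + phase1 z) * z - (- (Ln (1 - exp z) + phase z)) * 1)
       = (inverse (1 - exp z) * exp z - 2 * phase1 z) * z" by (simp add: algebra_simps)
    then show ?thesis unfolding phase2_def using lh(1) by (simp add: divide_inverse mult_ac)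
  qed
  finally show ?thesis unfolding phase1_def[abs_def] .
qed

lemma holomorphic_phase2: "phase2 holomorphic_on {z. Re z < 0}"
proof -
  have "phase1 holomorphic_on {z. Re z < 0}"
    using phase1_deriv by (auto simp: holomorphic_on_def field_differentiable_def intro: has_field_derivative_at_within)
  then show ?thesis unfolding phase2_def
    by (intro holomorphic_intros) (auto dest: left_half_plane)
qed

lemma phase_z0: "phase z0 = - Ln (1 - exp z0)" "phase1 z0 = 0" "phase2 z0 = exp z0 / (1 - exp z0) / z0"
proof -
  show p: "phase z0 = - Ln (1 - exp z0)"
    using z0_eq unfolding phase_def by (simp add: divide_eq_eq) (simp add: algebra_simps eq_neg_iff_add_eq_0)
  then show "phase1 z0 = 0" by (simp add: phase1_def)
  then show "phase2 z0 = exp z0 / (1 - exp z0) / z0" by (simp add: phase2_def)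
qed

text \<open>Normalised so that \<open>phase (ray (1 + v)) = phase z0 - curvature * v\<^sup>2 + O(v\<^sup>3)\<close>.\<close>

definition curvature :: complex where
  "curvature = - (z0 * exp z0 / (1 - exp z0)) / 2"

text \<open>Positivity makes the integrand peak like a Gaussian along the ray. With w = e^(z0), it
  holds because Im z0 and Im w are positive while Re z0 is negative and |w|^2 < Re w.\<close>

lemma Re_curvature: "Re curvature > 0"
proof -
  define w where "w = exp z0"
  have nz: "norm (1 - w) > 0" using left_half_plane(4)[OF Re_z0_neg] by (simp add: w_def)
  have wb: "2/25 < Re w" "Re w < 43/500" "9/50 < Im w" "Im w < 23/125" using z0_bounds by (auto simp: w_def)
  have "(Re w)\<^sup>2 \<le> (43/500)\<^sup>2" "(Im w)\<^sup>2 \<le> (23/125)\<^sup>2" using wb by (auto intro!: power_mono)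
  then have "(Re w)\<^sup>2 + (Im w)\<^sup>2 < Re w" using wb by (simp add: power2_eq_square)
  then have "- Re z0 * (Re w - ((Re w)\<^sup>2 + (Im w)\<^sup>2)) > 0" using Re_z0_neg by (intro mult_pos_pos) auto
  moreover have "Im z0 * Im w > 0" using wb Im_z0_pos by simp
  ultimately have pos: "Im z0 * Im w - Re z0 * (Re w - ((Re w)\<^sup>2 + (Im w)\<^sup>2)) > 0" by simp
  have "Re (z0 * w / (1 - w)) = (Re z0 * (Re w - ((Re w)\<^sup>2 + (Im w)\<^sup>2)) - Im z0 * Im w) / (norm (1 - w))\<^sup>2"
    unfolding Re_divide cmod_power2[of "1 - w"] by (simp add: power2_eq_square algebra_simps)
  moreover have "(Re z0 * (Re w - ((Re w)\<^sup>2 + (Im w)\<^sup>2)) - Im z0 * Im w) / (norm (1 - w))\<^sup>2 < 0"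
    using pos nz by (intro divide_neg_pos) auto
  moreover have "Re (- X / 2) = - Re X / 2" for X by simp
  ultimately show ?thesis unfolding curvature_def w_def[symmetric] by (metis half_gt_zero neg_0_less_iff_less)
qed

lemma holomorphic_lipschitz:
  assumes f: "f holomorphic_on S" "open S" and K: "compact K" "convex K" "K \<subseteq> S"
  obtains L where "L \<ge> 0" "\<And>x y. x \<in> K \<Longrightarrow> y \<in> K \<Longrightarrow> norm (f x - f y) \<le> L * norm (x - y)"
proof -
  have "compact (deriv f ` K)"
    using f K by (intro compact_continuous_image holomorphic_on_imp_continuous_on[OF holomorphic_on_subset[OF holomorphic_deriv]]) auto
  then obtain L where L: "\<And>x. x \<in> K \<Longrightarrow> norm (deriv f x) \<le> L"
    using compact_imp_bounded by (fastforce simp: bounded_iff)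
  show ?thesis
  proof (rule that[of "\<bar>L\<bar>"])
    fix x y assume xy: "x \<in> K" "y \<in> K"
    show "norm (f x - f y) \<le> \<bar>L\<bar> * norm (x - y)"
    proof (rule field_differentiable_bound[OF K(2) _ _ xy])
      fix z assume z: "z \<in> K"
      show "(f has_field_derivative deriv f z) (at z within K)"
        using holomorphic_derivI[OF f] z K by (blast intro: has_field_derivative_at_within)
      show "norm (deriv f z) \<le> \<bar>L\<bar>" using L[OF z] by simp
    qed
  qed simp
qed

lemma contour_integral_linepath_ray:
  assumes cont: "continuous_on (closed_segment (of_real (1 - \<eta>) * w) (of_real (1 + \<eta>) * w)) f" and \<eta>: "\<eta> > 0"
  shows "contour_integral (linepath (of_real (1 - \<eta>) * w) (of_real (1 + \<eta>) * w)) f =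
    w * integral {-\<eta>..\<eta>} (\<lambda>v. f (of_real (1 + v) * w))"
proof -
  have mem: "of_real (1 + v) * w \<in> closed_segment (of_real (1 - \<eta>) * w) (of_real (1 + \<eta>) * w)" if "v \<in> {-\<eta>..\<eta>}" for v
  proof -
    define u where "u = (v + \<eta>) / (2 * \<eta>)"
    have "0 \<le> u" "u \<le> 1" and vu: "v = 2 * \<eta> * u - \<eta>" using that \<eta> by (auto simp: u_def field_simps)
    moreover have "of_real (1 + v) * w = (1 - u) *\<^sub>R (of_real (1 - \<eta>) * w) + u *\<^sub>R (of_real (1 + \<eta>) * w)"
    proof -
      have "of_real v = (2 * of_real \<eta> * of_real u - of_real \<eta> :: complex)" unfolding vu by simp
      then have "of_real (1 + v) * w = (1 + (2 * of_real \<eta> * of_real u - of_real \<eta>)) * w" by simp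
      also have "\<dots> = (1 - u) *\<^sub>R (of_real (1 - \<eta>) * w) + u *\<^sub>R (of_real (1 + \<eta>) * w)"
        by (simp add: scaleR_conv_of_real algebra_simps)
      finally show ?thesis .
    qed
    ultimately show ?thesis unfolding closed_segment_def by blast
  qed
  have "(\<lambda>v. f (of_real (1 + v) * w)) integrable_on {-\<eta>..\<eta>}"
    using mem by (intro integrable_continuous_interval continuous_on_compose2[OF cont] continuous_intros) auto
  then have "((\<lambda>v. f (of_real (1 + v) * w)) has_integral integral {-\<eta>..\<eta>} (\<lambda>v. f (of_real (1 + v) * w))) (cbox (-\<eta>) \<eta>)"
    by (simp add: integrable_integral)
  from has_integral_affinity[OF this, of "2 * \<eta>" "-\<eta>"] \<eta>
  have "((\<lambda>t. f (of_real (1 + (2 * \<eta> * t - \<eta>)) * w)) has_integral (1 / (2 * \<eta>)) *\<^sub>R integral {-\<eta>..\<eta>} (\<lambda>v. f (of_real (1 + v) * w)))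
     ((\<lambda>x. (1 / (2 * \<eta>)) *\<^sub>R x + - ((1 / (2 * \<eta>)) *\<^sub>R (- \<eta>))) ` cbox (-\<eta>) \<eta>)" by simp
  also have "(\<lambda>x. (1 / (2 * \<eta>)) *\<^sub>R x + - ((1 / (2 * \<eta>)) *\<^sub>R (- \<eta>))) ` cbox (-\<eta>) \<eta> = {0..1}"
    using \<eta> image_affinity_atLeastAtMost[of "1 / (2 * \<eta>)" "1/2" "-\<eta>" \<eta>] by simp
  finally have "((\<lambda>t. f (of_real (1 + (2 * \<eta> * t - \<eta>)) * w) * (2 * of_real \<eta> * w)) has_integral
      ((1 / (2 * \<eta>)) *\<^sub>R integral {-\<eta>..\<eta>} (\<lambda>v. f (of_real (1 + v) * w))) * (2 * of_real \<eta> * w)) {0..1}"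
    by (rule has_integral_mult_left)
  moreover have "of_real (1 + (2 * \<eta> * t - \<eta>)) * w = linepath (of_real (1 - \<eta>) * w) (of_real (1 + \<eta>) * w) t" for t
    by (simp add: linepath_def scaleR_conv_of_real algebra_simps)
  moreover have "2 * of_real \<eta> * w = of_real (1 + \<eta>) * w - of_real (1 - \<eta>) * w" by (simp add: algebra_simps)
  moreover have "((1 / (2 * \<eta>)) *\<^sub>R J) * (2 * of_real \<eta> * w) = w * J" for J
    using \<eta> by (simp add: scaleR_conv_of_real)
  ultimately have "((\<lambda>t. f (linepath (of_real (1 - \<eta>) * w) (of_real (1 + \<eta>) * w) t) * (of_real (1 + \<eta>) * w - of_real (1 - \<eta>) * w)) has_integral
      w * integral {-\<eta>..\<eta>} (\<lambda>v. f (of_real (1 + v) * w))) {0..1}" by simp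
  then have "(f has_contour_integral w * integral {-\<eta>..\<eta>} (\<lambda>v. f (of_real (1 + v) * w))) (linepath (of_real (1 - \<eta>) * w) (of_real (1 + \<eta>) * w))"
    by (simp only: has_contour_integral_linepath)
  then show ?thesis by (rule contour_integral_unique)
qed

lemma ray_in_half_segment:
  assumes "\<bar>v\<bar> \<le> 1/4"
  shows "ray (1 + v) \<in> closed_segment (ray (3/4)) (ray (5/4))"
  using assms by (intro ray_in_segment) (auto simp: abs_le_iff)

text \<open>Taylor's formula of second order along the ray. The linear term is absent because
  \<open>z0\<close> is a critical point, and the quadratic one is z0^2 \<open>phase2 z0\<close> / 2
  = - \<open>curvature\<close>.\<close>

lemma phase_expansion:
  obtains M where "M \<ge> 0" "\<And>v. \<bar>v\<bar> \<le> 1/4 \<Longrightarrow>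
    norm (phase (ray (1 + v)) - phase z0 + curvature * (of_real v)\<^sup>2) \<le> M * \<bar>v\<bar> ^ 3"
proof -
  let ?S = "closed_segment (ray (3/4)) (ray (5/4))"
  have neg: "Re z < 0" if z: "z \<in> ?S" for z
  proof -
    obtain s where "3/4 \<le> s" "z = ray s" using z by (elim ray_segment) auto
    then show ?thesis using Re_z0_neg by (simp add: mult_pos_neg)
  qed
  have op: "open {z. Re z < 0}" by (rule open_halfspace_Re_lt)
  have "compact (deriv phase2 ` ?S)"
    using neg op by (intro compact_continuous_image holomorphic_on_imp_continuous_on[OF holomorphic_on_subset[OF holomorphic_deriv[OF holomorphic_phase2]]]) auto
  then obtain B where B: "\<And>x. x \<in> ?S \<Longrightarrow> norm (deriv phase2 x) \<le> B"
    using compact_imp_bounded by (fastforce simp: bounded_iff)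
  show ?thesis
  proof (rule that[of "\<bar>B\<bar> * norm z0 ^ 3 / 2"])
    fix v :: real assume v: "\<bar>v\<bar> \<le> 1/4"
    define f where "f = (\<lambda>i::nat. if i = 0 then phase else if i = 1 then phase1 else if i = 2 then phase2 else deriv phase2)"
    have T: "cmod (f 0 (ray (1 + v)) - (\<Sum>i\<le>2. f i z0 * (ray (1 + v) - z0) ^ i / fact i)) \<le> \<bar>B\<bar> * cmod (ray (1 + v) - z0) ^ Suc 2 / fact 2"
    proof (rule complex_Taylor[of ?S])
      fix i x assume x: "x \<in> ?S" and i: "i \<le> (2::nat)"
      have "(phase2 has_field_derivative deriv phase2 x) (at x)"
        using holomorphic_derivI[OF holomorphic_phase2 op] neg[OF x] by simp
      then show "(f i has_field_derivative f (Suc i) x) (at x within ?S)"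
        using i phase_deriv[OF neg[OF x]] phase1_deriv[OF neg[OF x]]
        by (auto simp: f_def le_Suc_eq numeral_2_eq_2 intro: has_field_derivative_at_within)
    next
      fix x assume "x \<in> ?S"
      then show "cmod (f (Suc 2) x) \<le> \<bar>B\<bar>" using B[of x] by (simp add: f_def)
    qed (use ray_in_half_segment[of v] ray_in_half_segment[of 0] v in auto)
    have d: "ray (1 + v) - z0 = of_real v * z0" by (simp add: algebra_simps)
    have sum: "(\<Sum>i\<le>2. f i z0 * (of_real v * z0) ^ i / fact i) = phase z0 - curvature * (of_real v)\<^sup>2"
      by (simp add: numeral_2_eq_2 f_def phase_z0 curvature_def; simp add: power2_eq_square field_simps)
    show "norm (phase (ray (1 + v)) - phase z0 + curvature * (of_real v)\<^sup>2) \<le> \<bar>B\<bar> * norm z0 ^ 3 / 2 * \<bar>v\<bar> ^ 3"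
    proof -
      have "norm (of_real v * z0) ^ Suc 2 = \<bar>v\<bar> ^ 3 * norm z0 ^ 3"
        by (simp only: norm_mult norm_of_real power_mult_distrib; simp?)
      moreover have eqn: "phase (ray (1 + v)) - phase z0 + c = phase (ray (1 + v)) - (phase z0 - c)" for c by simp
      ultimately show ?thesis using T[unfolded d sum] unfolding eqn by (simp add: f_def mult_ac)
    qed
  qed simp
qed

text \<open>The amplitude is Lipschitz along the ray, which gives the term |v|. The two remaining
  factors differ from 1 by O(1/N): one is evaluated at z/N, and the exponent of the other is the
  trapezoidal error.\<close>

lemma amplitude_correction_bound:
  assumes l: "l \<ge> 1"
  obtains B where "B \<ge> 0" "\<And>N v. N \<ge> 1 \<Longrightarrow> \<bar>v\<bar> \<le> 1/4 \<Longrightarrow>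
    norm (amplitude l (ray (1 + v)) * correction l (ray (1 + v) / of_nat N) * exp (- log_quot_error N (ray (1 + v))) - amplitude l z0)
      \<le> B * (\<bar>v\<bar> + 1 / real N)"
proof -
  let ?S = "closed_segment (ray (3/4)) (ray (5/4))"
  have S: "?S \<subseteq> slit_domain - {0}" by (rule ray_segment_slit) auto
  obtain La where La: "La \<ge> 0" "\<And>x y. x \<in> ?S \<Longrightarrow> y \<in> ?S \<Longrightarrow> norm (amplitude l x - amplitude l y) \<le> La * norm (x - y)"
    using holomorphic_lipschitz[OF holomorphic_amplitude open_slit_domain compact_segment convex_closed_segment, of "ray (3/4)" "ray (5/4)" l] S by blast
  define R where "R = 2 * norm z0"
  obtain Lc where Lc: "Lc \<ge> 0" "\<And>x y. x \<in> cball 0 R \<Longrightarrow> y \<in> cball 0 R \<Longrightarrow> norm (correction l x - correction l y) \<le> Lc * norm (x - y)"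
    using holomorphic_lipschitz[OF holomorphic_correction open_UNIV compact_cball convex_cball subset_UNIV] by metis
  obtain B1 where B1: "B1 \<ge> 0" "\<And>z N. z \<in> ?S \<Longrightarrow> N \<ge> 1 \<Longrightarrow> norm (log_quot_error N z) \<le> B1 / real N"
    using log_quot_error_bound[OF compact_segment S] by blast
  define q where "q = norm (amplitude l z0)"
  define Cc where "Cc = 1 + Lc * R"
  define B where "B = La * norm z0 * Cc * exp B1 + q * (Lc * R * exp B1 + B1 * exp B1)"
  have R0: "R \<ge> 0" by (simp add: R_def)
  have q0: "q \<ge> 0" by (simp add: q_def)
  have Cc1: "Cc \<ge> 0" using Lc R0 by (simp add: Cc_def)
  show ?thesis
  proof (rule that[of B])
    show "B \<ge> 0" unfolding B_def using La Lc B1 R0 q0 Cc1 by (intro add_nonneg_nonneg mult_nonneg_nonneg) auto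
    fix N :: nat and v :: real assume N: "N \<ge> 1" and v: "\<bar>v\<bar> \<le> 1/4"
    define z where "z = ray (1 + v)"
    define c where "c = correction l (z / of_nat N)"
    define e where "e = exp (- log_quot_error N z)"
    have zS: "z \<in> ?S" "z0 \<in> ?S" using ray_in_half_segment[OF v] ray_in_half_segment[of 0] by (auto simp: z_def)
    have nz: "norm z \<le> R"
    proof -
      have "\<bar>1 + v\<bar> * norm z0 \<le> 2 * norm z0" using v by (intro mult_right_mono) auto
      then show ?thesis unfolding z_def R_def norm_mult norm_of_real .
    qed
    have nzN: "norm (z / of_nat N) \<le> R / real N" using nz by (simp add: norm_divide divide_right_mono)
    have RN: "R / real N \<le> R" using N R0 divide_left_mono[of 1 "real N" R] by simp
    have "correction l 0 = 1" by (simp add: correction_def expm1_quot_def)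
    then have "norm (c - 1) \<le> Lc * norm (z / of_nat N)"
      unfolding c_def using Lc(2)[of "z / of_nat N" 0] nzN RN R0 by (simp add: dist_norm)
    also have "\<dots> \<le> Lc * (R / real N)" using nzN Lc by (intro mult_left_mono) auto
    finally have c1: "norm (c - 1) \<le> Lc * R / real N" by simp
    have "Lc * (R / real N) \<le> Lc * R" using RN Lc by (intro mult_left_mono) auto
    then have nc: "norm c \<le> Cc" using norm_triangle_ineq[of 1 "c - 1"] c1 by (simp add: Cc_def)
    have err: "norm (log_quot_error N z) \<le> B1 / real N" by (rule B1(2)[OF zS(1) N])
    have "B1 / real N \<le> B1" using N B1 divide_left_mono[of 1 "real N" B1] by simp
    then have errB: "norm (- log_quot_error N z) \<le> B1" using err by simp
    have "norm (e - exp 0) \<le> norm (- log_quot_error N z - 0) * exp B1"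
      unfolding e_def using complex_Re_le_cmod[of "- log_quot_error N z"] errB B1(1) by (intro norm_exp_diff_le) auto
    also have "\<dots> \<le> B1 / real N * exp B1" using err by (intro mult_right_mono) auto
    finally have e1: "norm (e - 1) \<le> B1 * exp B1 / real N" by simp
    have ne: "norm e \<le> exp B1"
      unfolding e_def using complex_Re_le_cmod[of "- log_quot_error N z"] errB by simp
    have am: "norm (amplitude l z - amplitude l z0) \<le> La * norm z0 * \<bar>v\<bar>"
    proof -
      have "z - z0 = of_real v * z0" by (simp add: z_def algebra_simps)
      then show ?thesis using La(2)[OF zS] by (simp add: norm_mult mult_ac)
    qed
    have "amplitude l z * c * e - amplitude l z0 = (amplitude l z - amplitude l z0) * c * e + amplitude l z0 * ((c - 1) * e + (e - 1))"
      by (simp add: algebra_simps)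
    also have "norm \<dots> \<le> norm ((amplitude l z - amplitude l z0) * c * e) + norm (amplitude l z0 * ((c - 1) * e + (e - 1)))"
      by (rule norm_triangle_ineq)
    also have "norm ((amplitude l z - amplitude l z0) * c * e) \<le> La * norm z0 * \<bar>v\<bar> * Cc * exp B1"
      unfolding norm_mult using am nc ne La Cc1 by (intro mult_mono) auto
    also have "norm (amplitude l z0 * ((c - 1) * e + (e - 1))) \<le> q * (Lc * R / real N * exp B1 + B1 * exp B1 / real N)"
    proof -
      have "norm ((c - 1) * e + (e - 1)) \<le> norm (c - 1) * norm e + norm (e - 1)"
        using norm_triangle_ineq[of "(c - 1) * e" "e - 1"] by (simp add: norm_mult)
      also have "\<dots> \<le> Lc * R / real N * exp B1 + B1 * exp B1 / real N"
        using c1 ne e1 Lc R0 by (intro add_mono mult_mono) auto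
      finally show ?thesis unfolding norm_mult q_def by (intro mult_left_mono) auto
    qed
    also have "La * norm z0 * \<bar>v\<bar> * Cc * exp B1 + q * (Lc * R / real N * exp B1 + B1 * exp B1 / real N)
       = (La * norm z0 * Cc * exp B1) * \<bar>v\<bar> + (q * (Lc * R * exp B1 + B1 * exp B1)) * (1 / real N)"
      by (simp add: algebra_simps add_divide_distrib)
    also have "\<dots> \<le> B * \<bar>v\<bar> + B * (1 / real N)"
    proof -
      have "La * norm z0 * Cc * exp B1 \<ge> 0" "q * (Lc * R * exp B1 + B1 * exp B1) \<ge> 0"
        using La Lc B1 R0 q0 Cc1 by (auto intro!: add_nonneg_nonneg mult_nonneg_nonneg)
      then show ?thesis unfolding B_def by (intro add_mono mult_right_mono) auto
    qed
    finally show "norm (amplitude l (ray (1 + v)) * correction l (ray (1 + v) / of_nat N) * exp (- log_quot_error N (ray (1 + v))) - amplitude l z0)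
      \<le> B * (\<bar>v\<bar> + 1 / real N)"
      unfolding z_def[symmetric] c_def[symmetric] e_def[symmetric] by (simp add: algebra_simps)
  qed
qed

text \<open>The factor z0 comes from dz = z0 dv, the Gaussian integral gives sqrt(pi) /
  \<open>csqrt curvature\<close>, and Stirling's formula gives 1/sqrt(2 pi).\<close>

definition saddle_constant :: "nat \<Rightarrow> complex" where
  "saddle_constant l = z0 * amplitude l z0 / (of_real (sqrt 2) * csqrt curvature)"

lemma one_minus_exp_z0_nonzero: "1 - exp z0 \<noteq> 0"
  using left_half_plane(4)[OF Re_z0_neg] .

text \<open>A number of positive real part has a principal root of argument below pi/4 in modulus.
  This settles a choice of sign in \<open>rho_factor\<close>.\<close>

lemma csqrt_curvature: "csqrt curvature \<noteq> 0" "Re (csqrt curvature) > \<bar>Im (csqrt curvature)\<bar>"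
proof -
  define s where "s = csqrt curvature"
  have s2: "s ^ 2 = curvature" by (simp add: s_def)
  have "(Re s)\<^sup>2 - (Im s)\<^sup>2 > 0" using Re_curvature unfolding s2[symmetric] by (simp add: power2_eq_square)
  then have "\<bar>Im s\<bar> < \<bar>Re s\<bar>" by (simp add: abs_le_square_iff not_le[symmetric])
  moreover have "Re s \<ge> 0" unfolding s_def by (rule Re_csqrt)
  ultimately show "Re (csqrt curvature) > \<bar>Im (csqrt curvature)\<bar>" by (simp add: s_def)
  then show "csqrt curvature \<noteq> 0" by auto
qed

lemma product_rate:
  fixes y :: "nat \<Rightarrow> complex" and x :: "nat \<Rightarrow> real"
  assumes x: "(\<lambda>N. x N - X) \<in> O(\<lambda>N. 1 / sqrt (real N))" and y: "(\<lambda>N. norm (y N - Y)) \<in> O(\<lambda>N. 1 / sqrt (real N))"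
  shows "(\<lambda>N. norm (of_real (x N) * y N - of_real X * Y)) \<in> O(\<lambda>N. 1 / sqrt (real N))"
proof -
  have x': "(\<lambda>N. \<bar>x N - X\<bar>) \<in> O(\<lambda>N. 1 / sqrt (real N))" using x by simp
  have one: "(\<lambda>N. 1 / sqrt (real N)) \<in> O(\<lambda>N. 1 :: real)" by real_asymp
  have "(\<lambda>N. \<bar>x N - X\<bar> * norm (y N - Y)) \<in> O(\<lambda>N. 1 / sqrt (real N) * 1)"
    by (intro landau_o.big.mult x' landau_o.big_trans[OF y one])
  moreover have "(\<lambda>N. \<bar>x N - X\<bar> * norm Y) \<in> O(\<lambda>N. 1 / sqrt (real N) * 1)"
    by (intro landau_o.big.mult x') simp
  moreover have "(\<lambda>N. norm (y N - Y) * \<bar>X\<bar>) \<in> O(\<lambda>N. 1 / sqrt (real N) * 1)"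
    by (intro landau_o.big.mult y) simp
  ultimately have big: "(\<lambda>N. \<bar>x N - X\<bar> * norm (y N - Y) + \<bar>x N - X\<bar> * norm Y + norm (y N - Y) * \<bar>X\<bar>) \<in> O(\<lambda>N. 1 / sqrt (real N))"
    by (intro sum_in_bigo) simp_all
  have le: "norm (of_real (x N) * y N - of_real X * Y) \<le> \<bar>x N - X\<bar> * norm (y N - Y) + \<bar>x N - X\<bar> * norm Y + norm (y N - Y) * \<bar>X\<bar>" for N
  proof -
    have "of_real (x N) * y N - of_real X * Y = of_real (x N - X) * (y N - Y) + of_real (x N - X) * Y + (y N - Y) * of_real X"
      by (simp add: algebra_simps)
    also have "norm \<dots> \<le> norm (of_real (x N - X) * (y N - Y)) + norm (of_real (x N - X) * Y) + norm ((y N - Y) * of_real X)"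
      by (intro norm_triangle_le add_right_mono norm_triangle_ineq)
    finally show ?thesis by (simp only: norm_mult norm_of_real)
  qed
  show ?thesis
    by (rule landau_o.big_trans[OF landau_o.big_mono big]) (use le in \<open>auto intro!: always_eventually order.trans[OF le abs_ge_self]\<close>)
qed

text \<open>At the saddle \<open>base z0\<close> is 1/(1 - e^(z0)), which explains the factor (1 -
  e^(z0))^N. Of the power N^(l+1), N^l is explicit in the integrand; the last N is shared between
  Stirling's formula and the Gaussian integral.\<close>

lemma saddle_segment_asymptotics:
  assumes l: "l \<ge> 1"
  obtains \<eta> where "0 < \<eta>" "\<eta> \<le> 1/4"
    "(\<lambda>N. norm (contour_integral (linepath (ray (1 - \<eta>)) (ray (1 + \<eta>))) (integrand l N) * (1 - exp z0) ^ N * of_nat N ^ Suc l - saddle_constant l))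
       \<in> O(\<lambda>N. 1 / sqrt (real N))"
proof -
  obtain M where M: "M \<ge> 0" "\<And>v. \<bar>v\<bar> \<le> 1/4 \<Longrightarrow>
    norm (phase (ray (1 + v)) - phase z0 + curvature * (of_real v)\<^sup>2) \<le> M * \<bar>v\<bar> ^ 3"
    by (rule phase_expansion) blast
  obtain B where B: "B \<ge> 0" "\<And>N v. N \<ge> 1 \<Longrightarrow> \<bar>v\<bar> \<le> 1/4 \<Longrightarrow>
    norm (amplitude l (ray (1 + v)) * correction l (ray (1 + v) / of_nat N) * exp (- log_quot_error N (ray (1 + v))) - amplitude l z0)
      \<le> B * (\<bar>v\<bar> + 1 / real N)"
    by (rule amplitude_correction_bound[OF l]) blast
  \<comment> \<open>Small enough for the Taylor bound and for the cubic remainder to use up at most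
    half of the Gaussian decay; M + 1 avoids division by zero.\<close>
  define \<eta> where "\<eta> = min (1/4) (Re curvature / (2 * (M + 1)))"
  have \<eta>: "0 < \<eta>" "\<eta> \<le> 1/4" using Re_curvature M by (simp_all add: \<eta>_def del: le_divide_eq_numeral1)
  have M\<eta>: "M * \<eta> \<le> Re curvature / 2"
  proof -
    have "M * \<eta> \<le> (M + 1) * (Re curvature / (2 * (M + 1)))"
      using M \<eta> by (intro mult_mono) (auto simp: \<eta>_def)
    also have "\<dots> = Re curvature / 2" using M by (simp add: field_simps)
    finally show ?thesis .
  qed
  define r where "r = (\<lambda>v. phase (ray (1 + v)) - phase z0)"
  define Q where "Q = (\<lambda>N v. amplitude l (ray (1 + v)) * correction l (ray (1 + v) / of_nat N) * exp (- log_quot_error N (ray (1 + v))))"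
  define J where "J = (\<lambda>N. integral {-\<eta>..\<eta>} (\<lambda>v. exp (of_nat N * r v) * Q N v))"
  have slit: "ray (1 + v) \<in> slit_domain - {0}" "Re (ray (1 + v)) < 0" if "v \<in> {-\<eta>..\<eta>}" for v
    using ray_in_slit[of "1 + v"] that \<eta> Re_z0_neg by (auto intro!: mult_pos_neg)
  have contray: "continuous_on {-\<eta>..\<eta>} (\<lambda>v. ray (1 + v))" by (intro continuous_intros)
  have contphase: "continuous_on {z. Re z < 0} phase"
    using phase_deriv by (intro DERIV_continuous_on) (auto intro: has_field_derivative_at_within)
  have contQ: "continuous_on {-\<eta>..\<eta>} (Q N)" if "N \<ge> 1" for N
    unfolding Q_def
  proof (intro continuous_intros)
    show "continuous_on {-\<eta>..\<eta>} (\<lambda>v. amplitude l (ray (1 + v)))"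
      using slit by (intro continuous_on_compose2[OF continuous_on_amplitude contray]) auto
    show "continuous_on {-\<eta>..\<eta>} (\<lambda>v. correction l (ray (1 + v) / of_nat N))"
      using that by (intro continuous_on_compose2[OF holomorphic_on_imp_continuous_on[OF holomorphic_correction[of l UNIV]]] continuous_intros contray) auto
    show "continuous_on {-\<eta>..\<eta>} (\<lambda>v. log_quot_error N (ray (1 + v)))"
      using slit by (intro continuous_on_compose2[OF continuous_on_log_quot_error contray]) auto
  qed
  have lap: "(\<lambda>N. norm (J N - amplitude l z0 * (of_real (sqrt (pi / real N)) / csqrt curvature))) \<in> O(\<lambda>N. 1 / real N)"
    unfolding J_def
  proof (rule laplace_segment[where M = M and B = B and ?N0.0 = 1])
    show "Re curvature > 0" by (rule Re_curvature)
    show "0 < \<eta>" "0 \<le> M" "M * \<eta> \<le> Re curvature / 2" "0 \<le> B" by (rule \<eta> M M\<eta> B)+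
    show "norm (r v + curvature * (of_real v)\<^sup>2) \<le> M * \<bar>v\<bar> ^ 3" if "\<bar>v\<bar> \<le> \<eta>" for v
      unfolding r_def using that \<eta> by (intro M) auto
    show "continuous_on {-\<eta>..\<eta>} r"
      unfolding r_def using slit by (intro continuous_intros continuous_on_compose2[OF contphase contray]) auto
    show "norm (Q N v - amplitude l z0) \<le> B * (\<bar>v\<bar> + 1 / real N)" if "1 \<le> N" "\<bar>v\<bar> \<le> \<eta>" for N v
      unfolding Q_def using that \<eta> by (intro B) auto
  qed (rule contQ)
  \<comment> \<open>\<open>x\<close> is the Stirling factor and \<open>y\<close>, defined next, is
    the Laplace integral, each scaled by sqrt(N) so as to converge with rate N^(-1/2).\<close>
  define x where "x = (\<lambda>N. real N ^ N * sqrt (real N) / (exp (real N) * fact N))"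
  define y where "y = (\<lambda>N. of_real (sqrt (real N)) * J N)"
  define Y where "Y = amplitude l z0 * (of_real (sqrt pi) / csqrt curvature)"
  have xrate: "(\<lambda>N. x N - 1 / sqrt (2 * pi)) \<in> O(\<lambda>N. 1 / sqrt (real N))"
  proof -
    have "(\<lambda>N. 1 / real N) \<in> O(\<lambda>N. 1 / sqrt (real N))" by real_asymp
    with stirling_bigo show ?thesis unfolding x_def by (rule landau_o.big_trans)
  qed
  have yrate: "(\<lambda>N. norm (y N - Y)) \<in> O(\<lambda>N. 1 / sqrt (real N))"
  proof -
    have "(\<lambda>N. sqrt (real N) * norm (J N - amplitude l z0 * (of_real (sqrt (pi / real N)) / csqrt curvature))) \<in> O(\<lambda>N. sqrt (real N) * (1 / real N))"
      by (intro landau_o.big.mult lap) simp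
    also have "(\<lambda>N. sqrt (real N) * (1 / real N)) \<in> O(\<lambda>N. 1 / sqrt (real N))" by real_asymp
    finally have big: "(\<lambda>N. sqrt (real N) * norm (J N - amplitude l z0 * (of_real (sqrt (pi / real N)) / csqrt curvature))) \<in> O(\<lambda>N. 1 / sqrt (real N))" .
    have "eventually (\<lambda>N. sqrt (real N) * norm (J N - amplitude l z0 * (of_real (sqrt (pi / real N)) / csqrt curvature)) = norm (y N - Y)) at_top"
      using eventually_ge_at_top[of 1]
    proof eventually_elim
      case (elim N)
      have "y N - Y = of_real (sqrt (real N)) * (J N - amplitude l z0 * (of_real (sqrt (pi / real N)) / csqrt curvature))"
        unfolding y_def Y_def real_sqrt_divide using elim by (simp add: algebra_simps)
      then show ?case by (simp add: norm_mult)
    qed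
    from landau_o.big.in_cong[OF this] big show ?thesis by blast
  qed
  have big: "(\<lambda>N. norm z0 * norm (of_real (x N) * y N - of_real (1 / sqrt (2 * pi)) * Y)) \<in> O(\<lambda>N. 1 / sqrt (real N))"
    using product_rate[OF xrate yrate] by (subst landau_o.big.cmult_in_iff) auto
  have ev: "eventually (\<lambda>N. norm z0 * norm (of_real (x N) * y N - of_real (1 / sqrt (2 * pi)) * Y) =
     norm (contour_integral (linepath (ray (1 - \<eta>)) (ray (1 + \<eta>))) (integrand l N) * (1 - exp z0) ^ N * of_nat N ^ Suc l - saddle_constant l)) at_top"
    using eventually_ge_at_top[of 1]
  proof eventually_elim
    case (elim N)
    have N: "N \<ge> 1" by (rule elim)
    define \<sigma> :: complex where "\<sigma> = of_real (real N ^ N / (exp (real N) * fact N)) / of_nat N ^ l * (1 / (1 - exp z0)) ^ N"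
    have int: "integrand l N (ray (1 + v)) = \<sigma> * (exp (of_nat N * r v) * Q N v)" if v: "v \<in> {-\<eta>..\<eta>}" for v
    proof -
      have "base (ray (1 + v)) ^ N = exp (of_nat N * phase (ray (1 + v)))"
        unfolding base_eq_exp_phase[OF slit(2)[OF v]] by (rule exp_of_nat_mult[symmetric])
      also have "of_nat N * phase (ray (1 + v)) = of_nat N * phase z0 + of_nat N * r v"
        by (simp add: r_def algebra_simps)
      also have "exp (of_nat N * phase z0 + of_nat N * r v) = exp (phase z0) ^ N * exp (of_nat N * r v)"
        by (simp only: exp_add exp_of_nat_mult)
      also have "exp (phase z0) = 1 / (1 - exp z0)"
        unfolding phase_z0 using one_minus_exp_z0_nonzero by (simp add: exp_minus inverse_eq_divide)
      finally have b: "base (ray (1 + v)) ^ N = (1 / (1 - exp z0)) ^ N * exp (of_nat N * r v)" .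
      have "integrand l N (ray (1 + v)) = of_real (real N ^ N / (exp (real N) * fact N)) / of_nat N ^ l * Q N v * ((1 / (1 - exp z0)) ^ N * exp (of_nat N * r v))"
        using integrand_eq[of "ray (1 + v)" N l] slit(1)[OF v] N l unfolding b Q_def by (simp only: mult.assoc) blast
      then show ?thesis unfolding \<sigma>_def by (simp only: mult_ac)
    qed
    have "continuous_on (closed_segment (ray (1 - \<eta>)) (ray (1 + \<eta>))) (integrand l N)"
      using ray_segment_slit[of "1 - \<eta>" "1 + \<eta>"] \<eta> by (intro continuous_on_subset[OF continuous_on_integrand[OF N]]) auto
    then have "contour_integral (linepath (ray (1 - \<eta>)) (ray (1 + \<eta>))) (integrand l N) = z0 * integral {-\<eta>..\<eta>} (\<lambda>v. integrand l N (ray (1 + v)))"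
      by (rule contour_integral_linepath_ray[OF _ \<eta>(1)])
    also have "integral {-\<eta>..\<eta>} (\<lambda>v. integrand l N (ray (1 + v))) = integral {-\<eta>..\<eta>} (\<lambda>v. \<sigma> * (exp (of_nat N * r v) * Q N v))"
      by (rule integral_cong[OF int])
    also have "\<dots> = \<sigma> * J N" unfolding J_def by (rule integral_mult_right)
    finally have ci: "contour_integral (linepath (ray (1 - \<eta>)) (ray (1 + \<eta>))) (integrand l N) = z0 * (\<sigma> * J N)" .
    have \<sigma>N: "\<sigma> * (1 - exp z0) ^ N * of_nat N ^ Suc l = of_real (x N) * of_real (sqrt (real N))"
    proof -
      have "\<sigma> * (1 - exp z0) ^ N * of_nat N ^ Suc l = of_real (real N ^ N / (exp (real N) * fact N)) * of_nat N"
        unfolding \<sigma>_def power_one_over power_Suc using N one_minus_exp_z0_nonzero by simp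
      also have "\<dots> = of_real (real N ^ N / (exp (real N) * fact N) * (sqrt (real N) * sqrt (real N)))" by simp
      also have "real N ^ N / (exp (real N) * fact N) * (sqrt (real N) * sqrt (real N)) = x N * sqrt (real N)"
        by (simp only: x_def times_divide_eq_left mult.assoc)
      finally show ?thesis by simp
    qed
    have sc: "saddle_constant l = z0 * (of_real (1 / sqrt (2 * pi)) * Y)"
      unfolding saddle_constant_def Y_def real_sqrt_mult by (simp add: field_simps)
    have "contour_integral (linepath (ray (1 - \<eta>)) (ray (1 + \<eta>))) (integrand l N) * (1 - exp z0) ^ N * of_nat N ^ Suc l - saddle_constant l
       = z0 * ((\<sigma> * (1 - exp z0) ^ N * of_nat N ^ Suc l) * J N) - z0 * (of_real (1 / sqrt (2 * pi)) * Y)"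
      unfolding ci sc by (simp only: mult_ac)
    also have "\<dots> = z0 * (of_real (x N) * y N - of_real (1 / sqrt (2 * pi)) * Y)"
      unfolding \<sigma>N y_def by (simp only: right_diff_distrib mult_ac)
    finally show ?case by (simp only: norm_mult)
  qed
  have "(\<lambda>N. norm (contour_integral (linepath (ray (1 - \<eta>)) (ray (1 + \<eta>))) (integrand l N) * (1 - exp z0) ^ N * of_nat N ^ Suc l - saddle_constant l))
       \<in> O(\<lambda>N. 1 / sqrt (real N))"
    using big unfolding landau_o.big.in_cong[OF ev] .
  with \<eta> show ?thesis by (rule that)
qed

text \<open>With \<open>\<alpha>\<close> the argument of e^(z0) / (z0 (1 - e^(z0))), the definition
  gives rho^2 = - e^(-i \<open>\<alpha>\<close>), which cancels the argument of the quotient and the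
  sign in front.\<close>

lemma rho_radicand:
  "- (z0 * (1 - exp z0)) / (rho ^ 2 * exp z0) = of_real (1 / norm (exp z0 / (z0 * (1 - exp z0))))"
proof -
  define \<beta> where "\<beta> = exp z0 / (z0 * (1 - exp z0))"
  define \<alpha> where "\<alpha> = Arg \<beta>"
  have \<beta>0: "\<beta> \<noteq> 0" using one_minus_exp_z0_nonzero by (simp add: \<beta>_def)
  have \<beta>: "\<beta> = of_real (norm \<beta>) * exp (\<i> * of_real \<alpha>)"
    unfolding \<alpha>_def by (rule Arg_eq[OF \<beta>0])
  have rho: "rho = exp (\<i> * of_real (pi / 2 - 1 / 2 * \<alpha>))" unfolding rho_def \<alpha>_def \<beta>_def ..
  have rho2: "rho ^ 2 = - exp (- (\<i> * of_real \<alpha>))"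
  proof -
    have "rho ^ 2 = exp (2 * (\<i> * of_real (pi / 2 - 1 / 2 * \<alpha>)))"
      unfolding rho by (simp only: exp_double)
    also have "2 * (\<i> * of_real (pi / 2 - 1 / 2 * \<alpha>)) = of_real pi * \<i> + - (\<i> * of_real \<alpha>)"
      by (simp add: algebra_simps)
    also have "exp \<dots> = - exp (- (\<i> * of_real \<alpha>))" unfolding exp_add exp_pi_i by simp
    finally show ?thesis .
  qed
  have "- (z0 * (1 - exp z0)) / (rho ^ 2 * exp z0) = - (1 / \<beta>) / rho ^ 2" by (simp add: \<beta>_def)
  also have "\<dots> = (1 / \<beta>) * exp (\<i> * of_real \<alpha>)"
    unfolding rho2 by (simp add: exp_minus divide_inverse)
  also have "\<dots> = of_real (1 / norm \<beta>)"
    by (subst \<beta>) (use \<beta>0 in simp)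
  finally show ?thesis unfolding \<beta>_def .
qed

text \<open>Both sides have the same square, so only a sign is open. The argument of
  \<open>rho\<close> lies in [0, pi), so the left side has nonnegative imaginary part; the right
  side has positive imaginary part.\<close>

lemma rho_factor: "csqrt (- (z0 * (1 - exp z0)) / (rho ^ 2 * exp z0)) * rho = z0 / (of_real (sqrt 2) * csqrt curvature)"
proof -
  define \<beta> where "\<beta> = exp z0 / (z0 * (1 - exp z0))"
  define \<alpha> where "\<alpha> = Arg \<beta>"
  have rho: "rho = exp (\<i> * of_real (pi / 2 - 1 / 2 * \<alpha>))" unfolding rho_def \<alpha>_def \<beta>_def ..
  have X: "- (z0 * (1 - exp z0)) / (rho ^ 2 * exp z0) = of_real (1 / norm \<beta>)"
    unfolding \<beta>_def by (rule rho_radicand)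
  define T where "T = z0 / (of_real (sqrt 2) * csqrt curvature)"
  define P where "P = csqrt (- (z0 * (1 - exp z0)) / (rho ^ 2 * exp z0)) * rho"
  have P: "P = of_real (sqrt (1 / norm \<beta>)) * rho"
    unfolding P_def X by (subst of_real_sqrt) auto
  have "T ^ 2 = P ^ 2"
  proof -
    have "T ^ 2 = z0 ^ 2 / (2 * curvature)"
      unfolding T_def power_divide power_mult_distrib of_real_power[symmetric] by simp
    also have "\<dots> = - (1 / \<beta>)" unfolding curvature_def \<beta>_def by (simp add: power2_eq_square field_simps)
    also have "\<dots> = of_real (1 / norm \<beta>) * rho ^ 2"
    proof -
      have "rho \<noteq> 0" unfolding rho by simp
      then have "- (1 / \<beta>) = - (z0 * (1 - exp z0)) / (rho ^ 2 * exp z0) * rho ^ 2" by (simp add: \<beta>_def)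
      then show ?thesis unfolding X .
    qed
    also have "\<dots> = P ^ 2" unfolding P power_mult_distrib of_real_power[symmetric] by simp
    finally show ?thesis .
  qed
  then have TP: "T = P \<or> T = - P" by (simp add: power2_eq_iff)
  have ImP: "Im P \<ge> 0"
  proof -
    have "Im rho = sin (pi / 2 - 1 / 2 * \<alpha>)" unfolding rho by (simp add: Im_exp)
    also have "\<dots> \<ge> 0" using Arg_bounded[of \<beta>] unfolding \<alpha>_def by (intro sin_ge_zero) auto
    finally show ?thesis unfolding P by simp
  qed
  \<comment> \<open>The argument of \<open>z0\<close> lies between pi/4 and 3 pi/4, since Im z0 >
    |Re z0|, and the root divided by has argument below pi/4 in modulus.\<close>
  have ImT: "Im T > 0"
  proof -
    define s where "s = csqrt curvature"
    have s: "Re s > \<bar>Im s\<bar>" "s \<noteq> 0" using csqrt_curvature by (auto simp: s_def)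
    have "Im z0 > \<bar>Re z0\<bar>" using z0_bounds by auto
    then have "\<bar>Re z0\<bar> * \<bar>Im s\<bar> < Im z0 * Re s" using s by (intro mult_strict_mono') auto
    then have "Re z0 * Im s < Im z0 * Re s" using abs_ge_self[of "Re z0 * Im s"] by (simp add: abs_mult)
    then have "Im (z0 / s) > 0" using s by (simp add: Im_divide cmod_power2[symmetric])
    moreover have "T = (z0 / s) / of_real (sqrt 2)" by (simp add: T_def s_def)
    ultimately show ?thesis by (simp only: Im_divide_of_real) simp
  qed
  have "T = P" using TP ImP ImT by auto
  then show ?thesis by (simp add: T_def P_def)
qed

text \<open>By \<open>log_quot_eq_Ln\<close> the factor exp(- \<open>log_quot z0\<close> / 2) is a
  quotient of principal roots of -z0 and 1 - e^(z0). The former completes the half-integer power,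
  and rewriting z0^(l-1) through -z0 gives the sign.\<close>

lemma saddle_constant_eq:
  assumes l: "l \<ge> 1"
  shows "saddle_constant l = (-1) ^ (l - 1) * csqrt (- (z0 * (1 - exp z0)) / (rho ^ 2 * exp z0)) *
     (rho * (- z0) powr (of_nat l - 1 / 2) / csqrt (1 - exp z0))"
proof -
  have "exp (- (log_quot z0 / 2)) = exp (Ln (- z0) / 2) / exp (Ln (1 - exp z0) / 2)"
    unfolding log_quot_eq_Ln[OF Re_z0_neg] by (simp add: exp_diff[symmetric] diff_divide_distrib)
  also have "exp (Ln (1 - exp z0) / 2) = csqrt (1 - exp z0)"
    using csqrt_exp_Ln[OF one_minus_exp_z0_nonzero] by simp
  finally have e: "exp (- (log_quot z0 / 2)) = exp (Ln (- z0) / 2) / csqrt (1 - exp z0)" .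
  have p: "(- z0) powr (of_nat l - 1 / 2) = (- z0) ^ (l - 1) * exp (Ln (- z0) / 2)"
  proof -
    have "(of_nat l - 1 / 2) * Ln (- z0) = of_nat (l - 1) * Ln (- z0) + Ln (- z0) / 2"
      using l by (simp add: of_nat_diff algebra_simps)
    then have "(- z0) powr (of_nat l - 1 / 2) = exp (of_nat (l - 1) * Ln (- z0) + Ln (- z0) / 2)"
      by (simp add: powr_def)
    also have "\<dots> = exp (Ln (- z0)) ^ (l - 1) * exp (Ln (- z0) / 2)"
      by (simp only: exp_add exp_of_nat_mult)
    finally show ?thesis by simp
  qed
  have z: "z0 ^ (l - 1) = (-1) ^ (l - 1) * (- z0) ^ (l - 1)"
    unfolding power_mult_distrib[symmetric] by simp
  have "saddle_constant l = amplitude l z0 * (z0 / (of_real (sqrt 2) * csqrt curvature))"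
    unfolding saddle_constant_def by simp
  also have "\<dots> = z0 ^ (l - 1) * (exp (Ln (- z0) / 2) / csqrt (1 - exp z0)) * (csqrt (- (z0 * (1 - exp z0)) / (rho ^ 2 * exp z0)) * rho)"
    unfolding rho_factor amplitude_def e ..
  finally show ?thesis unfolding p z by (simp only: times_divide_eq_left times_divide_eq_right mult_ac)
qed

section \<open>The asymptotic formula\<close>

lemma Arg_one_minus_exp_z0_nonzero: "Arg (1 - exp z0) \<noteq> 0"
  using z0_bounds(7) by (auto simp: Arg_eq_0 complex_is_Real_iff)

text \<open>Im w cos t - Re w sin t is the imaginary part of w e^(-it), and the radicand of the
  remaining root is positive. Boundedness and periodicity are then evident.\<close>

lemma H_eq:
  assumes "l \<ge> 1"
  shows "H l x = of_real (Im (saddle_constant l * exp (- (\<i> * of_real (x * Arg (1 - exp z0))))) / pi)"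
proof -
  define w where "w = rho * (- z0) powr (of_nat l - 1 / 2) / csqrt (1 - exp z0)"
  define r where "r = sqrt (1 / norm (exp z0 / (z0 * (1 - exp z0))))"
  define t where "t = x * Arg (1 - exp z0)"
  define \<sigma> :: real where "\<sigma> = (-1) ^ (l - 1)"
  have r: "csqrt (- (z0 * (1 - exp z0)) / (rho ^ 2 * exp z0)) = of_real r"
    unfolding rho_radicand r_def by (rule of_real_sqrt[symmetric]) simp
  have sc: "saddle_constant l = of_real (\<sigma> * r) * w"
    unfolding saddle_constant_eq[OF assms] r w_def \<sigma>_def by simp
  have "Im (saddle_constant l * exp (- (\<i> * of_real t))) = \<sigma> * r * (Im w * cos t - Re w * sin t)"
    unfolding sc by (simp add: Re_exp Im_exp algebra_simps)
  moreover have "H l x = of_real (\<sigma> / pi * r * (Im w * cos t - Re w * sin t))"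
    unfolding H_def Let_def r w_def[symmetric] t_def[symmetric] \<sigma>_def by simp
  ultimately show ?thesis unfolding t_def by simp
qed

lemma bounded_H:
  assumes "l \<ge> 1"
  shows "bounded (range (H l))"
proof -
  have "norm (H l x) \<le> norm (saddle_constant l) / pi" for x
  proof -
    have "norm (H l x) = \<bar>Im (saddle_constant l * exp (- (\<i> * of_real (x * Arg (1 - exp z0)))))\<bar> / pi"
      unfolding H_eq[OF assms] norm_of_real by simp
    also have "\<dots> \<le> norm (saddle_constant l * exp (- (\<i> * of_real (x * Arg (1 - exp z0))))) / pi"
      by (intro divide_right_mono abs_Im_le_cmod) simp
    finally show ?thesis by (simp add: norm_mult)
  qed
  then show ?thesis by (auto simp: bounded_iff)
qed

lemma p_pos: "p > 0"
  unfolding p_def using Arg_one_minus_exp_z0_nonzero by simp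

lemma H_periodic:
  assumes "l \<ge> 1"
  shows "H l (x + p) = H l x"
proof -
  define \<theta> where "\<theta> = Arg (1 - exp z0)"
  have "\<theta> \<noteq> 0" unfolding \<theta>_def by (rule Arg_one_minus_exp_z0_nonzero)
  then have p: "p * \<theta> = 2 * pi \<or> p * \<theta> = - (2 * pi)"
    unfolding p_def \<theta>_def[symmetric] by (auto simp: abs_if)
  have "exp (- (\<i> * of_real (p * \<theta>))) = cis (- (p * \<theta>))" by (simp add: cis_conv_exp)
  also have "\<dots> = 1" using p by (elim disjE; simp only: cis_conv_exp) (simp_all add: complex_eq_iff Re_exp Im_exp)
  finally have "exp (- (\<i> * of_real (p * \<theta>))) = 1" .
  moreover have "- (\<i> * of_real ((x + p) * \<theta>)) = - (\<i> * of_real (x * \<theta>)) + - (\<i> * of_real (p * \<theta>))"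
    by (simp add: algebra_simps)
  ultimately have "exp (- (\<i> * of_real ((x + p) * \<theta>))) = exp (- (\<i> * of_real (x * \<theta>)))"
    by (simp only: exp_add mult_1_right)
  then show ?thesis unfolding H_eq[OF assms] \<theta>_def by simp
qed

lemma main_term_eq:
  assumes "l \<ge> 1" "N \<ge> 1"
  shows "of_real (b ^ N * real N powr (- real l - 1)) * H l (real N) =
    of_real (Im (saddle_constant l / ((1 - exp z0) ^ N * of_nat N ^ Suc l)) / pi)"
proof -
  define \<theta> where "\<theta> = Arg (1 - exp z0)"
  define q where "q = 1 - exp z0"
  have q: "q = of_real (norm q) * exp (\<i> * of_real \<theta>)"
    unfolding \<theta>_def q_def by (rule Arg_eq[OF one_minus_exp_z0_nonzero])
  have "q ^ N = of_real (norm q ^ N) * exp (\<i> * of_real (real N * \<theta>))"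
    by (subst q) (simp add: power_mult_distrib exp_of_nat_mult[symmetric] mult_ac)
  then have "1 / q ^ N = of_real (b ^ N) * exp (- (\<i> * of_real (real N * \<theta>)))"
    by (simp add: b_def q_def[symmetric] exp_minus divide_inverse power_inverse)
  moreover have "real N powr (- real l - 1) = 1 / real N ^ Suc l"
  proof -
    have "- real l - 1 = - real (Suc l)" by simp
    then show ?thesis using assms by (simp only: powr_minus powr_realpow) (simp add: divide_inverse)
  qed
  ultimately have "saddle_constant l / (q ^ N * of_nat N ^ Suc l) =
      of_real (b ^ N * real N powr (- real l - 1)) * (saddle_constant l * exp (- (\<i> * of_real (real N * \<theta>))))"
    by (simp add: divide_inverse inverse_mult_distrib mult_ac)
  then have "Im (saddle_constant l / (q ^ N * of_nat N ^ Suc l)) =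
      b ^ N * real N powr (- real l - 1) * Im (saddle_constant l * exp (- (\<i> * of_real (real N * \<theta>))))"
    by (simp only: times_complex.sel Re_complex_of_real Im_complex_of_real mult_zero_left add_0_right)
  then show ?thesis unfolding H_eq[OF assms(1)] q_def \<theta>_def of_real_mult[symmetric]
    by (simp only: times_divide_eq_right)
qed

text \<open>The growth rate at \<open>z0\<close> is ln b, and the uniform gap below it gives an
  exponential factor that beats every power of N.\<close>

lemma segment_negligible:
  assumes "closed_segment u v \<subseteq> slit_domain - {0}" "l \<ge> 1"
    and "\<And>z. z \<in> closed_segment u v \<Longrightarrow> growth z < growth z0"
  shows "(\<lambda>N. norm (contour_integral (linepath u v) (integrand l N))) \<in> O(\<lambda>N. b ^ N * real N powr a)"
proof -
  obtain M \<delta> where M: "M \<ge> 0" "\<delta> > 0"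
     "\<And>N. N \<ge> 1 \<Longrightarrow> norm (contour_integral (linepath u v) (integrand l N)) \<le> M * exp (real N * (growth z0 - \<delta>))"
    using segment_small[OF assms] by metis
  have b: "b = exp (growth z0)"
    unfolding growth_z0 b_def using one_minus_exp_z0_nonzero by (simp add: exp_minus divide_inverse)
  have e: "exp (real N * (growth z0 - \<delta>)) = b ^ N * exp (- (real N * \<delta>))" for N
    unfolding b exp_of_nat_mult[symmetric] exp_add[symmetric] by (simp add: algebra_simps)
  have "(\<lambda>N. norm (contour_integral (linepath u v) (integrand l N))) \<in> O(\<lambda>N. exp (real N * (growth z0 - \<delta>)))"
    using M by (intro bigoI[of _ M] eventually_mono[OF eventually_ge_at_top[of 1]]) simp
  also have "(\<lambda>N. exp (- (real N * \<delta>))) \<in> O(\<lambda>N. real N powr a)"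
    using M(2) by real_asymp
  then have "(\<lambda>N. exp (real N * (growth z0 - \<delta>))) \<in> O(\<lambda>N. b ^ N * real N powr a)"
    unfolding e by (intro landau_o.big.mult) simp_all
  finally show ?thesis .
qed

text \<open>A conjugate pair contributes S - cnj S = 2 i Im S, and division by 2 pi i leaves Im S /
  pi. The middle piece of the ray is kept; the other pieces and the two vertical edges go into the
  error.\<close>

lemma C_eq_saddle:
  assumes N: "N \<ge> 1" "N \<ge> l" and l: "l \<ge> 1" and \<eta>: "0 < \<eta>" "\<eta> \<le> 1/4"
  defines "I \<equiv> \<lambda>u v. contour_integral (linepath u v) (integrand l N)"
  shows "norm (C 0 1 l N - of_real (Im (I (ray (1 - \<eta>)) (ray (1 + \<eta>))) / pi)) \<le>
     norm (I (Complex 4 (- y\<^sub>0)) (Complex 4 y\<^sub>0)) + norm (I (ray 20) (cnj (ray 20))) +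
     norm (I (Complex 4 y\<^sub>0) (ray s1)) + norm (I (ray s1) (ray (1 - \<eta>))) + norm (I (ray (1 + \<eta>)) (ray 20))"
proof -
  define A F E R S T where "A = I (Complex 4 (- y\<^sub>0)) (Complex 4 y\<^sub>0)" and "F = I (ray 20) (cnj (ray 20))"
    and "E = I (Complex 4 y\<^sub>0) (ray s1)" and "R = I (ray s1) (ray (1 - \<eta>))"
    and "S = I (ray (1 - \<eta>)) (ray (1 + \<eta>))" and "T = I (ray (1 + \<eta>)) (ray 20)"
  have cont: "continuous_on (closed_segment (ray c) (ray d)) (integrand l N)" if "0 < c" "c \<le> d" for c d
    by (rule continuous_on_subset[OF continuous_on_integrand[OF N(1)] ray_segment_slit[OF that]])
  have "I (ray s1) (ray 20) = R + I (ray (1 - \<eta>)) (ray 20)"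
    unfolding R_def I_def using s1_bounds \<eta>
    by (intro contour_integral_split_linepath cont ray_in_segment) auto
  also have "I (ray (1 - \<eta>)) (ray 20) = S + T"
    unfolding S_def T_def I_def using \<eta>
    by (intro contour_integral_split_linepath cont ray_in_segment) auto
  finally have split: "I (ray s1) (ray 20) = R + (S + T)" .
  have "2 * of_real pi * \<i> * C 0 1 l N = A + F + (E - cnj E) + (R + (S + T) - cnj (R + (S + T)))"
    using C_eq_segments[OF N l] unfolding split[symmetric] A_def F_def E_def I_def .
  also have "\<dots> = (A + F) + 2 * \<i> * of_real (Im E + Im R + Im T) + 2 * \<i> * of_real (Im S)"
    by (simp add: complex_eq_iff)
  finally have "C 0 1 l N = ((A + F) + 2 * \<i> * of_real (Im E + Im R + Im T) + 2 * \<i> * of_real (Im S)) / (2 * of_real pi * \<i>)"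
    by (simp add: nonzero_eq_divide_eq mult_ac)
  then have "C 0 1 l N - of_real (Im S / pi) = (A + F) / (2 * of_real pi * \<i>) + of_real ((Im E + Im R + Im T) / pi)"
    by (simp add: add_divide_distrib distrib_left)
  then have "norm (C 0 1 l N - of_real (Im S / pi)) \<le> norm ((A + F) / (2 * of_real pi * \<i>)) + norm (of_real ((Im E + Im R + Im T) / pi) :: complex)"
    by (metis norm_triangle_ineq)
  also have "norm ((A + F) / (2 * of_real pi * \<i>)) \<le> norm A + norm F"
  proof -
    have "norm ((A + F) / (2 * of_real pi * \<i>)) = norm (A + F) / (2 * pi)" by (simp add: norm_divide norm_mult)
    also have "\<dots> \<le> norm (A + F) / 1" using pi_gt3 by (intro divide_left_mono) auto
    finally show ?thesis using norm_triangle_ineq[of A F] by simp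
  qed
  also have "norm (of_real ((Im E + Im R + Im T) / pi) :: complex) \<le> norm E + norm R + norm T"
  proof -
    have "norm (of_real ((Im E + Im R + Im T) / pi) :: complex) = \<bar>Im E + Im R + Im T\<bar> / pi"
      unfolding norm_of_real by simp
    also have "\<dots> \<le> \<bar>Im E + Im R + Im T\<bar> / 1" using pi_gt3 by (intro divide_left_mono) auto
    also have "\<dots> \<le> \<bar>Im E\<bar> + \<bar>Im R\<bar> + \<bar>Im T\<bar>" by simp
    also have "\<dots> \<le> norm E + norm R + norm T" by (intro add_mono abs_Im_le_cmod)
    finally show ?thesis .
  qed
  finally show ?thesis unfolding A_def F_def E_def R_def S_def T_def by simp
qed

lemma C_asymptotics:
  assumes l: "l \<ge> 1"
  shows "(\<lambda>N::nat. norm (C 0 1 l N - of_real (b ^ N * real N powr (- real l - 1)) * H l (real N)))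
           \<in> O(\<lambda>N. b ^ N * real N powr (- real l - 117 / 112))"
proof -
  obtain \<eta> where \<eta>: "0 < \<eta>" "\<eta> \<le> 1/4" and sad:
    "(\<lambda>N. norm (contour_integral (linepath (ray (1 - \<eta>)) (ray (1 + \<eta>))) (integrand l N) * (1 - exp z0) ^ N * of_nat N ^ Suc l - saddle_constant l))
       \<in> O(\<lambda>N. 1 / sqrt (real N))"
    by (rule saddle_segment_asymptotics[OF l])
  define I where "I = (\<lambda>N u v. contour_integral (linepath u v) (integrand l N))"
  define d where "d = (\<lambda>N. norm (I N (ray (1 - \<eta>)) (ray (1 + \<eta>)) * (1 - exp z0) ^ N * of_nat N ^ Suc l - saddle_constant l))"
  define f where "f = (\<lambda>N. norm (I N (Complex 4 (- y\<^sub>0)) (Complex 4 y\<^sub>0)) + norm (I N (ray 20) (cnj (ray 20))) +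
     norm (I N (Complex 4 y\<^sub>0) (ray s1)) + norm (I N (ray s1) (ray (1 - \<eta>))) + norm (I N (ray (1 + \<eta>)) (ray 20)))"
  let ?g = "\<lambda>N. b ^ N * real N powr (- real l - 117 / 112)"
  \<comment> \<open>The estimates before and after s = 6/5 together cover the ray from
    \<open>s1\<close> on, apart from the saddle s = 1 itself.\<close>
  have gray: "growth z < growth z0"
    if asm: "z \<in> closed_segment (ray c) (ray e)" "s1 \<le> c" "c \<le> e" "\<And>s. c \<le> s \<Longrightarrow> s \<le> e \<Longrightarrow> s \<noteq> 1" for z c e
  proof -
    obtain s where s: "c \<le> s" "s \<le> e" "z = ray s" using ray_segment[OF asm(1,3)] by blast
    then show ?thesis using asm growth_ray_near[of s] growth_ray_far[of s] by (cases "s \<le> 6/5") auto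
  qed
  have "f \<in> O(?g)"
    unfolding f_def I_def
  proof (intro sum_in_bigo segment_negligible l)
    show "closed_segment (ray s1) (ray (1 - \<eta>)) \<subseteq> slit_domain - {0}"
      using s1_bounds \<eta> by (intro ray_segment_slit) auto
    show "closed_segment (ray (1 + \<eta>)) (ray 20) \<subseteq> slit_domain - {0}"
      using \<eta> by (intro ray_segment_slit) auto
    show "growth z < growth z0" if "z \<in> closed_segment (ray s1) (ray (1 - \<eta>))" for z
      by (rule gray[OF that]) (use s1_bounds \<eta> in auto)
    show "growth z < growth z0" if "z \<in> closed_segment (ray (1 + \<eta>)) (ray 20)" for z
      by (rule gray[OF that]) (use s1_bounds \<eta> in auto)
  qed (use horizontal_segment right_segment left_segment in blast)+
  moreover have "(\<lambda>N. d N * (b ^ N * real N powr (- real l - 1))) \<in> O(?g)"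
  proof -
    have "(\<lambda>N. d N * (b ^ N * real N powr (- real l - 1))) \<in> O(\<lambda>N. 1 / sqrt (real N) * (b ^ N * real N powr (- real l - 1)))"
      unfolding d_def I_def by (rule landau_o.big.mult[OF sad]) simp
    \<comment> \<open>The exponent obtained is -l - 3/2, which lies below -l - 117/112.\<close>
    also have "(\<lambda>N. 1 / sqrt (real N) * real N powr (- real l - 1)) \<in> O(\<lambda>N. real N powr (- real l - 117 / 112))"
      by real_asymp
    then have "(\<lambda>N. b ^ N * (1 / sqrt (real N) * real N powr (- real l - 1))) \<in> O(?g)"
      by (intro landau_o.big.mult) simp_all
    then have "(\<lambda>N. 1 / sqrt (real N) * (b ^ N * real N powr (- real l - 1))) \<in> O(?g)"
      by (simp only: mult.left_commute)
    finally show ?thesis .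
  qed
  ultimately have big: "(\<lambda>N. f N + d N * (b ^ N * real N powr (- real l - 1))) \<in> O(?g)"
    by (rule sum_in_bigo)
  have le: "norm (C 0 1 l N - of_real (b ^ N * real N powr (- real l - 1)) * H l (real N)) \<le> f N + d N * (b ^ N * real N powr (- real l - 1))"
    if N: "N \<ge> 1" "N \<ge> l" for N
  proof -
    define S where "S = I N (ray (1 - \<eta>)) (ray (1 + \<eta>))"
    define D where "D = (1 - exp z0) ^ N * of_nat N ^ Suc l"
    have D0: "D \<noteq> 0" using one_minus_exp_z0_nonzero N by (simp add: D_def)
    have nD: "1 / norm D = b ^ N * real N powr (- real l - 1)"
    proof -
      have "- real l - 1 = - real (Suc l)" by simp
      then have "real N powr (- real l - 1) = 1 / real N ^ Suc l"
        using N by (simp only: powr_minus powr_realpow) (simp add: divide_inverse)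
      then show ?thesis by (simp add: D_def b_def norm_mult norm_power power_divide)
    qed
    have "norm (of_real (Im S / pi) - of_real (Im (saddle_constant l / D) / pi) :: complex) = \<bar>Im (S - saddle_constant l / D)\<bar> / pi"
      unfolding of_real_diff[symmetric] norm_of_real diff_divide_distrib[symmetric] by simp
    also have "\<dots> \<le> \<bar>Im (S - saddle_constant l / D)\<bar> / 1" using pi_gt3 by (intro divide_left_mono) auto
    also have "\<dots> \<le> norm (S - saddle_constant l / D)" using abs_Im_le_cmod[of "S - saddle_constant l / D"] by simp
    also have "S - saddle_constant l / D = (S * D - saddle_constant l) / D" using D0 by (simp add: diff_divide_distrib)
    also have "norm \<dots> = d N * (b ^ N * real N powr (- real l - 1))"
      unfolding nD[symmetric] d_def S_def[symmetric] D_def[symmetric] by (simp add: norm_divide D_def mult.assoc)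
    finally have "norm (of_real (Im S / pi) - of_real (Im (saddle_constant l / D) / pi) :: complex) \<le> d N * (b ^ N * real N powr (- real l - 1))" .
    moreover have "norm (C 0 1 l N - of_real (Im S / pi)) \<le> f N"
      unfolding S_def f_def I_def by (rule C_eq_saddle[OF N l \<eta>])
    ultimately show ?thesis
      unfolding main_term_eq[OF l N(1)] D_def[symmetric] by (rule norm_diff_triangle_le[rotated])
  qed
  have "(\<lambda>N::nat. norm (C 0 1 l N - of_real (b ^ N * real N powr (- real l - 1)) * H l (real N)))
           \<in> O(\<lambda>N. f N + d N * (b ^ N * real N powr (- real l - 1)))"
    by (intro landau_o.big_mono eventually_mono[OF eventually_ge_at_top[of "max 1 l"]])
       (simp only: real_norm_def abs_norm_cancel max.bounded_iff, elim conjE, rule order.trans[OF le abs_ge_self])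
  then show ?thesis using big by (rule landau_o.big_trans)
qed

theorem theorem1:
  fixes l :: nat
  assumes "l \<ge> 1"
  shows "bounded (range (H l)) \<and>
         p > 0 \<and> (\<forall>x. H l (x + p) = H l x) \<and>
         (\<lambda>N::nat. norm (C 0 1 l N - of_real (b ^ N * real N powr (- real l - 1)) * H l (real N)))
           \<in> O(\<lambda>N. b ^ N * real N powr (- real l - 117 / 112))"
  using bounded_H[OF assms] p_pos H_periodic[OF assms] C_asymptotics[OF assms] by blast

end
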